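(* Suppose that $X$ is a weakly irreducible, critical multitype Galton-Watson tree with finite type set $\mathcal X$ and offspring kernel $\mathbb Q$ all of whose exponential moments are finite (i.e. $\mathbb Q\{e^{\eta N}\,|\,a\}<\infty$ for all $a\in\mathcal X$, $\eta>0$), and that $S=\{n\in\mathbb N:\mathbb P\{|T|=n\}>0\}$ is infinite. Condition $X$ to have exactly $n$ vertices. Then, as $n\to\infty$ with $n\in S$, the empirical offspring measure $M_X$ satisfies a large deviation principle in $\mathcal M(\mathcal X\times\mathcal X^* )$ with speed $n$ and the convex, good rate function $$J(\nu)=\begin{cases}H(\nu\,\|\,\nu_1\otimes\mathbb Q)&\text{if }\nu\text{ is shift-invariant},\\ \infty&\text{otherwise.}\end{cases}$$
   Context: $\mathcal X$ is a finite set of types; $\mathcal X^*=\bigcup_{n\ge0}\{n\}\times\mathcal X^n$ with the discrete topology, containing $(0,\emptyset)$ (no offspring). For $c=(n,a_1,\dots,a_n)\in\mathcal X^*$ and $a\in\mathcal X$, $m(a,c)=\sum_{i=1}^n\mathbf 1_{\{a_i=a\}}$. Multitype Galton-Watson tree (law $\mathbb P$): a random rooted planar typed tree. The root has type drawn from an initial probability measure on $\mathcal X$; each vertex of type $a$, independently of everything else, has an ordered family of children whose number and types $(N,X_1,\dots,X_N)$ are drawn from $\mathbb Q\{\cdot\,|\,a\}$, a probability measure on $\mathcal X^*$. $T$ is the underlying tree, $V$ its vertex set, $|T|$ its number of vertices, $X(v)$ the type of $v$, and $C(v)=(N(v),X_1(v),\dots,X_{N(v)}(v))\in\mathcal X^*$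 the number and types (left to right) of the children of $v$. Let $A(a,b)=\sum_{c\in\mathcal X^*}\mathbb Q\{c\,|\,b\}\,m(a,c)$ and $A^*(a,b)=\sum_{k\ge1}A^k(a,b)\in[0,\infty]$. The matrix $A$ is weakly irreducible if $\mathcal X$ is the disjoint union of a nonempty set $\mathcal X_r$ (recurrent states) and a set $\mathcal X_t$ (transient states) such that $A^*(a,b)>0$ whenever $b\in\mathcal X_r$, and $A^*(a,b)=0$ whenever $b\in\mathcal X_t$ and either $a=b$ or $a\in\mathcal X_r$. The multitype Galton-Watson tree is weakly irreducible if $A$ is weakly irreducible and $\sum_{a\in\mathcal X_t}m(a,c)$ is uniformly bounded over all $c$ with $\mathbb Q\{c\,|\,b\}>0$ for some $b$. It is critical if the largest eigenvalue of $A$ (real and positive by Perron-Frobenius) is $1$. Empirical offspring measure: $M_X(a,c)=\frac1{|T|}\sum_{v\in V}\delta_{(X(v),C(v))}(a,c)$. $\mathcal M(\mathcal X\times\mathcal X^* )$ is the space of probability measures $\nu$ on $\mathcal X\times\mathcal X^*$ with $\int n\,\nu(da,dc)<\infty$ (where $c=(n,a_1,\dots,a_n)$), with the smallest topology making $\nu\mapsto\int f\,d\nu$ continuous for every bounded $f:\mathcal X\times\mathcal X^*\to\mathbb R$ and for every $f(b,c)=m(a,c)\mathbf 1_{b_0}(b)$, $a,b_0\in\mathcal X$. For such $\nu$, $\nu_1$ is the $\mathcal X$-marginal, $\nu_1\otimes\mathbb Q(a,c)=\nu_1(a)\mathbb Q\{c\,|\,a\}$, and $\nu$ is shift-invariant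 if $\nu_1(a)=\sum_{(b,c)}m(a,c)\nu(b,c)$ for all $a\in\mathcal X$. $H$ is relative entropy. *)

theory Defs
  imports "HOL-Probability.Probability"
begin

section \<open>Typed planar trees and the Galton-Watson law\<close>

text \<open>
  The finite type set is a type of class \<open>finite\<close>.  An element \<open>(n, a\<^sub>1, \<dots>, a\<^sub>n)\<close> of the
  offspring space is the list of the \<open>a\<^sub>i\<close>, so \<open>n\<close> is its length, the list \<open>[]\<close> stands for no
  offspring, and \<open>m(a, c)\<close> is \<open>count_list c a\<close>.

  A typed planar tree is a partial function from vertex addresses to types (Ulam-Harris labelling).
  Addresses are read from right to left: \<open>[]\<close> is the root and \<open>i # v\<close> is the \<open>i\<close>-th child of \<open>v\<close>
  (from the left, counting from 0).  Trees may be infinite.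
\<close>

type_synonym 'a typed_tree = "nat list \<Rightarrow> 'a option"

definition vertices :: "'a typed_tree \<Rightarrow> nat list set" where
  "vertices t = dom t"

definition vertex_type :: "'a typed_tree \<Rightarrow> nat list \<Rightarrow> 'a" where
  "vertex_type t v = the (t v)"

definition offspring :: "'a typed_tree \<Rightarrow> nat list \<Rightarrow> 'a list" where
  "offspring t v = map (\<lambda>i. vertex_type t (i # v)) [0..<card {i. i # v \<in> vertices t}]"

definition tree_size :: "'a typed_tree \<Rightarrow> enat" where
  "tree_size t = (if finite (vertices t) then enat (card (vertices t)) else \<infinity>)"

text \<open>
  The tree grown from a root type \<open>r\<close> when a vertex \<open>v\<close> of type \<open>a\<close> receives the children \<open>\<xi> (v, a)\<close>.
\<close>

primrec grow :: "'a \<times> (nat list \<times> 'a \<Rightarrow> 'a list) \<Rightarrow> 'a typed_tree" where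
  "grow \<omega> [] = Some (fst \<omega>)"
| "grow \<omega> (i # v) =
    (case grow \<omega> v of
       None \<Rightarrow> None
     | Some a \<Rightarrow> if i < length (snd \<omega> (v, a)) then Some (snd \<omega> (v, a) ! i) else None)"

text \<open>
  The law of the multitype Galton-Watson tree with initial distribution \<open>\<mu>\<close> and offspring kernel
  \<open>Q\<close>: the root type and all offspring lists \<open>\<xi> (v, a)\<close> are independent, with laws \<open>\<mu>\<close> and \<open>Q a\<close>.
\<close>

definition gw_source ::
  "'a pmf \<Rightarrow> ('a \<Rightarrow> 'a list pmf) \<Rightarrow> ('a \<times> (nat list \<times> 'a \<Rightarrow> 'a list)) measure" where
  "gw_source \<mu> Q = measure_pmf \<mu> \<Otimes>\<^sub>M (\<Pi>\<^sub>M (v, a)\<in>UNIV. measure_pmf (Q a))"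

definition gw_law :: "'a pmf \<Rightarrow> ('a \<Rightarrow> 'a list pmf) \<Rightarrow> 'a typed_tree measure" where
  "gw_law \<mu> Q = distr (gw_source \<mu> Q) (\<Pi>\<^sub>M v\<in>UNIV. count_space UNIV) grow"

lemma offspring_grow:
  assumes "v \<in> vertices (grow \<omega>)"
  shows "offspring (grow \<omega>) v = snd \<omega> (v, vertex_type (grow \<omega>) v)"
proof -
  obtain a where a: "grow \<omega> v = Some a"
    using assms by (auto simp: vertices_def)
  let ?c = "snd \<omega> (v, a)"
  have "{i. i # v \<in> vertices (grow \<omega>)} = {..<length ?c}"
    by (auto simp: vertices_def a dom_def)
  then have "offspring (grow \<omega>) v = map (\<lambda>i. vertex_type (grow \<omega>) (i # v)) [0..<length ?c]"
    by (simp add: offspring_def)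
  also have "\<dots> = map ((!) ?c) [0..<length ?c]"
    by (rule map_cong) (auto simp: vertex_type_def a)
  also have "\<dots> = ?c"
    by (rule map_nth)
  finally show ?thesis
    by (simp add: vertex_type_def a)
qed

lemma measurable_grow:
  fixes \<mu> :: "'a::countable pmf"
  shows "grow \<in> measurable (gw_source \<mu> Q) (\<Pi>\<^sub>M v\<in>UNIV. count_space UNIV)"
proof -
  have *: "(\<lambda>\<omega>. grow \<omega> v) \<in> measurable (gw_source \<mu> Q) (count_space UNIV)" for v
  proof (induction v)
    case Nil
    have "(\<lambda>\<omega>. Some (fst \<omega>)) \<in> measurable (gw_source \<mu> Q) (count_space UNIV)"
      unfolding gw_source_def
      by (rule measurable_compose[OF measurable_fst]) simp
    then show ?case by simp
  next
    case (Cons i v)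
    have sel: "(\<lambda>\<omega>. snd \<omega> (v, a)) \<in> measurable (gw_source \<mu> Q) (count_space UNIV)" for a
    proof -
      have "(\<lambda>f. f (v, a)) \<in> measurable
          (\<Pi>\<^sub>M (v, a)\<in>UNIV. measure_pmf (Q a)) (measure_pmf (Q a))"
        using measurable_component_singleton[of "(v, a)" UNIV "\<lambda>(v, a). measure_pmf (Q a)"]
        by simp
      from measurable_compose[OF measurable_snd this] show ?thesis
        unfolding gw_source_def by (simp add: measurable_def)
    qed
    have step: "(\<lambda>\<omega>. case x of None \<Rightarrow> None | Some a \<Rightarrow>
        if i < length (snd \<omega> (v, a)) then Some (snd \<omega> (v, a) ! i) else None)
      \<in> measurable (gw_source \<mu> Q) (count_space UNIV)" for x
    proof (cases x)
      case (Some a)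
      show ?thesis
        using measurable_compose[OF sel[of a], of
            "\<lambda>c. if i < length c then Some (c ! i) else None" "count_space UNIV"]
        by (simp add: Some)
    qed simp
    show ?case
      using measurable_compose_countable[OF step Cons.IH] by simp
  qed
  show ?thesis
    by (rule measurable_PiM_single') (use * in auto)
qed

definition empirical_offspring_measure :: "'a typed_tree \<Rightarrow> ('a \<times> 'a list) pmf" where
  "empirical_offspring_measure t =
     map_pmf (\<lambda>v. (vertex_type t v, offspring t v)) (pmf_of_set (vertices t))"

lemma pmf_empirical_offspring_measure:
  assumes "finite (vertices t)" and "vertices t \<noteq> {}"
  shows "pmf (empirical_offspring_measure t) (a, c) =
    (\<Sum>v\<in>vertices t. indicator {(a, c)} (vertex_type t v, offspring t v)) / real (card (vertices t))"
proof -
  have "(\<Sum>v\<in>vertices t. indicator {(a, c)} (vertex_type t v, offspring t v) :: real)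
      = real (card (vertices t \<inter> (\<lambda>v. (vertex_type t v, offspring t v)) -` {(a, c)}))"
    using assms(1) by (simp add: indicator_def sum.If_cases vimage_def Int_def)
  then show ?thesis
    using assms by (simp add: empirical_offspring_measure_def pmf_map measure_pmf_of_set)
qed


section \<open>Mean matrix, weak irreducibility, criticality\<close>

text \<open>
  In \<open>A $ a $ b\<close> the column index \<open>b\<close> is the type of the parent.  The Bochner integral is the
  intended one only if the mean offspring number is finite.
\<close>

definition mean_matrix :: "('a::finite \<Rightarrow> 'a list pmf) \<Rightarrow> real^'a^'a" where
  "mean_matrix Q = (\<chi> a b. measure_pmf.expectation (Q b) (\<lambda>c. real (count_list c a)))"

text \<open>The overloaded power on \<open>real^'a^'a\<close> would be entrywise, hence an explicit matrix power.\<close>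

primrec matrix_power :: "real^'a^'a \<Rightarrow> nat \<Rightarrow> real^'a^'a" where
  "matrix_power A 0 = mat 1"
| "matrix_power A (Suc k) = A ** matrix_power A k"

definition matrix_star :: "real^'a^'a \<Rightarrow> 'a \<Rightarrow> 'a::finite \<Rightarrow> ennreal" where
  "matrix_star A a b = (\<Sum>k. ennreal (matrix_power A (Suc k) $ a $ b))"

definition weakly_irreducible_wrt :: "real^'a^'a \<Rightarrow> 'a set \<Rightarrow> 'a::finite set \<Rightarrow> bool" where
  "weakly_irreducible_wrt A Xr Xt \<longleftrightarrow>
     Xr \<union> Xt = UNIV \<and> Xr \<inter> Xt = {} \<and> Xr \<noteq> {} \<and>
     (\<forall>a. \<forall>b\<in>Xr. matrix_star A a b > 0) \<and>
     (\<forall>a. \<forall>b\<in>Xt. a = b \<or> a \<in> Xr \<longrightarrow> matrix_star A a b = 0)"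

definition weakly_irreducible_gw :: "('a::finite \<Rightarrow> 'a list pmf) \<Rightarrow> bool" where
  "weakly_irreducible_gw Q \<longleftrightarrow>
     (\<exists>Xr Xt. weakly_irreducible_wrt (mean_matrix Q) Xr Xt \<and>
        (\<exists>K. \<forall>b. \<forall>c\<in>set_pmf (Q b). (\<Sum>a\<in>Xt. count_list c a) \<le> K))"

definition is_eigenvalue :: "complex^'a^'a \<Rightarrow> complex \<Rightarrow> bool" where
  "is_eigenvalue A z \<longleftrightarrow> (\<exists>x. x \<noteq> 0 \<and> A *v x = z *s x)"

text \<open>
  As usual for the Perron-Frobenius eigenvalue, \<^emph>\<open>largest\<close> is meant with respect to the modulus,
  among all complex eigenvalues.
\<close>

definition is_largest_eigenvalue :: "real^'a^'a \<Rightarrow> real \<Rightarrow> bool" where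
  "is_largest_eigenvalue A r \<longleftrightarrow>
     (let B = (\<chi> a b. complex_of_real (A $ a $ b)) in
        is_eigenvalue B (complex_of_real r) \<and> (\<forall>z. is_eigenvalue B z \<longrightarrow> cmod z \<le> r))"

definition critical_gw :: "('a::finite \<Rightarrow> 'a list pmf) \<Rightarrow> bool" where
  "critical_gw Q \<longleftrightarrow> is_largest_eigenvalue (mean_matrix Q) 1"

definition finite_exponential_moments :: "('a \<Rightarrow> 'a list pmf) \<Rightarrow> bool" where
  "finite_exponential_moments Q \<longleftrightarrow>
     (\<forall>a. \<forall>\<eta>>0. (\<integral>\<^sup>+ c. ennreal (exp (\<eta> * real (length c))) \<partial>measure_pmf (Q a)) < \<infinity>)"


section \<open>The space of offspring measures\<close>

definition offspring_measures :: "('a \<times> 'a list) pmf set" where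
  "offspring_measures = {\<nu>. (\<integral>\<^sup>+ (a, c). ennreal (real (length c)) \<partial>measure_pmf \<nu>) < \<infinity>}"

definition offspring_test_functions :: "('a \<times> 'a list \<Rightarrow> real) set" where
  "offspring_test_functions =
     {f. bounded (range f)} \<union>
     {f. \<exists>a b\<^sub>0. f = (\<lambda>(b, c). real (count_list c a) * indicator {b\<^sub>0} b)}"

text \<open>The initial topology of the maps \<open>\<nu> \<mapsto> \<integral>f d\<nu>\<close> with \<open>f\<close> a test function.\<close>

definition offspring_topology :: "('a \<times> 'a list) pmf topology" where
  "offspring_topology = topology_generated_by
     {{\<nu> \<in> offspring_measures. measure_pmf.expectation \<nu> f \<in> U} | f U.
        f \<in> offspring_test_functions \<and> open U}"

lemma topspace_offspring_topology: "topspace offspring_topology = offspring_measures"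
proof -
  have "offspring_measures \<in>
     {{\<nu> \<in> offspring_measures. measure_pmf.expectation \<nu> f \<in> U} | f U.
        f \<in> offspring_test_functions \<and> open U}"
    by (rule CollectI, rule exI[of _ "\<lambda>_. 0"], rule exI[of _ UNIV])
       (auto simp: offspring_test_functions_def)
  then show ?thesis
    unfolding offspring_topology_def topology_generated_by_topspace by blast
qed

definition type_marginal :: "('a \<times> 'a list) pmf \<Rightarrow> 'a pmf" where
  "type_marginal \<nu> = map_pmf fst \<nu>"

definition kernel_product :: "'a pmf \<Rightarrow> ('a \<Rightarrow> 'a list pmf) \<Rightarrow> ('a \<times> 'a list) pmf" where
  "kernel_product \<mu> Q = bind_pmf \<mu> (\<lambda>a. map_pmf (Pair a) (Q a))"

lemma pmf_kernel_product: "pmf (kernel_product \<mu> Q) (a, c) = pmf \<mu> a * pmf (Q a) c"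
proof -
  have "pmf (map_pmf (Pair b) (Q b)) (a, c) = indicator {a} b * pmf (Q a) c" for b
    by (cases "b = a") (auto simp: pmf_map_inj' inj_def pmf_eq_0_set_pmf)
  then have "pmf (kernel_product \<mu> Q) (a, c) =
      measure_pmf.expectation \<mu> (\<lambda>b. indicator {a} b * pmf (Q a) c)"
    by (simp add: kernel_product_def pmf_bind)
  then show ?thesis
    by (simp add: measure_pmf_single)
qed

definition shift_invariant :: "('a \<times> 'a list) pmf \<Rightarrow> bool" where
  "shift_invariant \<nu> \<longleftrightarrow>
     (\<forall>a. pmf (type_marginal \<nu>) a =
        measure_pmf.expectation \<nu> (\<lambda>(b, c). real (count_list c a)))"

text \<open>
  \<open>KL_divergence b M N\<close> is the integral of \<open>log b (dN/dM)\<close> under \<open>N\<close>; it is meaningful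
  only if \<open>N\<close> is absolutely continuous with respect to \<open>M\<close> and the integral converges, and since
  the negative part is always integrable, the relative entropy is infinite in all other cases.
\<close>

definition relative_entropy :: "'b pmf \<Rightarrow> 'b pmf \<Rightarrow> ereal" where
  "relative_entropy \<nu> \<mu> =
     (if absolutely_continuous (measure_pmf \<mu>) (measure_pmf \<nu>) \<and>
         integrable (measure_pmf \<nu>) (entropy_density (exp 1) (measure_pmf \<mu>) (measure_pmf \<nu>))
      then ereal (KL_divergence (exp 1) (measure_pmf \<mu>) (measure_pmf \<nu>))
      else \<infinity>)"

definition offspring_rate :: "('a \<Rightarrow> 'a list pmf) \<Rightarrow> ('a \<times> 'a list) pmf \<Rightarrow> ereal" where
  "offspring_rate Q \<nu> =
     (if shift_invariant \<nu> then relative_entropy \<nu> (kernel_product (type_marginal \<nu>) Q) else \<infinity>)"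


section \<open>Large deviation principles\<close>

definition rate_function :: "'b topology \<Rightarrow> ('b \<Rightarrow> ereal) \<Rightarrow> bool" where
  "rate_function T I \<longleftrightarrow>
     (\<forall>x\<in>topspace T. 0 \<le> I x) \<and> (\<forall>\<alpha>::real. closedin T {x \<in> topspace T. I x \<le> ereal \<alpha>})"

definition good_rate_function :: "'b topology \<Rightarrow> ('b \<Rightarrow> ereal) \<Rightarrow> bool" where
  "good_rate_function T I \<longleftrightarrow>
     rate_function T I \<and> (\<forall>\<alpha>::real. compactin T {x \<in> topspace T. I x \<le> ereal \<alpha>})"

text \<open>Convexity on a set of probability mass functions; note that \<open>0 * \<infinity> = 0\<close> in \<open>ereal\<close>.\<close>

definition convex_on_pmfs :: "'b pmf set \<Rightarrow> ('b pmf \<Rightarrow> ereal) \<Rightarrow> bool" where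
  "convex_on_pmfs S I \<longleftrightarrow>
     (\<forall>\<nu>\<in>S. \<forall>\<nu>\<^sub>0\<in>S. \<forall>\<nu>\<^sub>1\<in>S. \<forall>s\<in>{0..1}.
        (\<forall>x. pmf \<nu> x = (1 - s) * pmf \<nu>\<^sub>0 x + s * pmf \<nu>\<^sub>1 x) \<longrightarrow>
        I \<nu> \<le> ereal (1 - s) * I \<nu>\<^sub>0 + ereal s * I \<nu>\<^sub>1)"

text \<open>The library has \<open>ln 0 = 0\<close>, but logarithms of null probabilities must be \<open>-\<infinity>\<close>.\<close>

definition log_prob :: "real \<Rightarrow> ereal" where
  "log_prob p = (if p \<le> 0 then -\<infinity> else ereal (ln p))"

text \<open>
  \<open>P n B\<close> is the probability of \<open>B\<close> under the \<open>n\<close>-th law; only \<open>n \<in> S\<close> are considered, and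
  \<open>n\<close> tends to infinity within \<open>S\<close>.
\<close>

definition large_deviation_principle ::
  "'b topology \<Rightarrow> nat set \<Rightarrow> (nat \<Rightarrow> 'b set \<Rightarrow> real) \<Rightarrow> (nat \<Rightarrow> real) \<Rightarrow> ('b \<Rightarrow> ereal) \<Rightarrow> bool" where
  "large_deviation_principle T S P speed I \<longleftrightarrow>
     rate_function T I \<and>
     (\<forall>F. closedin T F \<longrightarrow>
        Limsup (inf at_top (principal S)) (\<lambda>n. ereal (1 / speed n) * log_prob (P n F))
          \<le> - (INF x\<in>F. I x)) \<and>
     (\<forall>G. openin T G \<longrightarrow>
        - (INF x\<in>G. I x)
          \<le> Liminf (inf at_top (principal S)) (\<lambda>n. ereal (1 / speed n) * log_prob (P n G)))"

end

(*
  Summing over the finitely many trees of size n with root type a turns every probability in the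
  statement into a finite sum of products of offspring probabilities.

  Upper bound.  If f is bounded and each expectation of exp (f (a, _)) under Q a is at most 1, then
  multiplying the offspring probabilities by exp f gives a sub-probability, which is Chernoff's
  bound for the empirical measure M.  The supremum of the integrals of such f is the relative
  entropy; this formula also gives lower semicontinuity, convexity and compact level sets.
  Shift-invariance enters because M is shift-invariant up to an error 1/n.

  Lower bound.  A measure nu of finite rate is approximated by finitely supported, shift-invariant
  ones.  For the kernel Q' = nu( _ | a), the generating functions T a of the weights exp (s n) with
  s > 0 cannot all converge: Jensen's inequality for T = exp s * sum Q' T...T, integrated over nu,
  would give 0 >= s since shift-invariance cancels the terms ln T.  Hence trees of size n have
  Q'-probability exp (-o(n)) along a subsequence, and the upper bound for Q' puts them near nu,
  the only zero of the rate function of Q'.  Undoing the change of measure gives the bound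
  for infinitely many n.  Gluing many such trees of one fixed size onto a tree of the right size
  modulo the size of a block then reaches every large n in S, whatever the period.
*)
theory Submission
  imports Defs
begin

section \<open>Finite planar trees\<close>

text \<open>Criticality acts through a positive vector p with A p = p. It makes P \<otimes> Q, where
  P has weights p, a point of rate zero, so the lower bound for the whole space shows that
  conditioning on the size costs only a subexponential factor. Once some recurrent root has a finite
  tree, it also forces every type to have one, and some recurrent vertex to have two recurrent
  children. Hence every recurrent type b is the root of a finite tree with two open leaves, one of
  type b and one of any given type. Such trees are the joints of the gluing. Their vertices lower
  the balance of types while complete trees raise it, so small amounts of both restore
  shift-invariance after a truncation; and a measure that charges both has a kernel with only one
  invariant type law. The analytic obstacle is that the topology tests unbounded numbers of
  children. All exponential moments together give a function \<phi> of superlinear growth with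
  finite exponential mean, and bounds on the mean of \<phi> define compact sets. Transient types
  root only trees of bounded size, so large trees have recurrent roots.\<close>

datatype 'a gtree = GNode (root_type: 'a) (subtrees: "'a gtree list")

text \<open>The weight of a tree and its empirical measure depend on the tree only through this
  multiset, which has one entry per vertex. Its additivity over subtrees makes gluing
  computable.\<close>

primrec tree_cnt :: "'a gtree \<Rightarrow> ('a \<times> 'a list) multiset" where
  "tree_cnt (GNode a ts) = add_mset (a, map root_type ts) (sum_list (map tree_cnt ts))"

definition tree_weight :: "('a \<times> 'a list \<Rightarrow> real) \<Rightarrow> 'a gtree \<Rightarrow> real" where
  "tree_weight q t = (\<Prod>x\<in>#tree_cnt t. q x)"

definition sized_trees :: "nat \<Rightarrow> 'a \<Rightarrow> 'a gtree set" where
  "sized_trees n a = {t. root_type t = a \<and> size (tree_cnt t) = n}"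

text \<open>\<open>h\<close> bounds the number of levels, so \<open>h = 0\<close> admits no tree,
  and \<open>N\<close> bounds the number of children. Bounding the height gives weight sums a
  one-step recursion, where bounding the number of vertices would give a convolution.\<close>

primrec bounded_trees :: "nat \<Rightarrow> nat \<Rightarrow> 'a \<Rightarrow> 'a gtree set" where
  "bounded_trees N 0 a = {}"
| "bounded_trees N (Suc h) a =
     (\<Union>c\<in>{c. length c \<le> N}. GNode a ` listset (map (bounded_trees N h) c))"

lemma tree_cnt_nonempty [simp]: "tree_cnt t \<noteq> {#}"
  by (cases t) auto

lemma size_sum_list: "size (sum_list Cs :: 'b multiset) = sum_list (map size Cs)"
  by (induction Cs) auto

lemma prod_mset_nonneg_real: "(\<And>x. 0 \<le> q x) \<Longrightarrow> 0 \<le> (\<Prod>x\<in>#C. q x :: real)"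
  by (induction C) auto

lemma image_mset_sum_list: "image_mset f (sum_list Cs) = sum_list (map (image_mset f) Cs)"
  by (induction Cs) auto

lemma prod_mset_sum_list: "prod_mset (sum_list Cs) = prod_list (map prod_mset Cs)"
  by (induction Cs) auto

lemma sum_mset_sum_list: "sum_mset (sum_list Cs) = sum_list (map sum_mset Cs)"
  by (induction Cs) auto

lemma tree_weight_GNode:
  "tree_weight q (GNode a ts) = q (a, map root_type ts) * prod_list (map (tree_weight q) ts)"
  by (simp add: tree_weight_def[abs_def] image_mset_sum_list prod_mset_sum_list o_def)

lemma tree_weight_nonneg: "(\<And>x. 0 \<le> q x) \<Longrightarrow> 0 \<le> tree_weight q t"
  unfolding tree_weight_def by (rule prod_mset_nonneg_real)

lemma in_listset: "xs \<in> listset As \<longleftrightarrow> list_all2 (\<in>) xs As"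
  by (induction As arbitrary: xs) (auto simp: set_Cons_def list_all2_Cons2)

lemma finite_listset: "(\<And>A. A \<in> set As \<Longrightarrow> finite A) \<Longrightarrow> finite (listset As)"
proof (induction As)
  case (Cons A As)
  have "set_Cons A (listset As) = (\<lambda>(x, xs). x # xs) ` (A \<times> listset As)"
    by (auto simp: set_Cons_def)
  then show ?case using Cons by simp
qed simp

lemma sum_prod_listset:
  fixes f :: "'b \<Rightarrow> real"
  assumes "\<And>A. A \<in> set As \<Longrightarrow> finite A"
  shows "(\<Sum>xs\<in>listset As. prod_list (map f xs)) = prod_list (map (sum f) As)"
  using assms
proof (induction As)
  case (Cons A As)
  have eq: "listset (A # As) = (\<lambda>(x, xs). x # xs) ` (A \<times> listset As)"
    by (auto simp: set_Cons_def)
  have inj: "inj_on (\<lambda>(x, xs). x # xs) (A \<times> listset As)"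
    by (auto simp: inj_on_def)
  have "(\<Sum>xs\<in>listset (A # As). prod_list (map f xs))
      = (\<Sum>(x, xs)\<in>A \<times> listset As. f x * prod_list (map f xs))"
    unfolding eq by (subst sum.reindex[OF inj]) (auto intro!: sum.cong)
  also have "\<dots> = (\<Sum>x\<in>A. \<Sum>xs\<in>listset As. f x * prod_list (map f xs))"
    by (simp add: sum.cartesian_product)
  also have "\<dots> = sum f A * (\<Sum>xs\<in>listset As. prod_list (map f xs))"
    by (simp add: sum_product)
  finally show ?case using Cons by simp
qed simp

lemma finite_words: "finite {c :: 'a::finite list. length c \<le> N}"
  using finite_lists_length_le[of "UNIV :: 'a set" N] by simp

lemma finite_bounded_trees: "finite (bounded_trees N h (a::'a::finite))"
proof (induction h arbitrary: a)
  case (Suc h)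
  then have "finite (listset (map (bounded_trees N h) c))" for c :: "'a list"
    by (intro finite_listset) auto
  then show ?case by (simp add: finite_words)
qed simp

lemma root_type_bounded_trees: "t \<in> bounded_trees N h a \<Longrightarrow> root_type t = a"
  by (cases h) auto

lemma map_root_type_listset:
  "ts \<in> listset (map (bounded_trees N h) c) \<Longrightarrow> map root_type ts = c"
  by (auto simp: in_listset list_all2_conv_all_nth intro!: nth_equalityI root_type_bounded_trees)

text \<open>The branching property for weights: given their root types, the subtrees vary
  independently, so a sum over tuples is a product of sums. Iterating in \<open>h\<close> bounds
  total masses and, in the limit, yields the fixed point equation of a generating function.\<close>

lemma sum_bounded_trees_Suc:
  fixes a :: "'a::finite"
  shows "(\<Sum>t\<in>bounded_trees N (Suc h) a. tree_weight q t)
    = (\<Sum>c | length c \<le> N. q (a, c) *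
         prod_list (map (\<lambda>b. \<Sum>t\<in>bounded_trees N h b. tree_weight q t) c))"
proof -
  let ?L = "\<lambda>c :: 'a list. listset (map (bounded_trees N h) c)"
  have fin: "finite (?L c)" for c
    by (intro finite_listset) (auto intro: finite_bounded_trees)
  have "(\<Sum>t\<in>bounded_trees N (Suc h) a. tree_weight q t)
      = (\<Sum>c | length c \<le> N. \<Sum>t\<in>GNode a ` ?L c. tree_weight q t)"
    unfolding bounded_trees.simps
  proof (subst sum.UNION_disjoint)
    have "c = c'" if "ts \<in> ?L c" "ts \<in> ?L c'" for c c' ts
      using that map_root_type_listset by metis
    then show "\<forall>c\<in>{c. length c \<le> N}. \<forall>c'\<in>{c. length c \<le> N}.
        c \<noteq> c' \<longrightarrow> GNode a ` ?L c \<inter> GNode a ` ?L c' = {}"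
      by blast
  qed (use fin in \<open>auto intro: finite_words\<close>)
  also have "\<dots> = (\<Sum>c | length c \<le> N. \<Sum>ts\<in>?L c. q (a, c) * prod_list (map (tree_weight q) ts))"
    by (intro sum.cong refl, subst sum.reindex)
       (auto simp: inj_on_def tree_weight_GNode map_root_type_listset)
  also have "\<dots> = (\<Sum>c | length c \<le> N. q (a, c) *
         prod_list (map (\<lambda>b. \<Sum>t\<in>bounded_trees N h b. tree_weight q t) c))"
    by (subst sum_distrib_left[symmetric], subst sum_prod_listset)
       (auto intro: finite_bounded_trees simp: o_def)
  finally show ?thesis .
qed

lemma in_bounded_trees:
  "size (tree_cnt t) \<le> h \<Longrightarrow> size (tree_cnt t) \<le> N \<Longrightarrow> t \<in> bounded_trees N h (root_type t)"
proof (induction h arbitrary: t)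
  case (Suc h)
  obtain a ts where t: "t = GNode a ts" by (cases t)
  have sz: "size (tree_cnt t) = Suc (sum_list (map (\<lambda>s. size (tree_cnt s)) ts))"
    by (simp add: t size_sum_list o_def)
  have ge1: "1 \<le> size (tree_cnt s)" for s :: "'a gtree"
    by (metis One_nat_def Suc_leI nonempty_has_size tree_cnt_nonempty)
  have "sum_list (map (\<lambda>s. 1) ts) \<le> sum_list (map (\<lambda>s. size (tree_cnt s)) ts)"
    by (intro sum_list_mono ge1)
  then have len: "length ts \<le> N" using Suc sz by (simp add: sum_list_triv)
  have "s \<in> bounded_trees N h (root_type s)" if "s \<in> set ts" for s
  proof -
    have "size (tree_cnt s) \<le> sum_list (map (\<lambda>s. size (tree_cnt s)) ts)"
      using that by (intro member_le_sum_list) auto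
    then show ?thesis using Suc sz by auto
  qed
  then have "ts \<in> listset (map (bounded_trees N h) (map root_type ts))"
    by (auto simp: in_listset list_all2_conv_all_nth)
  then show ?case using len by (auto simp: t intro!: exI[of _ "map root_type ts"])
qed (simp add: nonempty_has_size)

lemma sized_trees_subset: "sized_trees n a \<subseteq> bounded_trees n n a"
  using in_bounded_trees by (force simp: sized_trees_def)

lemma finite_sized_trees [simp]: "finite (sized_trees n (a::'a::finite))"
  using finite_subset[OF sized_trees_subset finite_bounded_trees] .

lemma sum_bounded_trees_le_1:
  fixes a :: "'a::finite"
  assumes q: "\<And>x. 0 \<le> q x" and sub: "\<And>a. (\<Sum>c | length c \<le> N. q (a, c)) \<le> 1"
  shows "(\<Sum>t\<in>bounded_trees N h a. tree_weight q t) \<le> 1"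
proof (induction h arbitrary: a)
  case (Suc h)
  have "prod_list (map (\<lambda>b. \<Sum>t\<in>bounded_trees N h b. tree_weight q t) c) \<le> 1" for c
    using Suc by (induction c) (auto intro!: mult_le_one prod_list_nonneg sum_nonneg tree_weight_nonneg q)
  then have "(\<Sum>t\<in>bounded_trees N (Suc h) a. tree_weight q t) \<le> (\<Sum>c | length c \<le> N. q (a, c) * 1)"
    unfolding sum_bounded_trees_Suc by (intro sum_mono mult_left_mono q) auto
  then show ?case using sub[of a] by simp
qed simp

text \<open>A tree with \<open>n\<close> vertices has at most \<open>n\<close> levels and at most
  \<open>n\<close> children per vertex, so it is among the bounded trees, whose mass stays below 1
  by induction on the height. The kernel may be a sub-probability, as exponentially tilted weights
  are.\<close>

lemma sum_sized_trees_le_1: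
  fixes a :: "'a::finite"
  assumes q: "\<And>x. 0 \<le> q x" and sub: "\<And>a N. (\<Sum>c | length c \<le> N. q (a, c)) \<le> 1"
  shows "(\<Sum>t\<in>sized_trees n a. tree_weight q t) \<le> 1"
proof -
  have "(\<Sum>t\<in>sized_trees n a. tree_weight q t) \<le> (\<Sum>t\<in>bounded_trees n n a. tree_weight q t)"
    by (intro sum_mono2 finite_bounded_trees sized_trees_subset) (auto intro: tree_weight_nonneg q)
  also have "\<dots> \<le> 1" by (rule sum_bounded_trees_le_1[OF q sub])
  finally show ?thesis .
qed

text \<open>Every vertex except the root is the child of exactly one vertex, so the root is the only
  source of imbalance.\<close>

lemma sum_mset_count_children:
  fixes t :: "'a gtree"
  shows "(\<Sum>x\<in>#tree_cnt t. real (count_list (snd x) a)) + indicator {root_type t} a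
    = (\<Sum>x\<in>#tree_cnt t. indicator {a} (fst x))"
proof (induction t)
  case (GNode b ts)
  have "sum_list (map (\<lambda>t. \<Sum>x\<in>#tree_cnt t. real (count_list (snd x) a)) ts)
      + real (count_list (map root_type ts) a)
      = sum_list (map (\<lambda>t. \<Sum>x\<in>#tree_cnt t. indicator {a} (fst x)) ts)"
    using GNode
  proof (induction ts)
    case (Cons t ts)
    have "(\<Sum>x\<in>#tree_cnt t. real (count_list (snd x) a)) + indicator {root_type t} a
      = (\<Sum>x\<in>#tree_cnt t. indicator {a} (fst x))" by (rule Cons.prems) simp
    moreover have "sum_list (map (\<lambda>t. \<Sum>x\<in>#tree_cnt t. real (count_list (snd x) a)) ts)
      + real (count_list (map root_type ts) a)
      = sum_list (map (\<lambda>t. \<Sum>x\<in>#tree_cnt t. indicator {a} (fst x)) ts)"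
      by (rule Cons.IH) (auto intro: Cons.prems)
    ultimately show ?case by (auto simp: indicator_def split: if_splits)
  qed simp
  then show ?case
    by (auto simp: image_mset_sum_list sum_mset_sum_list o_def indicator_def)
qed

section \<open>The law of finite trees\<close>

text \<open>Addresses are read from right to left, so the last entry names a child of the root;
  hence \<open>last\<close> and \<open>butlast\<close> in a recursion over subtrees.\<close>

primrec tree_map :: "'a gtree \<Rightarrow> 'a typed_tree" where
  "tree_map (GNode a ts) = (\<lambda>v. if v = [] then Some a
     else if last v < length ts then (map tree_map ts ! last v) (butlast v) else None)"

lemma tree_map_Nil [simp]: "tree_map t [] = Some (root_type t)"
  by (cases t) auto

lemma tree_map_snoc:
  "tree_map (GNode a ts) (v @ [i]) = (if i < length ts then tree_map (ts ! i) v else None)"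
  by auto

lemma vertices_GNode:
  "vertices (tree_map (GNode a ts)) =
     insert [] (\<Union>i<length ts. (\<lambda>v. v @ [i]) ` vertices (tree_map (ts ! i)))"
proof (intro set_eqI iffI)
  fix v assume "v \<in> vertices (tree_map (GNode a ts))"
  then show "v \<in> insert [] (\<Union>i<length ts. (\<lambda>v. v @ [i]) ` vertices (tree_map (ts ! i)))"
    by (cases v rule: rev_cases)
       (auto simp: vertices_def dom_def tree_map_snoc image_iff simp del: tree_map.simps split: if_splits)
next
  fix v assume "v \<in> insert [] (\<Union>i<length ts. (\<lambda>v. v @ [i]) ` vertices (tree_map (ts ! i)))"
  then show "v \<in> vertices (tree_map (GNode a ts))"
    by (auto simp: vertices_def dom_def tree_map_snoc simp del: tree_map.simps)
qed

lemma finite_vertices_tree_map: "finite (vertices (tree_map t))"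
proof (induction t)
  case (GNode a ts)
  then show ?case unfolding vertices_GNode by auto
qed

lemma Nil_in_vertices_tree_map [simp]: "[] \<in> vertices (tree_map t)"
  by (simp add: vertices_def dom_def)

lemma snoc_in_vertices_tree_map:
  "v @ [i] \<in> vertices (tree_map (GNode a ts)) \<longleftrightarrow> i < length ts \<and> v \<in> vertices (tree_map (ts ! i))"
  by (auto simp: vertices_def dom_def tree_map_snoc simp del: tree_map.simps)

lemma vertex_type_snoc:
  "i < length ts \<Longrightarrow> vertex_type (tree_map (GNode a ts)) (v @ [i]) = vertex_type (tree_map (ts ! i)) v"
  by (simp add: vertex_type_def tree_map_snoc del: tree_map.simps)

lemma offspring_snoc:
  assumes "i < length ts"
  shows "offspring (tree_map (GNode a ts)) (v @ [i]) = offspring (tree_map (ts ! i)) v"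
proof -
  have "{j. j # v @ [i] \<in> vertices (tree_map (GNode a ts))} = {j. j # v \<in> vertices (tree_map (ts ! i))}"
    using assms snoc_in_vertices_tree_map[of "_ # v" i a ts] by auto
  then show ?thesis
    using vertex_type_snoc[OF assms, of a "_ # v"] by (simp add: offspring_def del: tree_map.simps)
qed

lemma offspring_Nil: "offspring (tree_map (GNode a ts)) [] = map root_type ts"
proof -
  have "{j. [j] \<in> vertices (tree_map (GNode a ts))} = {..<length ts}"
    using snoc_in_vertices_tree_map[of "[]" _ a ts] by auto
  then show ?thesis
    using vertex_type_snoc[of _ ts a "[]"]
    by (auto simp: offspring_def vertex_type_def simp del: tree_map.simps intro!: nth_equalityI)
qed

lemma mset_set_UNION_lessThan:
  assumes "\<And>i. i < (n::nat) \<Longrightarrow> finite (A i)" "\<And>i j. i < n \<Longrightarrow> j < n \<Longrightarrow> i \<noteq> j \<Longrightarrow> A i \<inter> A j = {}"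
  shows "mset_set (\<Union>i<n. A i) = (\<Sum>i<n. mset_set (A i))"
  using assms
proof (induction n)
  case (Suc n)
  have "mset_set (A n \<union> (\<Union>i<n. A i)) = mset_set (A n) + mset_set (\<Union>i<n. A i)"
    using Suc.prems by (intro mset_set_Union) (auto, metis disjoint_iff less_Suc_eq nat_neq_iff)
  then show ?case using Suc by (simp add: lessThan_Suc add.commute)
qed simp

lemma image_mset_sum: "image_mset f (\<Sum>i\<in>I. C i) = (\<Sum>i\<in>I. image_mset f (C i))"
  by (induction I rule: infinite_finite_induct) auto

lemma tree_cnt_eq:
  "tree_cnt t = image_mset (\<lambda>v. (vertex_type (tree_map t) v, offspring (tree_map t) v))
     (mset_set (vertices (tree_map t)))"
proof (induction t)
  case (GNode a ts)
  let ?t = "tree_map (GNode a ts)"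
  let ?f = "\<lambda>v. (vertex_type ?t v, offspring ?t v)"
  let ?A = "\<lambda>i. (\<lambda>v. v @ [i]) ` vertices (tree_map (ts ! i))"
  have "mset_set (vertices ?t) = add_mset [] (\<Sum>i<length ts. mset_set (?A i))"
    unfolding vertices_GNode
    by (subst mset_set.insert) (auto simp: finite_vertices_tree_map intro!: mset_set_UNION_lessThan)
  moreover have "image_mset ?f (mset_set (?A i)) = tree_cnt (ts ! i)" if "i < length ts" for i
  proof -
    have "mset_set (?A i) = image_mset (\<lambda>v. v @ [i]) (mset_set (vertices (tree_map (ts ! i))))"
      by (subst image_mset_mset_set) (auto simp: inj_on_def)
    then show ?thesis
      using GNode[of "ts ! i"] that
      by (simp add: image_mset.compositionality o_def vertex_type_snoc offspring_snoc del: tree_map.simps)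
  qed
  ultimately have "image_mset ?f (mset_set (vertices ?t))
      = add_mset (a, map root_type ts) (\<Sum>i<length ts. tree_cnt (ts ! i))"
    by (simp add: image_mset_sum offspring_Nil vertex_type_def del: tree_map.simps)
  then show ?case by (simp add: sum_list_sum_nth atLeast0LessThan)
qed

lemma card_vertices_tree_map: "card (vertices (tree_map t)) = size (tree_cnt t)"
  by (subst tree_cnt_eq) simp

lemma inj_tree_map: "tree_map t = tree_map t' \<Longrightarrow> t = t'"
proof (induction t arbitrary: t')
  case (GNode a ts)
  obtain b us where t': "t' = GNode b us" by (cases t')
  have eq: "tree_map (GNode a ts) v = tree_map (GNode b us) v" for v
    using GNode.prems t' by simp
  have "a = b" using eq[of "[]"] by simp
  have "i < length ts \<longleftrightarrow> i < length us" for i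
    using eq[of "[] @ [i]"] unfolding tree_map_snoc by (auto split: if_splits)
  then have len: "length ts = length us" by (meson linorder_neqE_nat nat_less_le)
  have "ts ! i = us ! i" if "i < length ts" for i
  proof (rule GNode.IH)
    show "ts ! i \<in> set ts" using that by simp
    show "tree_map (ts ! i) = tree_map (us ! i)"
      using eq[of "_ @ [i]"] that len unfolding tree_map_snoc by auto
  qed
  then show ?case using \<open>a = b\<close> len t' by (auto intro: nth_equalityI)
qed

text \<open>\<open>grow\<close> recurses at the far end of the line of descent, whereas finite trees
  are built from the root. Here the recursion is turned round: below child \<open>i\<close> of the
  root the tree grows from the source with addresses shifted by \<open>i\<close>.\<close>

lemma grow_snoc:
  "grow \<omega> (v @ [i]) = (let c = snd \<omega> ([], fst \<omega>) in
     if i < length c then grow (c ! i, \<lambda>(w, a). snd \<omega> (w @ [i], a)) v else None)"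
  by (induction v) (auto simp: Let_def split: option.splits)

text \<open>Induction on the number of vertices: appending \<open>i\<close> embeds the subtree at
  child \<open>i\<close> into the tree without its root, so that subtree is smaller.\<close>

lemma grow_eq_tree_map:
  assumes "finite (vertices (grow \<omega>))"
  shows "\<exists>t. grow \<omega> = tree_map t"
  using assms
proof (induction "card (vertices (grow \<omega>))" arbitrary: \<omega> rule: less_induct)
  case less
  define c where "c = snd \<omega> ([], fst \<omega>)"
  define \<omega>' where "\<omega>' i = (c ! i, \<lambda>(w, a). snd \<omega> (w @ [i], a))" for i
  have snoc: "grow \<omega> (v @ [i]) = (if i < length c then grow (\<omega>' i) v else None)" for v i
    by (simp add: grow_snoc Let_def c_def \<omega>'_def)
  have "\<exists>t. grow (\<omega>' i) = tree_map t" if "i < length c" for i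
  proof (rule less.hyps)
    have sub: "(\<lambda>v. v @ [i]) ` vertices (grow (\<omega>' i)) \<subseteq> vertices (grow \<omega>) - {[]}"
      using that snoc by (auto simp: vertices_def dom_def)
    have inj: "inj_on (\<lambda>v. v @ [i]) (vertices (grow (\<omega>' i)))" by (auto simp: inj_on_def)
    have fin: "finite (vertices (grow \<omega>) - {[]})" using less.prems by simp
    show "finite (vertices (grow (\<omega>' i)))"
      using finite_imageD[OF finite_subset[OF sub fin] inj] .
    have "card (vertices (grow (\<omega>' i))) \<le> card (vertices (grow \<omega>) - {[]})"
      using card_mono[OF fin sub] card_image[OF inj] by simp
    also have "\<dots> < card (vertices (grow \<omega>))"
      using less.prems by (intro psubset_card_mono) (auto simp: vertices_def dom_def)
    finally show "card (vertices (grow (\<omega>' i))) < card (vertices (grow \<omega>))" .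
  qed
  then obtain f where f: "\<And>i. i < length c \<Longrightarrow> grow (\<omega>' i) = tree_map (f i)" by metis
  have "grow \<omega> v = tree_map (GNode (fst \<omega>) (map f [0..<length c])) v" for v
    by (cases v rule: rev_cases) (auto simp: snoc f)
  then show ?case by blast
qed

text \<open>Only the root type and the coordinates \<open>(v, a)\<close> with \<open>v\<close> a
  vertex and \<open>a\<close> its type are constrained. The event is a cylinder over finitely many
  coordinates, although the source carries a list for every address and type.\<close>

lemma grow_eq_tree_map_iff:
  "grow \<omega> = tree_map t \<longleftrightarrow> fst \<omega> = root_type t \<and>
     (\<forall>v\<in>vertices (tree_map t). snd \<omega> (v, vertex_type (tree_map t) v) = offspring (tree_map t) v)"
proof (intro iffI conjI ballI)
  assume eq: "grow \<omega> = tree_map t"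
  show "fst \<omega> = root_type t" using eq grow.simps(1)[of \<omega>] by simp
  fix v assume "v \<in> vertices (tree_map t)"
  then show "snd \<omega> (v, vertex_type (tree_map t) v) = offspring (tree_map t) v"
    using offspring_grow[of v \<omega>] eq by simp
next
  assume *: "fst \<omega> = root_type t \<and>
     (\<forall>v\<in>vertices (tree_map t). snd \<omega> (v, vertex_type (tree_map t) v) = offspring (tree_map t) v)"
  then show "grow \<omega> = tree_map t"
  proof (induction t arbitrary: \<omega>)
    case (GNode a ts)
    let ?t = "tree_map (GNode a ts)"
    have a: "fst \<omega> = a" using GNode.prems by simp
    have v: "snd \<omega> (v, vertex_type ?t v) = offspring ?t v" if "v \<in> vertices ?t" for v
      using GNode.prems that by blast
    have c: "snd \<omega> ([], fst \<omega>) = map root_type ts"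
      using v[of "[]"] offspring_Nil[of a ts] by (simp add: vertex_type_def a del: tree_map.simps)
    have i: "grow (root_type (ts ! i), \<lambda>(w, a). snd \<omega> (w @ [i], a)) = tree_map (ts ! i)"
      if i: "i < length ts" for i
    proof (rule GNode.IH)
      show "ts ! i \<in> set ts" using i by simp
      show "fst (root_type (ts ! i), \<lambda>(w, a). snd \<omega> (w @ [i], a)) = root_type (ts ! i) \<and>
        (\<forall>v\<in>vertices (tree_map (ts ! i)).
          snd (root_type (ts ! i), \<lambda>(w, a). snd \<omega> (w @ [i], a)) (v, vertex_type (tree_map (ts ! i)) v)
          = offspring (tree_map (ts ! i)) v)"
        using v[of "_ @ [i]"] i
        by (auto simp: snoc_in_vertices_tree_map vertex_type_snoc offspring_snoc simp del: tree_map.simps)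
    qed
    have "grow \<omega> v = ?t v" for v
      by (cases v rule: rev_cases)
         (use a in \<open>auto simp: grow_snoc c i tree_map_snoc simp del: tree_map.simps\<close>)
    then show ?case by blast
  qed
qed

lemma prob_space_gw_source: "prob_space (gw_source \<mu> Q)"
proof -
  have "prob_space (\<Pi>\<^sub>M (v :: nat list, a)\<in>UNIV. measure_pmf (Q a))"
    by (rule prob_space_PiM) (auto simp: split_beta prob_space_measure_pmf)
  then show ?thesis
    unfolding gw_source_def by (intro prob_space_pair prob_space_measure_pmf)
qed

lemma space_gw_source: "space (gw_source \<mu> Q) = UNIV"
  by (auto simp: gw_source_def space_pair_measure space_PiM split_beta)

text \<open>Distinct vertices use distinct coordinates of the source, so independence gives one
  factor per vertex.\<close>

lemma gw_source_grow_tree_map: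
  fixes t :: "'a::finite gtree"
  shows "{\<omega>. grow \<omega> = tree_map t} \<in> sets (gw_source \<mu> Q)"
    and "measure (gw_source \<mu> Q) {\<omega>. grow \<omega> = tree_map t}
      = pmf \<mu> (root_type t) * tree_weight (\<lambda>(a, c). pmf (Q a) c) t"
proof -
  define M where "M = (\<lambda>(v :: nat list, a). measure_pmf (Q a))"
  interpret product_prob_space M "UNIV :: (nat list \<times> 'a) set"
    by (rule product_prob_spaceI) (auto simp: M_def split_beta prob_space_measure_pmf)
  let ?V = "vertices (tree_map t)"
  let ?e = "\<lambda>v. (v, vertex_type (tree_map t) v)"
  let ?X = "\<lambda>x. {offspring (tree_map t) (fst x)}"
  define B where "B = {f. \<forall>x\<in>?e ` ?V. f x \<in> ?X x}"
  have space: "space (\<Pi>\<^sub>M x\<in>UNIV. M x) = UNIV" by (auto simp: M_def space_PiM split_beta)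
  have inM: "A \<in> sets (M x)" for A x by (simp add: M_def split_beta)
  have eq: "{\<omega>. grow \<omega> = tree_map t} = {root_type t} \<times> B"
    by (auto simp: grow_eq_tree_map_iff B_def)
  have B: "{f\<in>space (\<Pi>\<^sub>M x\<in>UNIV. M x). \<forall>x\<in>?e ` ?V. f x \<in> ?X x} = B"
    unfolding space B_def by simp
  have B_emb: "B = prod_emb UNIV M (?e ` ?V) (Pi\<^sub>E (?e ` ?V) ?X)"
    unfolding B_def by (auto simp: prod_emb_def space_PiM M_def split_beta Pi_iff)
  have meas: "B \<in> sets (\<Pi>\<^sub>M x\<in>UNIV. M x)"
    unfolding B_emb by (intro sets_PiM_I) (auto simp: finite_vertices_tree_map inM)
  have "measure (\<Pi>\<^sub>M x\<in>UNIV. M x) B = (\<Prod>x\<in>?e ` ?V. measure (M x) (?X x))"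
    unfolding B_emb by (intro measure_PiM_emb) (auto simp: finite_vertices_tree_map inM)
  also have "\<dots> = (\<Prod>v\<in>?V. pmf (Q (vertex_type (tree_map t) v)) (offspring (tree_map t) v))"
    by (subst prod.reindex) (auto simp: inj_on_def M_def measure_pmf_single)
  also have "\<dots> = tree_weight (\<lambda>(a, c). pmf (Q a) c) t"
    unfolding tree_weight_def tree_cnt_eq
    by (simp add: image_mset.compositionality o_def prod_unfold_prod_mset)
  finally have mB: "measure (\<Pi>\<^sub>M x\<in>UNIV. M x) B = tree_weight (\<lambda>(a, c). pmf (Q a) c) t" .
  have src: "gw_source \<mu> Q = measure_pmf \<mu> \<Otimes>\<^sub>M (\<Pi>\<^sub>M x\<in>UNIV. M x)"
    by (simp add: gw_source_def M_def)
  show "{\<omega>. grow \<omega> = tree_map t} \<in> sets (gw_source \<mu> Q)"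
    unfolding eq src using meas by (intro pair_measureI) auto
  have "emeasure (gw_source \<mu> Q) {\<omega>. grow \<omega> = tree_map t}
      = emeasure (measure_pmf \<mu>) {root_type t} * emeasure (\<Pi>\<^sub>M x\<in>UNIV. M x) B"
    unfolding eq src using meas by (intro P.emeasure_pair_measure_Times) auto
  then show "measure (gw_source \<mu> Q) {\<omega>. grow \<omega> = tree_map t}
      = pmf \<mu> (root_type t) * tree_weight (\<lambda>(a, c). pmf (Q a) c) t"
    by (simp add: measure_def enn2real_mult mB[symmetric] emeasure_pmf_single)
qed

definition emp :: "'a gtree \<Rightarrow> ('a \<times> 'a list) pmf" where
  "emp t = pmf_of_multiset (tree_cnt t)"

text \<open>A joint probability for a fixed root type; conditioning on the size is postponed to a
  single division at the end.\<close>

definition tree_prob :: "('a \<Rightarrow> 'a list pmf) \<Rightarrow> nat \<Rightarrow> 'a \<Rightarrow> ('a \<times> 'a list) pmf set \<Rightarrow> real" where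
  "tree_prob Q n a B =
     (\<Sum>t\<in>{t \<in> sized_trees n a. emp t \<in> B}. tree_weight (\<lambda>(a, c). pmf (Q a) c) t)"

lemma pmf_emp: "pmf (emp t) x = real (count (tree_cnt t) x) / real (size (tree_cnt t))"
  by (simp add: emp_def)

lemma empirical_tree_map: "empirical_offspring_measure (tree_map t) = emp t"
proof (rule pmf_eqI)
  fix x
  let ?V = "vertices (tree_map t)"
  let ?f = "\<lambda>v. (vertex_type (tree_map t) v, offspring (tree_map t) v)"
  have ne: "?V \<noteq> {}" using Nil_in_vertices_tree_map by blast
  have "count (tree_cnt t) x = card (?f -` {x} \<inter> ?V)"
    by (subst tree_cnt_eq) (simp add: count_image_mset finite_vertices_tree_map)
  then show "pmf (empirical_offspring_measure (tree_map t)) x = pmf (emp t) x"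
    by (simp add: empirical_offspring_measure_def pmf_map measure_pmf_of_set finite_vertices_tree_map
        ne pmf_emp card_vertices_tree_map Int_commute)
qed

lemma countable_finite_maps: "countable {T :: nat list \<Rightarrow> 'a::finite option. finite (dom T)}"
proof -
  have "T \<in> range map_of" if fin: "finite (dom T)" for T :: "nat list \<Rightarrow> 'a option"
  proof -
    obtain xs where "set xs = dom T" using finite_list[OF fin] by blast
    then have "map_of (map (\<lambda>k. (k, the (T k))) xs) = T" by (rule map_of_map_keys)
    then show ?thesis by (metis rangeI)
  qed
  then have "{T :: nat list \<Rightarrow> 'a option. finite (dom T)} \<subseteq> range map_of" by blast
  then show ?thesis by (rule countable_subset) simp
qed

text \<open>\<open>B\<close> is an arbitrary set, so measurability comes from countability: only
  countably many typed trees are finite, and each single tree is a measurable rectangle.\<close>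

lemma prob_gw_law:
  fixes Q :: "'a::finite \<Rightarrow> 'a list pmf"
  shows "\<P>(t in gw_law \<mu> Q. empirical_offspring_measure t \<in> B \<and> tree_size t = enat n)
    = (\<Sum>a\<in>UNIV. pmf \<mu> a * tree_prob Q n a B)"
proof -
  interpret prob_space "gw_source \<mu> Q" by (rule prob_space_gw_source)
  define A where "A = {T :: 'a typed_tree. empirical_offspring_measure T \<in> B \<and> tree_size T = enat n}"
  define TT where "TT = (\<Union>a. {t \<in> sized_trees n (a::'a). emp t \<in> B})"
  have fin: "finite TT" by (auto simp: TT_def)
  have sp: "space (\<Pi>\<^sub>M v\<in>(UNIV :: nat list set). count_space (UNIV :: 'a option set)) = UNIV"
    by (auto simp: space_PiM)
  have "{T} \<in> sets (\<Pi>\<^sub>M v\<in>(UNIV :: nat list set). count_space (UNIV :: 'a option set))" for T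
  proof -
    have "{T} = Pi\<^sub>E UNIV (\<lambda>v. {T v})" by (auto simp: PiE_def)
    then show ?thesis by (simp add: sets_PiM_I_countable)
  qed
  moreover have "countable A"
    by (rule countable_subset[OF _ countable_finite_maps])
       (auto simp: A_def tree_size_def vertices_def split: if_splits)
  ultimately have "(\<Union>T\<in>A. {T}) \<in> sets (\<Pi>\<^sub>M v\<in>(UNIV :: nat list set). count_space (UNIV :: 'a option set))"
    by (intro sets.countable_UN') auto
  then have A: "A \<in> sets (\<Pi>\<^sub>M v\<in>(UNIV :: nat list set). count_space (UNIV :: 'a option set))" by simp
  have "\<P>(t in gw_law \<mu> Q. empirical_offspring_measure t \<in> B \<and> tree_size t = enat n)
      = measure (gw_source \<mu> Q) (grow -` A \<inter> space (gw_source \<mu> Q))"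
    unfolding gw_law_def by (subst measure_distr[symmetric, OF measurable_grow A]) (simp add: sp A_def)
  also have "grow -` A \<inter> space (gw_source \<mu> Q) = (\<Union>t\<in>TT. {\<omega>. grow \<omega> = tree_map t})"
  proof (intro set_eqI iffI)
    fix \<omega> assume "\<omega> \<in> grow -` A \<inter> space (gw_source \<mu> Q)"
    then have \<omega>: "empirical_offspring_measure (grow \<omega>) \<in> B" "tree_size (grow \<omega>) = enat n"
      by (auto simp: A_def)
    then have "finite (vertices (grow \<omega>))" by (auto simp: tree_size_def split: if_splits)
    then obtain t where "grow \<omega> = tree_map t" using grow_eq_tree_map by blast
    then show "\<omega> \<in> (\<Union>t\<in>TT. {\<omega>. grow \<omega> = tree_map t})"
      using \<omega> by (auto simp: TT_def sized_trees_def tree_size_def finite_vertices_tree_map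
          card_vertices_tree_map empirical_tree_map intro!: exI[of _ t])
  next
    fix \<omega> assume "\<omega> \<in> (\<Union>t\<in>TT. {\<omega>. grow \<omega> = tree_map t})"
    then show "\<omega> \<in> grow -` A \<inter> space (gw_source \<mu> Q)"
      by (auto simp: TT_def A_def sized_trees_def tree_size_def finite_vertices_tree_map
          card_vertices_tree_map empirical_tree_map space_gw_source)
  qed
  also have "measure (gw_source \<mu> Q) \<dots> = (\<Sum>t\<in>TT. measure (gw_source \<mu> Q) {\<omega>. grow \<omega> = tree_map t})"
    by (intro finite_measure_finite_Union fin)
       (auto simp: gw_source_grow_tree_map disjoint_family_on_def dest: inj_tree_map)
  also have "\<dots> = (\<Sum>t\<in>TT. pmf \<mu> (root_type t) * tree_weight (\<lambda>(a, c). pmf (Q a) c) t)"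
    by (simp add: gw_source_grow_tree_map)
  also have "\<dots> = (\<Sum>a\<in>UNIV. \<Sum>t\<in>{t \<in> sized_trees n a. emp t \<in> B}.
      pmf \<mu> (root_type t) * tree_weight (\<lambda>(a, c). pmf (Q a) c) t)"
    unfolding TT_def by (subst sum.UNION_disjoint) (auto, auto simp: sized_trees_def)
  also have "\<dots> = (\<Sum>a\<in>UNIV. pmf \<mu> a * tree_prob Q n a B)"
    unfolding tree_prob_def sum_distrib_left by (intro sum.cong refl) (auto simp: sized_trees_def)
  finally show ?thesis .
qed

section \<open>A variational formula for the relative entropy\<close>

text \<open>The constraint is imposed for each parent type separately, not under
  \<open>kernel_product\<close>, so the set does not depend on \<nu>. This makes the entropy
  relative to \<open>kernel_product (type_marginal \<nu>) Q\<close> a supremum of fixed linear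
  functionals of \<nu>, and each member turns \<open>Q\<close> into a sub-probability
  kernel.\<close>

definition tilts :: "('a \<Rightarrow> 'a list pmf) \<Rightarrow> ('a \<times> 'a list \<Rightarrow> real) set" where
  "tilts Q = {f. bounded (range f) \<and> (\<forall>a. measure_pmf.expectation (Q a) (\<lambda>c. exp (f (a, c))) \<le> 1)}"

lemma integrable_bounded_pmf:
  fixes f :: "'b \<Rightarrow> real"
  assumes "bounded (range f)" shows "integrable (measure_pmf p) f"
proof -
  obtain B where "\<And>x. \<bar>f x\<bar> \<le> B" using assms by (auto simp: bounded_iff)
  then show ?thesis by (intro measure_pmf.integrable_const_bound[where B = B]) auto
qed

lemma integrable_indicator_pmf [simp]: "integrable (measure_pmf p) (indicator A :: _ \<Rightarrow> real)"
  by (intro integrable_bounded_pmf boundedI[of _ 1]) (auto simp: indicator_def)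

lemma bounded_range_compose:
  fixes f :: "'b \<Rightarrow> real"
  assumes "bounded (range f)" shows "bounded (range (\<lambda>c. f (g c)))" "bounded (range (\<lambda>c. exp (f (g c))))"
proof -
  obtain B where "\<And>x. \<bar>f x\<bar> \<le> B" using assms by (auto simp: bounded_iff)
  note B = this
  have "\<bar>exp (f (g c))\<bar> \<le> exp B" for c
    using B[of "g c"] by simp
  then show "bounded (range (\<lambda>c. exp (f (g c))))" by (intro boundedI[of _ "exp B"]) auto
  show "bounded (range (\<lambda>c. f (g c)))" using B by (intro boundedI[of _ B]) auto
qed

lemma entropy_density_pmf:
  assumes "absolutely_continuous (measure_pmf q) (measure_pmf \<nu>)" "x \<in> set_pmf \<nu>"
  shows "0 < pmf q x" "entropy_density (exp 1) (measure_pmf q) (measure_pmf \<nu>) x = ln (pmf \<nu> x / pmf q x)"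
proof -
  show q: "0 < pmf q x"
  proof (rule ccontr)
    assume "\<not> 0 < pmf q x"
    then have "pmf q x = 0" by (metis less_eq_real_def pmf_nonneg)
    then have "{x} \<in> null_sets (measure_pmf q)"
      by (intro null_setsI) (simp_all add: emeasure_pmf_single)
    then have "{x} \<in> null_sets (measure_pmf \<nu>)" using assms by (auto simp: absolutely_continuous_def)
    then show False using assms(2) by (auto simp: null_sets_def emeasure_pmf_single set_pmf_iff)
  qed
  have "emeasure \<nu> {x} = RN_deriv q \<nu> x * emeasure q {x}"
    using assms(1) by (intro measure_pmf.RN_deriv_singleton) auto
  then have "ennreal (pmf \<nu> x) = RN_deriv q \<nu> x * ennreal (pmf q x)"
    by (simp add: emeasure_pmf_single)
  then have "pmf \<nu> x = enn2real (RN_deriv q \<nu> x) * pmf q x"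
    by (metis enn2real_ennreal enn2real_mult pmf_nonneg)
  then show "entropy_density (exp 1) (measure_pmf q) (measure_pmf \<nu>) x = ln (pmf \<nu> x / pmf q x)"
    using q by (simp add: entropy_density_def log_def)
qed

text \<open>Only an inequality, since the mass of \<open>q\<close> outside the support of \<nu> is
  lost; there the ratio is 0 by the convention for division.\<close>

lemma nn_integral_pmf_ratio:
  fixes \<nu> q :: "'b pmf" and h :: "'b \<Rightarrow> ennreal"
  shows "(\<integral>\<^sup>+x. h x * ennreal (pmf q x / pmf \<nu> x) \<partial>measure_pmf \<nu>) \<le> (\<integral>\<^sup>+x. h x \<partial>measure_pmf q)"
  unfolding nn_integral_measure_pmf
proof (rule nn_integral_mono)
  fix x
  have "ennreal (pmf \<nu> x) * (h x * ennreal (pmf q x / pmf \<nu> x))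
      = h x * ennreal (pmf \<nu> x * (pmf q x / pmf \<nu> x))"
    by (subst ennreal_mult') (simp_all add: mult_ac)
  also have "\<dots> \<le> h x * ennreal (pmf q x)"
    by (intro mult_left_mono ennreal_leI) (auto simp: divide_simps)
  finally show "ennreal (pmf \<nu> x) * (h x * ennreal (pmf q x / pmf \<nu> x)) \<le> ennreal (pmf q x) * h x"
    by (simp add: mult.commute)
qed

text \<open>With \<open>D\<close> the logarithmic density and \<open>r = exp (f - D)\<close>, the
  inequality \<open>1 + y \<le> exp y\<close> gives \<open>f \<le> D + (r - 1)\<close>. The mean of
  \<open>r\<close> under \<nu> is at most that of \<open>exp f\<close> under \<open>q\<close>, hence
  at most 1.\<close>

lemma expectation_le_relative_entropy:
  fixes f :: "'b \<Rightarrow> real"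
  assumes f: "bounded (range f)" and le: "measure_pmf.expectation q (\<lambda>x. exp (f x)) \<le> 1"
  shows "ereal (measure_pmf.expectation \<nu> f) \<le> relative_entropy \<nu> q"
proof (cases "absolutely_continuous (measure_pmf q) (measure_pmf \<nu>) \<and>
    integrable (measure_pmf \<nu>) (entropy_density (exp 1) (measure_pmf q) (measure_pmf \<nu>))")
  case True
  let ?D = "entropy_density (exp 1) (measure_pmf q) (measure_pmf \<nu>)"
  let ?r = "\<lambda>x. exp (f x) * (pmf q x / pmf \<nu> x)"
  have D: "?D x = ln (pmf \<nu> x / pmf q x)" "0 < pmf q x" if "x \<in> set_pmf \<nu>" for x
    using entropy_density_pmf[of q \<nu> x] True that by auto
  have "(\<integral>\<^sup>+x. ennreal (?r x) \<partial>\<nu>) \<le> (\<integral>\<^sup>+x. ennreal (exp (f x)) \<partial>q)"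
    using nn_integral_pmf_ratio[of \<nu> "\<lambda>x. ennreal (exp (f x))" q]
    by (simp add: ennreal_mult'[symmetric])
  also have "\<dots> = ennreal (measure_pmf.expectation q (\<lambda>x. exp (f x)))"
    by (intro nn_integral_eq_integral integrable_bounded_pmf)
       (use bounded_range_compose(2)[OF f, of "\<lambda>x. x"] in auto)
  also have "\<dots> \<le> ennreal 1" by (intro ennreal_leI le)
  finally have r1: "(\<integral>\<^sup>+x. ennreal (?r x) \<partial>\<nu>) \<le> ennreal 1" .
  have ir: "integrable (measure_pmf \<nu>) ?r"
    by (rule integrableI_bounded) (use r1 in \<open>auto intro: le_less_trans\<close>)
  have r: "measure_pmf.expectation \<nu> ?r \<le> 1"
    using r1 by (subst (asm) nn_integral_eq_integral[OF ir]) auto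
  have "measure_pmf.expectation \<nu> f \<le> measure_pmf.expectation \<nu> (\<lambda>x. ?D x + (?r x - 1))"
  proof (rule integral_mono_AE)
    show "integrable (measure_pmf \<nu>) f" by (rule integrable_bounded_pmf[OF f])
    show "integrable (measure_pmf \<nu>) (\<lambda>x. ?D x + (?r x - 1))" using True ir by auto
    show "AE x in measure_pmf \<nu>. f x \<le> ?D x + (?r x - 1)"
      unfolding AE_measure_pmf_iff
    proof
      fix x assume x: "x \<in> set_pmf \<nu>"
      then have pos: "0 < pmf \<nu> x" by (rule pmf_positive)
      have "?r x = exp (f x - ?D x)"
        using D[OF x] pos by (simp add: exp_diff)
      then show "f x \<le> ?D x + (?r x - 1)"
        unfolding \<open>?r x = _\<close> using exp_ge_add_one_self[of "f x - ?D x"] by linarith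
    qed
  qed
  also have "\<dots> = measure_pmf.expectation \<nu> ?D + (measure_pmf.expectation \<nu> ?r - 1)"
    using True ir by simp
  also have "\<dots> \<le> measure_pmf.expectation \<nu> ?D" using r by simp
  finally show ?thesis using True by (simp add: relative_entropy_def KL_divergence_def)
qed (simp only: relative_entropy_def if_False ereal_less_eq(1))

lemma expectation_kernel_product:
  fixes f :: "'a::finite \<times> 'a list \<Rightarrow> real"
  assumes f: "\<And>a. integrable (measure_pmf (Q a)) (\<lambda>c. f (a, c))" and nn: "\<And>x. 0 \<le> f x"
  shows "integrable (measure_pmf (kernel_product \<mu> Q)) f"
    "measure_pmf.expectation (kernel_product \<mu> Q) f
      = (\<Sum>a\<in>UNIV. pmf \<mu> a * measure_pmf.expectation (Q a) (\<lambda>c. f (a, c)))"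
proof -
  have E0: "0 \<le> measure_pmf.expectation (Q a) (\<lambda>c. f (a, c))" for a
    by (simp add: integral_nonneg nn)
  have "(\<integral>\<^sup>+x. ennreal (f x) \<partial>kernel_product \<mu> Q)
      = (\<integral>\<^sup>+a. \<integral>\<^sup>+c. ennreal (f (a, c)) \<partial>Q a \<partial>\<mu>)"
    unfolding kernel_product_def by (simp add: nn_integral_map_pmf)
  also have "\<dots> = (\<Sum>a\<in>UNIV. (\<integral>\<^sup>+c. ennreal (f (a, c)) \<partial>Q a) * ennreal (pmf \<mu> a))"
    by (subst nn_integral_measure_pmf_support[of UNIV]) auto
  also have "\<dots> = (\<Sum>a\<in>UNIV. ennreal (measure_pmf.expectation (Q a) (\<lambda>c. f (a, c))) * ennreal (pmf \<mu> a))"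
    by (simp add: nn_integral_eq_integral f nn)
  also have "\<dots> = ennreal (\<Sum>a\<in>UNIV. pmf \<mu> a * measure_pmf.expectation (Q a) (\<lambda>c. f (a, c)))"
  proof -
    have "ennreal (measure_pmf.expectation (Q a) (\<lambda>c. f (a, c))) * ennreal (pmf \<mu> a)
        = ennreal (pmf \<mu> a * measure_pmf.expectation (Q a) (\<lambda>c. f (a, c)))" for a
      using E0[of a] by (simp add: ennreal_mult mult.commute)
    then show ?thesis using E0 by simp
  qed
  finally have *: "(\<integral>\<^sup>+x. ennreal (f x) \<partial>kernel_product \<mu> Q)
    = ennreal (\<Sum>a\<in>UNIV. pmf \<mu> a * measure_pmf.expectation (Q a) (\<lambda>c. f (a, c)))" .
  show i: "integrable (measure_pmf (kernel_product \<mu> Q)) f"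
    by (rule integrableI_bounded) (simp_all add: nn *)
  show "measure_pmf.expectation (kernel_product \<mu> Q) f
      = (\<Sum>a\<in>UNIV. pmf \<mu> a * measure_pmf.expectation (Q a) (\<lambda>c. f (a, c)))"
  proof -
    have "ennreal (measure_pmf.expectation (kernel_product \<mu> Q) f)
      = ennreal (\<Sum>a\<in>UNIV. pmf \<mu> a * measure_pmf.expectation (Q a) (\<lambda>c. f (a, c)))"
      using * nn_integral_eq_integral[OF i] nn by simp
    moreover have "0 \<le> measure_pmf.expectation (kernel_product \<mu> Q) f"
      by (simp add: integral_nonneg nn)
    moreover have "0 \<le> (\<Sum>a\<in>UNIV. pmf \<mu> a * measure_pmf.expectation (Q a) (\<lambda>c. f (a, c)))"
      by (intro sum_nonneg mult_nonneg_nonneg E0) simp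
    ultimately show ?thesis by (simp only: ennreal_inj)
  qed
qed

lemma expectation_exp_tilt_le:
  fixes f :: "'a::finite \<times> 'a list \<Rightarrow> real"
  assumes "f \<in> tilts Q"
  shows "measure_pmf.expectation (kernel_product \<mu> Q) (\<lambda>x. exp (f x)) \<le> 1"
proof -
  have f: "bounded (range f)" "\<And>a. measure_pmf.expectation (Q a) (\<lambda>c. exp (f (a, c))) \<le> 1"
    using assms by (auto simp: tilts_def)
  have "measure_pmf.expectation (kernel_product \<mu> Q) (\<lambda>x. exp (f x))
      = (\<Sum>a\<in>UNIV. pmf \<mu> a * measure_pmf.expectation (Q a) (\<lambda>c. exp (f (a, c))))"
    by (rule expectation_kernel_product(2)) (simp_all add: integrable_bounded_pmf[OF bounded_range_compose(2)[OF f(1)]])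
  also have "\<dots> \<le> (\<Sum>a\<in>UNIV. pmf \<mu> a * 1)"
    by (intro sum_mono mult_left_mono f) auto
  also have "\<dots> = 1" by (simp add: sum_pmf_eq_1)
  finally show ?thesis .
qed

abbreviation entropy_rel :: "('a \<Rightarrow> 'a list pmf) \<Rightarrow> ('a \<times> 'a list) pmf \<Rightarrow> ereal" where
  "entropy_rel Q \<nu> \<equiv> relative_entropy \<nu> (kernel_product (type_marginal \<nu>) Q)"

lemma tilt_le_entropy_rel:
  fixes f :: "'a::finite \<times> 'a list \<Rightarrow> real"
  assumes "f \<in> tilts Q"
  shows "ereal (measure_pmf.expectation \<nu> f) \<le> entropy_rel Q \<nu>"
  using assms by (intro expectation_le_relative_entropy expectation_exp_tilt_le) (auto simp: tilts_def)

lemma pmf_type_marginal_ge: "pmf \<nu> (a, c) \<le> pmf (type_marginal \<nu>) a"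
proof -
  have "measure \<nu> {(a, c)} \<le> measure \<nu> (fst -` {a})"
    by (intro measure_pmf.finite_measure_mono) auto
  then show ?thesis by (simp add: type_marginal_def pmf_map measure_pmf_single)
qed

lemma sum_pmf_le_type_marginal:
  assumes "finite C" shows "(\<Sum>c\<in>C. pmf \<nu> (a, c)) \<le> pmf (type_marginal \<nu>) a"
proof -
  have "(\<Sum>c\<in>C. pmf \<nu> (a, c)) = (\<Sum>x\<in>Pair a ` C. pmf \<nu> x)"
    by (subst sum.reindex) (auto simp: inj_on_def)
  also have "\<dots> = measure \<nu> (Pair a ` C)" using assms by (simp add: measure_measure_pmf_finite)
  also have "\<dots> \<le> measure \<nu> (fst -` {a})"
    by (intro measure_pmf.finite_measure_mono) auto
  finally show ?thesis by (simp add: type_marginal_def pmf_map)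
qed

lemma expectation_type_marginal:
  fixes h :: "'a::finite \<Rightarrow> real"
  shows "measure_pmf.expectation \<nu> (\<lambda>x. h (fst x)) = (\<Sum>a\<in>UNIV. pmf (type_marginal \<nu>) a * h a)"
proof -
  have "measure_pmf.expectation \<nu> (\<lambda>x. h (fst x)) = measure_pmf.expectation (type_marginal \<nu>) h"
    by (simp add: type_marginal_def)
  then show ?thesis by (subst (asm) integral_measure_pmf[of UNIV]) auto
qed

text \<open>The optimal tilt is the logarithmic density, but it has to be bounded and normalised for
  each parent type. It is used on \<open>F\<close> only, replaced by 0 outside, and lowered by
  \<open>ln (1 + s a + e)\<close>, where \<open>s a\<close> is the mass of \<open>Q a\<close>
  outside \<open>F\<close>. On average this correction costs at most the \<open>q\<close>-mass
  outside \<open>F\<close> plus \<open>e\<close>.\<close>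

lemma finite_tilt:
  fixes Q :: "'a::finite \<Rightarrow> 'a list pmf" and \<nu> :: "('a \<times> 'a list) pmf"
  defines "q \<equiv> kernel_product (type_marginal \<nu>) Q"
  assumes F: "finite F" and pos: "\<And>x. x \<in> F \<Longrightarrow> x \<in> set_pmf \<nu> \<Longrightarrow> 0 < pmf q x" and e: "0 < e"
  shows "\<exists>f\<in>tilts Q. (\<Sum>x\<in>F. pmf \<nu> x * ln (pmf \<nu> x / pmf q x)) - measure q (- F) - e
      \<le> measure_pmf.expectation \<nu> f"
proof -
  let ?L = "\<lambda>x. ln (pmf \<nu> x / pmf q x)"
  define C where "C a = {c. (a, c) \<in> F}" for a
  have "C a \<subseteq> snd ` F" for a by (force simp: C_def)
  then have C: "finite (C a)" for a using F finite_subset by blast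
  define s where "s a = measure (Q a) (- C a)" for a
  have s0: "0 \<le> s a" for a by (simp add: s_def)
  \<comment> \<open>On points of \<open>F\<close> without \<nu>-mass the logarithm of the ratio
    should be minus infinity; the finite value \<open>ln e\<close> keeps their total weight under
    \<open>exp g\<close> below \<open>e\<close> and does not enter the \<nu>-integral.\<close>
  define g where "g x = (if x \<in> F then if pmf \<nu> x > 0 then ?L x else ln e else 0)" for x
  define f where "f x = g x - ln (1 + s (fst x) + e)" for x
  have "bounded (range g)"
  proof (rule finite_imp_bounded, rule finite_subset)
    show "range g \<subseteq> g ` F \<union> {0}" by (auto simp: g_def)
  qed (use F in auto)
  moreover have bl: "bounded (range (\<lambda>x::'a \<times> 'a list. ln (1 + s (fst x) + e)))"
  proof (rule finite_imp_bounded)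
    have "range (\<lambda>x::'a \<times> 'a list. ln (1 + s (fst x) + e)) \<subseteq> range (\<lambda>a. ln (1 + s a + e))" by auto
    then show "finite (range (\<lambda>x::'a \<times> 'a list. ln (1 + s (fst x) + e)))"
      by (rule finite_subset) simp
  qed
  ultimately have bf: "bounded (range f)" and bg: "bounded (range g)"
    unfolding f_def by (auto intro: bounded_minus_comp)
  have tilt: "measure_pmf.expectation (Q a) (\<lambda>c. exp (f (a, c))) \<le> 1" for a
  proof -
    have gi: "integrable (measure_pmf (Q a)) (\<lambda>c. exp (g (a, c)))"
      by (rule integrable_bounded_pmf[OF bounded_range_compose(2)[OF bg]])
    have le: "pmf (Q a) c * exp (g (a, c)) \<le> pmf \<nu> (a, c) / pmf (type_marginal \<nu>) a + e * pmf (Q a) c"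
      if "c \<in> C a" for c
    proof (cases "pmf \<nu> (a, c) > 0")
      case True
      then have x: "(a, c) \<in> F" "(a, c) \<in> set_pmf \<nu>" using that by (auto simp: C_def set_pmf_iff)
      have "0 < pmf (type_marginal \<nu>) a * pmf (Q a) c"
        using pos[OF x] by (simp add: q_def pmf_kernel_product)
      then have "0 < pmf (type_marginal \<nu>) a" "0 < pmf (Q a) c"
        by (simp_all add: zero_less_mult_iff)
      then have "pmf (Q a) c * exp (g (a, c)) = pmf \<nu> (a, c) / pmf (type_marginal \<nu>) a"
        using True x by (simp add: g_def q_def pmf_kernel_product)
      then show ?thesis using e by simp
    qed (use that e in \<open>simp add: g_def C_def mult.commute\<close>)
    have "measure_pmf.expectation (Q a) (\<lambda>c. exp (g (a, c)))
      = measure_pmf.expectation (Q a) (\<lambda>c. indicator (C a) c * exp (g (a, c)) + indicator (- C a) c)"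
      by (intro Bochner_Integration.integral_cong) (auto simp: g_def C_def indicator_def)
    also have "\<dots> = measure_pmf.expectation (Q a) (\<lambda>c. indicator (C a) c * exp (g (a, c))) + s a"
    proof -
      show ?thesis
        using integrable_real_mult_indicator[OF _ gi, of "C a"]
        by (subst Bochner_Integration.integral_add) (auto simp: s_def mult.commute)
    qed
    also have "measure_pmf.expectation (Q a) (\<lambda>c. indicator (C a) c * exp (g (a, c)))
      = (\<Sum>c\<in>C a. pmf (Q a) c * exp (g (a, c)))"
      by (subst integral_measure_pmf[OF C[of a]]) (auto simp: indicator_def)
    also have "\<dots> \<le> (\<Sum>c\<in>C a. pmf \<nu> (a, c) / pmf (type_marginal \<nu>) a + e * pmf (Q a) c)"
      by (intro sum_mono le)
    also have "\<dots> = (\<Sum>c\<in>C a. pmf \<nu> (a, c)) / pmf (type_marginal \<nu>) a + e * (\<Sum>c\<in>C a. pmf (Q a) c)"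
      by (simp add: sum.distrib sum_divide_distrib sum_distrib_left)
    also have "(\<Sum>c\<in>C a. pmf \<nu> (a, c)) / pmf (type_marginal \<nu>) a \<le> 1"
      using sum_pmf_le_type_marginal[OF C, of \<nu> a a] by (simp add: divide_le_eq_1 pmf_nonneg less_le)
    also have "(\<Sum>c\<in>C a. pmf (Q a) c) \<le> 1"
      using measure_measure_pmf_finite[OF C, of "Q a" a] measure_pmf.prob_le_1[of "Q a" "C a"] by simp
    finally have "measure_pmf.expectation (Q a) (\<lambda>c. exp (g (a, c))) \<le> 1 + s a + e"
      using e by simp
    then show ?thesis
      using s0[of a] e by (simp add: f_def exp_diff)
  qed
  have "f \<in> tilts Q" using bf tilt by (simp add: tilts_def)
  moreover have "(\<Sum>x\<in>F. pmf \<nu> x * ?L x) - measure q (- F) - e \<le> measure_pmf.expectation \<nu> f"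
  proof -
    have "measure_pmf.expectation \<nu> g = (\<Sum>x\<in>F. pmf \<nu> x * g x)"
      by (subst integral_measure_pmf[OF F]) (auto simp: g_def split: if_splits)
    also have "\<dots> = (\<Sum>x\<in>F. pmf \<nu> x * ?L x)"
      by (intro sum.cong) (auto simp: g_def less_le)
    finally have Eg: "measure_pmf.expectation \<nu> g = (\<Sum>x\<in>F. pmf \<nu> x * ?L x)" .
    have "(\<Sum>a\<in>UNIV. pmf (type_marginal \<nu>) a * ln (1 + s a + e))
        \<le> (\<Sum>a\<in>UNIV. pmf (type_marginal \<nu>) a * (s a + e))"
    proof (intro sum_mono mult_left_mono)
      fix a show "ln (1 + s a + e) \<le> s a + e"
        using ln_add_one_self_le_self[of "s a + e"] s0[of a] e by (simp add: add.assoc)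
    qed simp
    also have "\<dots> = (\<Sum>a\<in>UNIV. pmf (type_marginal \<nu>) a * s a) + e"
      by (simp add: distrib_left sum.distrib sum_distrib_right[symmetric] sum_pmf_eq_1)
    also have "(\<Sum>a\<in>UNIV. pmf (type_marginal \<nu>) a * s a) = measure_pmf.expectation q (indicator (- F))"
    proof -
      have "(\<lambda>c. indicator (- F) (a, c)) = (indicator (- C a) :: _ \<Rightarrow> real)" for a
        by (auto simp: C_def indicator_def)
      then show ?thesis
        unfolding q_def by (subst expectation_kernel_product(2)) (auto simp: s_def)
    qed
    also have "\<dots> = measure q (- F)" by simp
    finally have *: "(\<Sum>a\<in>UNIV. pmf (type_marginal \<nu>) a * ln (1 + s a + e)) \<le> measure q (- F) + e" .
    have "measure_pmf.expectation \<nu> f = measure_pmf.expectation \<nu> g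
        - (\<Sum>a\<in>UNIV. pmf (type_marginal \<nu>) a * ln (1 + s a + e))"
      unfolding f_def
      by (subst Bochner_Integration.integral_diff)
         (simp_all add: integrable_bounded_pmf bg bl expectation_type_marginal[of \<nu> "\<lambda>a. ln (1 + s a + e)"])
    then show ?thesis using * Eg by simp
  qed
  ultimately show ?thesis by blast
qed

lemma finite_to_nat_less [simp]: "finite {x :: 'b::countable. to_nat x < k}"
proof (rule finite_subset)
  show "{x :: 'b. to_nat x < k} \<subseteq> from_nat ` {..<k}"
    by (auto simp: image_iff) (metis from_nat_to_nat lessThan_iff)
qed simp

lemma expectation_LIMSEQ:
  fixes h :: "'b::countable \<Rightarrow> real"
  assumes h: "integrable (measure_pmf \<nu>) h"
  shows "(\<lambda>k. \<Sum>x | to_nat x < k. pmf \<nu> x * h x) \<longlonglongrightarrow> measure_pmf.expectation \<nu> h"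
proof -
  let ?F = "\<lambda>k. {x :: 'b. to_nat x < k}"
  have "(\<lambda>k. measure_pmf.expectation \<nu> (\<lambda>x. indicator (?F k) x * h x)) \<longlonglongrightarrow> measure_pmf.expectation \<nu> h"
  proof (rule integral_dominated_convergence[where w = "\<lambda>x. norm (h x)"])
    show "AE x in measure_pmf \<nu>. (\<lambda>k. indicator (?F k) x * h x) \<longlonglongrightarrow> h x"
    proof (rule AE_I2)
      fix x
      have "\<forall>\<^sub>F k in sequentially. indicator (?F k) x * h x = h x"
        using eventually_gt_at_top[of "to_nat x"] by eventually_elim simp
      then show "(\<lambda>k. indicator (?F k) x * h x) \<longlonglongrightarrow> h x" by (rule tendsto_eventually)
    qed
  qed (use h in \<open>auto simp: indicator_def\<close>)
  moreover have "measure_pmf.expectation \<nu> (\<lambda>x. indicator (?F k) x * h x) = (\<Sum>x\<in>?F k. pmf \<nu> x * h x)" for k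
    by (subst integral_measure_pmf[of "?F k"]) (auto simp: indicator_def)
  ultimately show ?thesis by simp
qed

lemma nn_integral_count_space_SUP:
  fixes f :: "'b::countable \<Rightarrow> ennreal"
  shows "(\<integral>\<^sup>+x. f x \<partial>count_space UNIV) = (SUP k. \<Sum>x | to_nat x < k. f x)"
proof -
  let ?F = "\<lambda>k. {x :: 'b. to_nat x < k}"
  have "(\<integral>\<^sup>+x. f x \<partial>count_space UNIV) = (\<integral>\<^sup>+x. (SUP k. f x * indicator (?F k) x) \<partial>count_space UNIV)"
  proof (rule nn_integral_cong)
    fix x
    have "(SUP k. f x * indicator (?F k) x) = f x"
    proof (rule antisym)
      show "(SUP k. f x * indicator (?F k) x) \<le> f x"
        by (rule SUP_least) (auto simp: indicator_def)
      show "f x \<le> (SUP k. f x * indicator (?F k) x)"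
        by (rule SUP_upper2[of "Suc (to_nat x)"]) auto
    qed
    then show "f x = (SUP k. f x * indicator (?F k) x)" by simp
  qed
  also have "\<dots> = (SUP k. \<integral>\<^sup>+x. f x * indicator (?F k) x \<partial>count_space UNIV)"
    by (rule nn_integral_monotone_convergence_SUP)
       (auto simp: incseq_def le_fun_def indicator_def intro!: mult_left_mono)
  also have "\<dots> = (SUP k. \<Sum>x | to_nat x < k. f x)"
    by (intro SUP_cong refl, subst nn_integral_count_space'[of "?F _"]) (auto simp: indicator_def)
  finally show ?thesis .
qed

text \<open>The negative part is always integrable: \<open>- ln y\<close> is at most
  \<open>1 / y\<close>, and the mean of \<open>q/\<nu>\<close> under \<nu> is at most 1. The
  positive part is a supremum of finite sums, all controlled by \<open>B\<close>.\<close>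

lemma integrable_entropy_density:
  fixes \<nu> q :: "'b::countable pmf"
  assumes ac: "absolutely_continuous (measure_pmf q) (measure_pmf \<nu>)"
    and bound: "\<And>F. finite F \<Longrightarrow> F \<subseteq> set_pmf \<nu> \<Longrightarrow> (\<Sum>x\<in>F. pmf \<nu> x * ln (pmf \<nu> x / pmf q x)) \<le> B"
  shows "integrable (measure_pmf \<nu>) (entropy_density (exp 1) (measure_pmf q) (measure_pmf \<nu>))"
proof -
  let ?D = "entropy_density (exp 1) (measure_pmf q) (measure_pmf \<nu>)"
  let ?F = "\<lambda>k. {x :: 'b. to_nat x < k}"
  have D: "?D x = ln (pmf \<nu> x / pmf q x)" "0 < pmf q x" "0 < pmf \<nu> x" if "x \<in> set_pmf \<nu>" for x
    using entropy_density_pmf[OF ac that] that by (auto intro: pmf_positive)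
  have neg: "(\<integral>\<^sup>+x. ennreal (- ?D x) \<partial>\<nu>) \<le> 1"
  proof -
    have "(\<integral>\<^sup>+x. ennreal (- ?D x) \<partial>\<nu>) \<le> (\<integral>\<^sup>+x. 1 * ennreal (pmf q x / pmf \<nu> x) \<partial>\<nu>)"
    proof (rule nn_integral_mono_AE, unfold AE_measure_pmf_iff, rule ballI)
      fix x assume x: "x \<in> set_pmf \<nu>"
      have "- ?D x = ln (pmf q x / pmf \<nu> x)" using D[OF x] by (simp add: ln_div)
      also have "\<dots> \<le> pmf q x / pmf \<nu> x" using D[OF x] by (intro ln_le_minus_one[THEN order_trans]) auto
      finally show "ennreal (- ?D x) \<le> 1 * ennreal (pmf q x / pmf \<nu> x)" by (simp add: ennreal_leI)
    qed
    also have "\<dots> \<le> (\<integral>\<^sup>+x. 1 \<partial>q)" by (rule nn_integral_pmf_ratio)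
    finally show ?thesis by simp
  qed
  have pos: "(\<integral>\<^sup>+x. ennreal (?D x) \<partial>\<nu>) \<le> ennreal B"
  proof -
    have "(\<integral>\<^sup>+x. ennreal (?D x) \<partial>\<nu>) = (SUP k. \<Sum>x\<in>?F k. ennreal (pmf \<nu> x) * ennreal (?D x))"
      by (simp only: nn_integral_measure_pmf nn_integral_count_space_SUP)
    also have "\<dots> \<le> ennreal B"
    proof (rule SUP_least)
      fix k
      \<comment> \<open>Keeping only the points with nonnegative density makes the partial sums of
        the positive part instances of \<open>bound\<close>.\<close>
      let ?G = "{x \<in> ?F k. x \<in> set_pmf \<nu> \<and> 0 \<le> ?D x}"
      have fin: "finite ?G" by simp
      have "(\<Sum>x\<in>?F k. ennreal (pmf \<nu> x) * ennreal (?D x)) = (\<Sum>x\<in>?G. ennreal (pmf \<nu> x) * ennreal (?D x))"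
        by (rule sum.mono_neutral_right) (auto simp: set_pmf_iff ennreal_eq_0_iff)
      also have "\<dots> = (\<Sum>x\<in>?G. ennreal (pmf \<nu> x * ln (pmf \<nu> x / pmf q x)))"
        using D(1) by (intro sum.cong) (auto simp: ennreal_mult)
      also have "\<dots> = ennreal (\<Sum>x\<in>?G. pmf \<nu> x * ln (pmf \<nu> x / pmf q x))"
        using D(1) by (intro sum_ennreal) auto
      also have "\<dots> \<le> ennreal B" by (intro ennreal_leI bound fin) auto
      finally show "(\<Sum>x\<in>?F k. ennreal (pmf \<nu> x) * ennreal (?D x)) \<le> ennreal B" .
    qed
    finally show ?thesis .
  qed
  have "(\<integral>\<^sup>+x. ennreal (norm (?D x)) \<partial>\<nu>) \<le> (\<integral>\<^sup>+x. ennreal (?D x) + ennreal (- ?D x) \<partial>\<nu>)"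
    by (intro nn_integral_mono) (auto simp: abs_if)
  also have "\<dots> = (\<integral>\<^sup>+x. ennreal (?D x) \<partial>\<nu>) + (\<integral>\<^sup>+x. ennreal (- ?D x) \<partial>\<nu>)"
    by (intro nn_integral_add) auto
  also have "\<dots> \<le> ennreal B + 1" by (intro add_mono pos neg)
  also have "\<dots> < \<infinity>" by simp
  finally show ?thesis by (intro integrableI_bounded) auto
qed

text \<open>The converse half of the variational formula, in the three cases of the definition. If
  \<nu> charges a point \<open>x = (a, c)\<close> that \<open>q\<close> misses, then
  \<open>c\<close> has probability 0 under \<open>Q a\<close>, and every multiple of the indicator
  of \<open>x\<close> is a tilt. If the density is not integrable, its finite sums are unbounded.
  Otherwise they converge to the entropy.\<close>

lemma less_entropy_rel_tilt:
  fixes Q :: "'a::finite \<Rightarrow> 'a list pmf"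
  assumes less: "ereal \<alpha> < entropy_rel Q \<nu>"
  shows "\<exists>f\<in>tilts Q. \<alpha> < measure_pmf.expectation \<nu> f"
proof -
  define q where "q = kernel_product (type_marginal \<nu>) Q"
  let ?D = "entropy_density (exp 1) (measure_pmf q) (measure_pmf \<nu>)"
  let ?L = "\<lambda>x. ln (pmf \<nu> x / pmf q x)"
  consider (nac) "\<not> absolutely_continuous (measure_pmf q) (measure_pmf \<nu>)"
    | (nint) "absolutely_continuous (measure_pmf q) (measure_pmf \<nu>)" "\<not> integrable (measure_pmf \<nu>) ?D"
    | (int) "absolutely_continuous (measure_pmf q) (measure_pmf \<nu>)" "integrable (measure_pmf \<nu>) ?D"
    by blast
  then show ?thesis
  proof cases
    case nac
    then obtain A where "emeasure q A = 0" "emeasure \<nu> A \<noteq> 0"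
      by (auto simp: absolutely_continuous_def null_sets_def)
    then obtain x where x: "x \<in> A" "x \<in> set_pmf \<nu>"
      by (metis AE_measure_pmf_iff AE_iff_measurable UNIV_I measure_pmf.emeasure_eq_measure
          disjoint_iff emeasure_Int_set_pmf emeasure_empty)
    have "emeasure q {x} \<le> emeasure q A" using x by (intro emeasure_mono) auto
    then have q0: "pmf q x = 0" using \<open>emeasure q A = 0\<close> by (simp add: emeasure_pmf_single)
    obtain a c where ac: "x = (a, c)" by (cases x)
    have \<nu>x: "0 < pmf \<nu> x" using x by (simp add: pmf_positive)
    then have "0 < pmf (type_marginal \<nu>) a" using pmf_type_marginal_ge[of \<nu> a c] by (simp add: ac)
    then have Q0: "c \<notin> set_pmf (Q a)" using q0 by (simp add: q_def ac pmf_kernel_product set_pmf_iff)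
    \<comment> \<open>Chosen so that the mean under \<nu> becomes
      \<open>\<bar>\<alpha>\<bar> + 1\<close>.\<close>
    define M where "M = (\<bar>\<alpha>\<bar> + 1) / pmf \<nu> x"
    define f where "f = (\<lambda>y. M * indicator {x} y)"
    have "measure_pmf.expectation (Q b) (\<lambda>d. exp (f (b, d))) = measure_pmf.expectation (Q b) (\<lambda>d. 1)" for b
      by (rule integral_cong_AE) (use Q0 in \<open>auto simp: AE_measure_pmf_iff f_def ac indicator_def\<close>)
    then have "f \<in> tilts Q"
      by (auto simp: tilts_def f_def indicator_def intro!: boundedI[of _ "\<bar>M\<bar>"])
    moreover have "measure_pmf.expectation \<nu> f = \<bar>\<alpha>\<bar> + 1"
      unfolding f_def using \<nu>x by (simp add: measure_pmf_single M_def)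
    ultimately show ?thesis by (intro bexI[of _ f]) auto
  next
    case nint
    \<comment> \<open>Two units above \<alpha>: one pays for the \<open>q\<close>-mass outside
      \<open>F\<close>, the other for the parameter 1 of the tilt.\<close>
    have "\<exists>F. finite F \<and> F \<subseteq> set_pmf \<nu> \<and> \<alpha> + 2 < (\<Sum>x\<in>F. pmf \<nu> x * ?L x)"
      using integrable_entropy_density[OF nint(1), of "\<alpha> + 2"] nint(2) by (meson not_le)
    then obtain F where F: "finite F" "F \<subseteq> set_pmf \<nu>" "\<alpha> + 2 < (\<Sum>x\<in>F. pmf \<nu> x * ?L x)" by blast
    obtain f where "f \<in> tilts Q"
      "(\<Sum>x\<in>F. pmf \<nu> x * ?L x) - measure q (- F) - 1 \<le> measure_pmf.expectation \<nu> f"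
      using finite_tilt[OF F(1), of \<nu> Q 1] entropy_density_pmf(1)[OF nint(1)] by (auto simp: q_def)
    then show ?thesis
      using F(3) measure_pmf.prob_le_1[of q "- F"] by (intro bexI[of _ f]) linarith+
  next
    case int
    have KL: "\<alpha> < measure_pmf.expectation \<nu> ?D"
      using less int by (simp add: relative_entropy_def KL_divergence_def q_def)
    have "(\<lambda>k. \<Sum>x | to_nat x < k. pmf \<nu> x * ?D x) \<longlonglongrightarrow> measure_pmf.expectation \<nu> ?D"
      by (rule expectation_LIMSEQ[OF int(2)])
    moreover have "(\<lambda>k. \<Sum>x | to_nat x < k. pmf q x * 1) \<longlonglongrightarrow> measure_pmf.expectation q (\<lambda>x. 1)"
      by (rule expectation_LIMSEQ) simp
    ultimately have "(\<lambda>k. (\<Sum>x | to_nat x < k. pmf \<nu> x * ?D x) - (1 - (\<Sum>x | to_nat x < k. pmf q x * 1)))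
      \<longlonglongrightarrow> measure_pmf.expectation \<nu> ?D - (1 - measure_pmf.expectation q (\<lambda>x. 1))"
      by (intro tendsto_intros)
    then have "\<forall>\<^sub>F k in sequentially. \<alpha> < (\<Sum>x | to_nat x < k. pmf \<nu> x * ?D x)
        - (1 - (\<Sum>x | to_nat x < k. pmf q x * 1))"
      using KL by (intro order_tendstoD) auto
    then obtain k where k: "\<alpha> < (\<Sum>x | to_nat x < k. pmf \<nu> x * ?D x)
        - (1 - (\<Sum>x | to_nat x < k. pmf q x))"
      by (auto simp: eventually_sequentially)
    let ?F = "{x :: 'a \<times> 'a list. to_nat x < k}"
    have D: "(\<Sum>x\<in>?F. pmf \<nu> x * ?D x) = (\<Sum>x\<in>?F. pmf \<nu> x * ?L x)"
    proof (intro sum.cong refl)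
      fix x show "pmf \<nu> x * ?D x = pmf \<nu> x * ?L x"
        by (cases "x \<in> set_pmf \<nu>") (auto simp: entropy_density_pmf(2)[OF int(1)] set_pmf_iff)
    qed
    have m: "measure q (- ?F) = 1 - (\<Sum>x\<in>?F. pmf q x)"
      using measure_pmf.prob_compl[of ?F q] by (simp add: measure_measure_pmf_finite Compl_eq_Diff_UNIV)
    \<comment> \<open>Half of the margin that remains after the mass outside the finite set has been
      deducted.\<close>
    define e where "e = ((\<Sum>x\<in>?F. pmf \<nu> x * ?L x) - measure q (- ?F) - \<alpha>) / 2"
    have e: "0 < e" using k by (simp add: e_def D m)
    obtain f where "f \<in> tilts Q"
      "(\<Sum>x\<in>?F. pmf \<nu> x * ?L x) - measure q (- ?F) - e \<le> measure_pmf.expectation \<nu> f"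
      using finite_tilt[OF _ _ e, of ?F \<nu> Q] entropy_density_pmf(1)[OF int(1)] by (auto simp: q_def)
    then show ?thesis using e by (intro bexI[of _ f]) (auto simp: e_def field_simps)
  qed
qed

lemma entropy_rel_leI:
  fixes Q :: "'a::finite \<Rightarrow> 'a list pmf"
  assumes "\<And>f. f \<in> tilts Q \<Longrightarrow> ereal (measure_pmf.expectation \<nu> f) \<le> u"
  shows "entropy_rel Q \<nu> \<le> u"
proof (rule ereal_le_real)
  fix z assume "u \<le> ereal z"
  then show "entropy_rel Q \<nu> \<le> ereal z"
    using assms less_entropy_rel_tilt[where \<alpha> = z and Q = Q and \<nu> = \<nu>] by (meson ereal_less_eq(3) linorder_not_less order_trans)
qed

lemma entropy_rel_nonneg: "0 \<le> entropy_rel Q (\<nu> :: ('a::finite \<times> 'a list) pmf)"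
  using tilt_le_entropy_rel[where f = "\<lambda>_. 0" and Q = Q and \<nu> = \<nu>] by (simp add: tilts_def zero_ereal_def)

section \<open>The topology on offspring measures\<close>

lemma openin_test_function:
  "f \<in> offspring_test_functions \<Longrightarrow> open U \<Longrightarrow>
    openin offspring_topology {\<nu> \<in> offspring_measures. measure_pmf.expectation \<nu> f \<in> U}"
  unfolding offspring_topology_def by (intro topology_generated_by_Basis) blast

lemma continuous_map_test_function:
  assumes "f \<in> offspring_test_functions"
  shows "continuous_map offspring_topology euclideanreal (\<lambda>\<nu>. measure_pmf.expectation \<nu> f)"
  using openin_test_function[OF assms]
  by (auto simp: continuous_map_def topspace_offspring_topology)

lemma continuous_map_bounded:
  "bounded (range f) \<Longrightarrow>
    continuous_map offspring_topology euclideanreal (\<lambda>\<nu>. measure_pmf.expectation \<nu> f)"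
  by (rule continuous_map_test_function) (simp add: offspring_test_functions_def)

lemma integrable_length:
  "\<nu> \<in> offspring_measures \<Longrightarrow> integrable (measure_pmf \<nu>) (\<lambda>x. real (length (snd x)))"
  by (rule integrableI_bounded) (auto simp: offspring_measures_def case_prod_unfold)

lemma integrable_linear_growth:
  fixes f :: "'a \<times> 'a list \<Rightarrow> real"
  assumes "\<nu> \<in> offspring_measures" "\<And>x. \<bar>f x\<bar> \<le> C * (1 + real (length (snd x)))"
  shows "integrable (measure_pmf \<nu>) f"
proof (rule Bochner_Integration.integrable_bound)
  show "integrable (measure_pmf \<nu>) (\<lambda>x. C * (1 + real (length (snd x))))"
    using integrable_length[OF assms(1)] by auto
  show "AE x in measure_pmf \<nu>. norm (f x) \<le> norm (C * (1 + real (length (snd x))))"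
    using assms(2) by (auto intro!: AE_I2 order_trans[OF _ abs_ge_self])
qed simp

lemma count_list_le: "real (count_list c a) \<le> real (length c)"
  by (simp add: count_le_length)

lemma count_indicator_growth:
  "\<bar>real (count_list c a) * indicator A b\<bar> \<le> 1 * (1 + real (length c))"
  using count_list_le[of c a] by (cases "b \<in> A") auto

lemma integrable_count:
  "\<nu> \<in> offspring_measures \<Longrightarrow> integrable (measure_pmf \<nu>) (\<lambda>x. real (count_list (snd x) a))"
  using count_indicator_growth[of _ a UNIV undefined]
  by (intro integrable_linear_growth[where C = 1]) simp_all

text \<open>The unbounded test functions fix the type of the parent; summing over the finitely many
  parent types removes this restriction.\<close>

lemma continuous_map_count:
  fixes a :: "'a::finite"
  shows "continuous_map offspring_topology euclideanreal
    (\<lambda>\<nu>. measure_pmf.expectation \<nu> (\<lambda>x. real (count_list (snd x) a)))"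
proof -
  let ?f = "\<lambda>b :: 'a. \<lambda>x. real (count_list (snd x) a) * indicator {b} (fst x)"
  have eq: "measure_pmf.expectation \<nu> (\<lambda>x. real (count_list (snd x) a))
      = (\<Sum>b\<in>UNIV. measure_pmf.expectation \<nu> (?f b))" if "\<nu> \<in> offspring_measures" for \<nu> :: "('a \<times> 'a list) pmf"
  proof -
    have "integrable (measure_pmf \<nu>) (?f b)" for b
      by (rule integrable_linear_growth[OF that count_indicator_growth])
    then have "(\<Sum>b\<in>UNIV. measure_pmf.expectation \<nu> (?f b)) = measure_pmf.expectation \<nu> (\<lambda>x. \<Sum>b\<in>UNIV. ?f b x)"
      by (subst Bochner_Integration.integral_sum) auto
    also have "(\<lambda>x. \<Sum>b\<in>UNIV. ?f b x) = (\<lambda>x. real (count_list (snd x) a))"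
      by (auto simp: sum_distrib_left[symmetric] indicator_def)
    finally show ?thesis by simp
  qed
  have "continuous_map offspring_topology euclideanreal (\<lambda>\<nu>. \<Sum>b\<in>UNIV. measure_pmf.expectation \<nu> (?f b))"
    by (intro continuous_map_sum continuous_map_test_function)
       (simp, unfold offspring_test_functions_def case_prod_unfold, blast)
  then show ?thesis
    by (rule continuous_map_eq) (simp add: topspace_offspring_topology eq)
qed

definition near :: "('b \<Rightarrow> real) set \<Rightarrow> real \<Rightarrow> 'b pmf \<Rightarrow> 'b pmf \<Rightarrow> bool" where
  "near \<Phi> \<eta> \<nu> \<nu>' \<longleftrightarrow> (\<forall>f\<in>\<Phi>. \<bar>measure_pmf.expectation \<nu>' f - measure_pmf.expectation \<nu> f\<bar> < \<eta>)"

text \<open>Induction over the generation of the topology: an intersection joins the two families of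
  tests and takes the smaller radius. The lower bound thus has to control finitely many expectations
  only.\<close>

lemma openin_offspring_nbhd:
  assumes "openin offspring_topology G" "\<nu> \<in> G"
  obtains \<Phi> \<eta> where "finite \<Phi>" "\<Phi> \<subseteq> offspring_test_functions" "0 < \<eta>"
    "\<And>\<nu>'. \<nu>' \<in> offspring_measures \<Longrightarrow> near \<Phi> \<eta> \<nu> \<nu>' \<Longrightarrow> \<nu>' \<in> G"
proof -
  define good where "good G \<Phi> \<eta> \<longleftrightarrow> finite \<Phi> \<and> \<Phi> \<subseteq> offspring_test_functions \<and> 0 < \<eta> \<and>
    (\<forall>\<nu>'. \<nu>' \<in> offspring_measures \<longrightarrow> near \<Phi> \<eta> \<nu> \<nu>' \<longrightarrow> \<nu>' \<in> G)" for G \<Phi> \<eta>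
  have "generate_topology_on {{\<nu> \<in> offspring_measures. measure_pmf.expectation \<nu> f \<in> U} | f U.
        f \<in> offspring_test_functions \<and> open U} G"
    using assms(1) unfolding offspring_topology_def openin_topology_generated_by_iff .
  then have "\<exists>\<Phi> \<eta>. good G \<Phi> \<eta>" using assms(2)
  proof induction
    case Empty
    then show ?case by simp
  next
    case (Int A B)
    then obtain \<Phi>1 \<eta>1 \<Phi>2 \<eta>2 where *: "good A \<Phi>1 \<eta>1" "good B \<Phi>2 \<eta>2" by auto
    have "near (\<Phi>1 \<union> \<Phi>2) (min \<eta>1 \<eta>2) \<nu> \<nu>' \<Longrightarrow> near \<Phi>1 \<eta>1 \<nu> \<nu>' \<and> near \<Phi>2 \<eta>2 \<nu> \<nu>'" for \<nu>'
      by (simp add: near_def)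
    with * have "good (A \<inter> B) (\<Phi>1 \<union> \<Phi>2) (min \<eta>1 \<eta>2)" by (simp add: good_def)
    then show ?case by blast
  next
    case (UN K)
    then obtain k where k: "k \<in> K" "\<nu> \<in> k" by blast
    with UN.IH[of k] obtain \<Phi> \<eta> where "good k \<Phi> \<eta>" by blast
    then have "good (\<Union> K) \<Phi> \<eta>" using k(1) by (auto simp: good_def)
    then show ?case by blast
  next
    case (Basis s)
    then obtain f U where fU: "s = {\<nu> \<in> offspring_measures. measure_pmf.expectation \<nu> f \<in> U}"
      "f \<in> offspring_test_functions" "open U" by blast
    then have "measure_pmf.expectation \<nu> f \<in> U" using Basis by simp
    with \<open>open U\<close> obtain \<eta> where "0 < \<eta>" "\<And>y. dist y (measure_pmf.expectation \<nu> f) < \<eta> \<Longrightarrow> y \<in> U"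
      by (metis open_dist)
    then have "good s {f} \<eta>" using fU by (simp add: good_def near_def dist_real_def)
    then show ?case by blast
  qed
  then show ?thesis using that unfolding good_def by blast
qed

text \<open>Finite partial sums in place of an integral make this a closed condition on the mass
  function for pointwise convergence, and integrability is built in.\<close>

definition moment_le :: "(nat \<Rightarrow> real) \<Rightarrow> real \<Rightarrow> ('a \<times> 'a list) pmf \<Rightarrow> bool" where
  "moment_le \<phi> L \<nu> \<longleftrightarrow> (\<forall>F. finite F \<longrightarrow> (\<Sum>x\<in>F. pmf \<nu> x * \<phi> (length (snd x))) \<le> L)"

lemma moment_le_integrable:
  fixes \<nu> :: "('a::countable \<times> 'a list) pmf"
  assumes "moment_le \<phi> L \<nu>" and nn: "\<And>n. 0 \<le> \<phi> n"
  shows "integrable (measure_pmf \<nu>) (\<lambda>x. \<phi> (length (snd x)))"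
    "measure_pmf.expectation \<nu> (\<lambda>x. \<phi> (length (snd x))) \<le> L"
proof -
  have L: "0 \<le> L" using assms(1) by (auto simp: moment_le_def dest: spec[of _ "{}"])
  have "(\<integral>\<^sup>+x. ennreal (\<phi> (length (snd x))) \<partial>\<nu>)
      = (\<integral>\<^sup>+x. ennreal (pmf \<nu> x * \<phi> (length (snd x))) \<partial>count_space UNIV)"
    by (simp add: nn_integral_measure_pmf ennreal_mult nn)
  also have "\<dots> \<le> ennreal L"
    unfolding nn_integral_count_space_SUP using assms(1)
    by (intro SUP_least, subst sum_ennreal) (auto simp: moment_le_def nn intro!: ennreal_leI)
  finally have *: "(\<integral>\<^sup>+x. ennreal (\<phi> (length (snd x))) \<partial>\<nu>) \<le> ennreal L" .
  show i: "integrable (measure_pmf \<nu>) (\<lambda>x. \<phi> (length (snd x)))"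
  proof (rule integrableI_bounded)
    have "(\<integral>\<^sup>+x. ennreal (norm (\<phi> (length (snd x)))) \<partial>\<nu>) \<le> ennreal L" using * nn by simp
    then show "(\<integral>\<^sup>+x. ennreal (norm (\<phi> (length (snd x)))) \<partial>\<nu>) < \<infinity>"
      by (rule le_less_trans) simp
  qed simp
  show "measure_pmf.expectation \<nu> (\<lambda>x. \<phi> (length (snd x))) \<le> L"
    using * L nn nn_integral_eq_integral[OF i] by (simp add: integral_nonneg)
qed

definition superlinear :: "(nat \<Rightarrow> real) \<Rightarrow> bool" where
  "superlinear \<phi> \<longleftrightarrow> (\<forall>n. 0 \<le> \<phi> n) \<and> (\<forall>k. finite {n. \<phi> n < k * (1 + real n)})"

text \<open>The points where superlinear growth has not yet set in. Outside them
  \<open>1 + length\<close> is at most \<open>\<phi> / k\<close>, and there are finitely many of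
  them because the alphabet is finite.\<close>

definition light_words :: "(nat \<Rightarrow> real) \<Rightarrow> real \<Rightarrow> ('a \<times> 'a list) set" where
  "light_words \<phi> k = {x. \<phi> (length (snd x)) < k * (1 + real (length (snd x)))}"

lemma finite_light_words:
  assumes "superlinear \<phi>" shows "finite (light_words \<phi> k :: ('a::finite \<times> 'a list) set)"
proof -
  let ?N = "{n. \<phi> n < k * (1 + real n)}"
  have "finite ?N" using assms by (simp add: superlinear_def)
  then obtain m where "\<And>n. n \<in> ?N \<Longrightarrow> n \<le> m" by (meson finite_nat_set_iff_bounded_le)
  then have "light_words \<phi> k \<subseteq> (UNIV :: 'a set) \<times> {c :: 'a list. length c \<le> m}"
    by (auto simp: light_words_def)
  then show ?thesis by (rule finite_subset) (simp add: finite_words)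
qed

text \<open>Outside the light words a function of linear growth is at most \<open>C / k\<close>
  times \<phi>. The truncation error is therefore uniform over all measures with the same moment
  bound.\<close>

lemma expectation_light_words:
  fixes f :: "'a::finite \<times> 'a list \<Rightarrow> real"
  assumes \<phi>: "superlinear \<phi>" and m: "moment_le \<phi> L \<nu>" and \<nu>: "\<nu> \<in> offspring_measures"
    and f: "\<And>x. \<bar>f x\<bar> \<le> C * (1 + real (length (snd x)))" and C: "0 \<le> C" and k: "0 < k"
  shows "\<bar>measure_pmf.expectation \<nu> f - (\<Sum>x\<in>light_words \<phi> k. pmf \<nu> x * f x)\<bar> \<le> C * L / k"
proof -
  let ?W = "light_words \<phi> k :: ('a \<times> 'a list) set"
  have fW: "finite ?W" by (rule finite_light_words[OF \<phi>])
  have nn: "0 \<le> \<phi> n" for n using \<phi> by (simp add: superlinear_def)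
  have i: "integrable (measure_pmf \<nu>) f" by (rule integrable_linear_growth[OF \<nu> f])
  have i1: "integrable (measure_pmf \<nu>) (\<lambda>x. indicator ?W x * f x)"
    using integrable_real_mult_indicator[OF _ i, of ?W] by (simp add: mult.commute)
  have "(\<Sum>x\<in>?W. pmf \<nu> x * f x) = measure_pmf.expectation \<nu> (\<lambda>x. indicator ?W x * f x)"
    by (subst integral_measure_pmf[OF fW]) (auto simp: indicator_def)
  then have "\<bar>measure_pmf.expectation \<nu> f - (\<Sum>x\<in>?W. pmf \<nu> x * f x)\<bar>
      = \<bar>measure_pmf.expectation \<nu> (\<lambda>x. f x - indicator ?W x * f x)\<bar>"
    using i i1 by simp
  also have "\<dots> \<le> measure_pmf.expectation \<nu> (\<lambda>x. \<bar>f x - indicator ?W x * f x\<bar>)"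
    by (rule integral_abs_bound)
  also have "\<dots> \<le> measure_pmf.expectation \<nu> (\<lambda>x. C / k * \<phi> (length (snd x)))"
  proof (rule integral_mono)
    fix x :: "'a \<times> 'a list"
    have "\<bar>f x\<bar> \<le> C / k * \<phi> (length (snd x))" if "x \<notin> ?W"
    proof -
      have "C * (k * (1 + real (length (snd x)))) \<le> C * \<phi> (length (snd x))"
        using that C by (intro mult_left_mono) (auto simp: light_words_def)
      then have "k * (C * (1 + real (length (snd x)))) \<le> C * \<phi> (length (snd x))"
        by (simp add: mult_ac)
      moreover have "k * \<bar>f x\<bar> \<le> k * (C * (1 + real (length (snd x))))"
        using f k by (intro mult_left_mono) auto
      ultimately have "k * \<bar>f x\<bar> \<le> C * \<phi> (length (snd x))" by (rule order_trans[rotated])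
      then show ?thesis using k by (simp add: pos_le_divide_eq mult.commute)
    qed
    then show "\<bar>f x - indicator ?W x * f x\<bar> \<le> C / k * \<phi> (length (snd x))"
      using C k nn[of "length (snd x)"] by (cases "x \<in> ?W") auto
  qed (use i i1 moment_le_integrable(1)[OF m nn] in auto)
  also have "\<dots> = C / k * measure_pmf.expectation \<nu> (\<lambda>x. \<phi> (length (snd x)))" by simp
  also have "\<dots> \<le> C / k * L"
    using moment_le_integrable(2)[OF m nn] C k by (intro mult_left_mono) auto
  finally show ?thesis by simp
qed

lemma moment_le_offspring_measures:
  fixes \<nu> :: "('a::finite \<times> 'a list) pmf"
  assumes \<phi>: "superlinear \<phi>" and m: "moment_le \<phi> L \<nu>"
  shows "\<nu> \<in> offspring_measures"
proof -
  have nn: "0 \<le> \<phi> n" for n using \<phi> by (simp add: superlinear_def)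
  have "finite {n. \<phi> n < 1 * (1 + real n)}" using \<phi> unfolding superlinear_def by blast
  then obtain R where "\<And>n. n \<in> {n. \<phi> n < 1 * (1 + real n)} \<Longrightarrow> n \<le> R"
    by (meson finite_nat_set_iff_bounded_le)
  then have le: "real n \<le> \<phi> n + real R" for n
    using nn[of n] by (cases "\<phi> n < 1 * (1 + real n)") (fastforce simp: not_less)+
  have "integrable (measure_pmf \<nu>) (\<lambda>x. real (length (snd x)))"
  proof (rule Bochner_Integration.integrable_bound)
    show "integrable (measure_pmf \<nu>) (\<lambda>x. \<phi> (length (snd x)) + real R)"
      using moment_le_integrable(1)[OF m nn] by auto
  qed (use le nn in auto)
  then show ?thesis
    by (auto simp: offspring_measures_def case_prod_unfold integrable_iff_bounded)
qed

lemma test_function_growth: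
  fixes f :: "'a \<times> 'a list \<Rightarrow> real"
  assumes "f \<in> offspring_test_functions"
  shows "\<exists>C\<ge>0. \<forall>x. \<bar>f x\<bar> \<le> C * (1 + real (length (snd x)))"
proof -
  consider B where "\<And>x. \<bar>f x\<bar> \<le> B"
    | a b where "f = (\<lambda>(b', c). real (count_list c a) * indicator {b} b')"
    using assms by (auto simp: offspring_test_functions_def bounded_iff)
  then show ?thesis
  proof cases
    case 1
    have B: "0 \<le> B" using 1[of undefined] by linarith
    have "\<bar>f x\<bar> \<le> B * (1 + real (length (snd x)))" for x
      unfolding distrib_left mult_1_right
      using 1[of x] mult_nonneg_nonneg[OF B, of "real (length (snd x))"] by linarith
    then show ?thesis using B by blast
  next
    case 2
    then show ?thesis
      by (intro exI[of _ 1]) (simp add: case_prod_unfold count_indicator_growth[simplified])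
  qed
qed

text \<open>A pointwise limit of mass functions may lose mass; the third assumption is the tightness
  that prevents it.\<close>

lemma embed_pmf_tight:
  fixes p :: "'b::countable \<Rightarrow> real"
  assumes nn: "\<And>x. 0 \<le> p x" and le: "\<And>F. finite F \<Longrightarrow> sum p F \<le> 1"
    and ge: "\<And>e. 0 < e \<Longrightarrow> \<exists>F. finite F \<and> 1 - e \<le> sum p F"
  shows "pmf (embed_pmf p) = p"
proof -
  have "(\<integral>\<^sup>+x. ennreal (p x) \<partial>count_space UNIV) \<le> 1"
    unfolding nn_integral_count_space_SUP
    by (intro SUP_least, subst sum_ennreal) (auto simp: nn le ennreal_le_1)
  moreover have "1 \<le> (\<integral>\<^sup>+x. ennreal (p x) \<partial>count_space UNIV)"
  proof (rule ennreal_le_epsilon)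
    fix e :: real assume "0 < e"
    then obtain F where F: "finite F" "1 - e \<le> sum p F" using ge by blast
    have "1 \<le> ennreal (sum p F + e)" using F by simp
    also have "\<dots> = ennreal (sum p F) + ennreal e"
      using \<open>0 < e\<close> by (intro ennreal_plus) (auto simp: nn sum_nonneg)
    also have "ennreal (sum p F) = (\<integral>\<^sup>+x. ennreal (p x) * indicator F x \<partial>count_space UNIV)"
      using F by (subst nn_integral_count_space'[of F]) (auto simp: nn indicator_def)
    also have "\<dots> \<le> (\<integral>\<^sup>+x. ennreal (p x) \<partial>count_space UNIV)"
      by (intro nn_integral_mono) (auto simp: indicator_def)
    finally show "1 \<le> (\<integral>\<^sup>+x. ennreal (p x) \<partial>count_space UNIV) + ennreal e" by simp
  qed
  ultimately have "(\<integral>\<^sup>+x. ennreal (p x) \<partial>count_space UNIV) = 1" by (rule antisym)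
  then show ?thesis by (intro ext pmf_embed_pmf) (auto simp: nn)
qed

text \<open>\<open>P\<close> describes the mass functions of these measures by closed conditions in
  a product of unit intervals, which is compact; the last family of conditions, the truncation
  estimate for the constant 1, forces total mass one. On \<open>P\<close> pointwise convergence
  implies convergence of all test integrals, so the set is a continuous image of a compact
  set.\<close>

lemma compactin_moment_le:
  assumes \<phi>: "superlinear \<phi>"
  shows "compactin offspring_topology {\<nu> :: ('a::finite \<times> 'a list) pmf. moment_le \<phi> L \<nu>}"
proof -
  let ?W = "\<lambda>k. light_words \<phi> k :: ('a \<times> 'a list) set"
  define P where "P = PiE UNIV (\<lambda>_ :: 'a \<times> 'a list. {0..1::real})
    \<inter> (\<Inter>F\<in>{F. finite F}. {p. sum p F \<le> 1})
    \<inter> (\<Inter>F\<in>{F. finite F}. {p. (\<Sum>x\<in>F. p x * \<phi> (length (snd x))) \<le> L})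
    \<inter> (\<Inter>k\<in>{0<..}. {p. 1 - L / k \<le> sum p (?W k)})"
  have nn: "0 \<le> \<phi> n" for n using \<phi> by (simp add: superlinear_def)
  have "compactin (product_topology (\<lambda>_ :: 'a \<times> 'a list. euclideanreal) UNIV) (PiE UNIV (\<lambda>_. {0..1}))"
    unfolding compactin_PiE by (auto simp: compactin_euclidean_iff)
  then have "compact (PiE UNIV (\<lambda>_ :: 'a \<times> 'a list. {0..1::real}))"
    by (simp add: euclidean_product_topology)
  then have cP: "compact P"
    unfolding P_def Int_assoc
    by (intro compact_Int_closed closed_Int closed_INT ballI closed_Collect_le continuous_intros
        continuous_on_product_coordinates)
  have P0: "0 \<le> p x" if "p \<in> P" for p x using that by (cases x) (auto simp: P_def PiE_def Pi_def)
  have pmf_emb: "pmf (embed_pmf p) = p" if p: "p \<in> P" for p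
  proof (rule embed_pmf_tight)
    show "sum p F \<le> 1" if "finite F" for F using p that by (auto simp: P_def)
    fix e :: real assume e: "0 < e"
    have "1 - L / k \<le> sum p (?W k)" if "0 < k" for k using p that by (auto simp: P_def)
    \<comment> \<open>This value of \<open>k\<close> makes \<open>L / k \<le> e\<close>, also when
      \<open>L\<close> is not positive.\<close>
    from this[of "(\<bar>L\<bar> + 1) / e"] have "1 - L / ((\<bar>L\<bar> + 1) / e) \<le> sum p (?W ((\<bar>L\<bar> + 1) / e))"
      using e by auto
    moreover have "L / ((\<bar>L\<bar> + 1) / e) \<le> e"
    proof -
      have "L * e \<le> (\<bar>L\<bar> + 1) * e" using e by (intro mult_right_mono) auto
      then show ?thesis by (simp add: field_simps)
    qed
    ultimately show "\<exists>F. finite F \<and> 1 - e \<le> sum p F"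
      using finite_light_words[OF \<phi>] by (intro exI[of _ "?W ((\<bar>L\<bar> + 1) / e)"]) auto
  qed (rule P0[OF p])
  have mom: "moment_le \<phi> L (embed_pmf p)" if "p \<in> P" for p
    using that by (auto simp: moment_le_def pmf_emb P_def)
  have om: "embed_pmf p \<in> offspring_measures" if "p \<in> P" for p
    by (rule moment_le_offspring_measures[OF \<phi> mom[OF that]])
  have cont: "continuous_on P (\<lambda>p. measure_pmf.expectation (embed_pmf p) f)"
    if f: "f \<in> offspring_test_functions" for f
  proof -
    obtain C where C: "0 \<le> C" "\<And>x. \<bar>f x\<bar> \<le> C * (1 + real (length (snd x)))"
      using test_function_growth[OF f] by blast
    \<comment> \<open>Each truncated integral is a finite sum of coordinates, hence continuous; the
      truncation error is uniform on \<open>P\<close>, so the limit is continuous too.\<close>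
    have "uniform_limit P (\<lambda>n p. \<Sum>x\<in>?W (real (Suc n)). p x * f x)
        (\<lambda>p. measure_pmf.expectation (embed_pmf p) f) sequentially"
    proof (rule uniform_limitI)
      fix e :: real assume "0 < e"
      have "(\<lambda>n. C * L / real (Suc n)) \<longlonglongrightarrow> 0"
        using LIMSEQ_Suc[OF lim_const_over_n[of "C * L"]] by simp
      then have "\<forall>\<^sub>F n in sequentially. C * L / real (Suc n) < e"
        using \<open>0 < e\<close> by (rule order_tendstoD)
      then show "\<forall>\<^sub>F n in sequentially. \<forall>p\<in>P. dist (\<Sum>x\<in>?W (real (Suc n)). p x * f x)
          (measure_pmf.expectation (embed_pmf p) f) < e"
      proof eventually_elim
        case (elim n)
        show ?case
        proof
          fix p assume p: "p \<in> P"
          have "\<bar>measure_pmf.expectation (embed_pmf p) f - (\<Sum>x\<in>?W (real (Suc n)). pmf (embed_pmf p) x * f x)\<bar>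
              \<le> C * L / real (Suc n)"
            by (rule expectation_light_words[OF \<phi> mom[OF p] om[OF p] C(2) C(1)]) auto
          then show "dist (\<Sum>x\<in>?W (real (Suc n)). p x * f x)
              (measure_pmf.expectation (embed_pmf p) f) < e"
            using elim by (simp add: dist_real_def pmf_emb[OF p] abs_minus_commute)
        qed
      qed
    qed
    then show ?thesis
      by (rule uniform_limit_theorem[rotated])
         (auto intro!: always_eventually continuous_on_sum continuous_on_mult_right
            continuous_on_subset[OF continuous_on_product_coordinates])
  qed
  have "continuous_map (subtopology euclidean P) offspring_topology (embed_pmf :: _ \<Rightarrow> ('a \<times> 'a list) pmf)"
    unfolding offspring_topology_def
  proof (rule continuous_on_generated_topo)
    fix V :: "('a \<times> 'a list) pmf set" assume "V \<in> {{\<nu> \<in> offspring_measures. measure_pmf.expectation \<nu> f \<in> U} | f U.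
        f \<in> offspring_test_functions \<and> open U}"
    then obtain f U where V: "V = {\<nu>  \<in> offspring_measures. measure_pmf.expectation \<nu> f \<in> U}"
      "f \<in> offspring_test_functions" "open U" by blast
    have "openin (subtopology euclidean P) (P \<inter> (\<lambda>p. measure_pmf.expectation (embed_pmf p) f) -` U)"
      by (rule continuous_openin_preimage_gen[OF cont[OF V(2)] V(3)])
    also have "P \<inter> (\<lambda>p. measure_pmf.expectation (embed_pmf p) f) -` U
        = embed_pmf -` V \<inter> topspace (subtopology euclidean P)"
      using om by (auto simp: V(1))
    finally show "openin (subtopology euclidean P) (embed_pmf -` V \<inter> topspace (subtopology euclidean P))" .
  next
    show "embed_pmf ` topspace (subtopology euclidean P) \<subseteq>
       \<Union> {{\<nu> \<in> offspring_measures. measure_pmf.expectation \<nu> f \<in> U} | f U.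
        f \<in> offspring_test_functions \<and> open (U :: real set)}"
      unfolding topspace_offspring_topology[unfolded offspring_topology_def topology_generated_by_topspace]
      using om by auto
  qed
  moreover have "compactin (subtopology euclidean P) P"
    using cP by (simp add: compactin_subtopology)
  ultimately have "compactin offspring_topology (embed_pmf ` P :: ('a \<times> 'a list) pmf set)"
    by (rule image_compactin[rotated])
  also have "embed_pmf ` P = {\<nu> :: ('a \<times> 'a list) pmf. moment_le \<phi> L \<nu>}"
  proof (intro set_eqI iffI)
    fix \<nu> :: "('a \<times> 'a list) pmf" assume "\<nu> \<in> {\<nu>. moment_le \<phi> L \<nu>}"
    then have m: "moment_le \<phi> L \<nu>" by simp
    have "pmf \<nu> \<in> P"
      unfolding P_def
    proof (intro IntI INT_I)
      show "pmf \<nu> \<in> UNIV \<rightarrow>\<^sub>E {0..1}" by (auto simp: pmf_le_1)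
      show "pmf \<nu> \<in> {p. sum p F \<le> 1}" if "F \<in> {F. finite F}" for F
        using that by (simp add: measure_measure_pmf_finite[symmetric])
      show "pmf \<nu> \<in> {p. (\<Sum>x\<in>F. p x * \<phi> (length (snd x))) \<le> L}" if "F \<in> {F. finite F}" for F
        using that m by (simp add: moment_le_def)
      show "pmf \<nu> \<in> {p. 1 - L / k \<le> sum p (?W k)}" if "k \<in> {0<..}" for k
        using expectation_light_words[OF \<phi> m moment_le_offspring_measures[OF \<phi> m], of "\<lambda>_. 1" 1 k] that
        by simp
    qed
    moreover have "embed_pmf (pmf \<nu>) = \<nu>" using pmf_emb[OF \<open>pmf \<nu> \<in> P\<close>] by (simp add: pmf_eq_iff)
    ultimately show "\<nu> \<in> embed_pmf ` P" by (metis imageI)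
  qed (use mom in auto)
  finally show ?thesis .
qed

section \<open>Goodness and convexity of the rate function\<close>

text \<open>The balance of type \<open>a\<close> at a vertex: what the vertex itself contributes
  minus what its children do. Shift-invariance says that the means of all balances vanish.\<close>

definition excess :: "'a \<Rightarrow> 'a \<times> 'a list \<Rightarrow> real" where
  "excess a x = indicator {a} (fst x) - real (count_list (snd x) a)"

lemma expectation_excess:
  assumes "\<nu> \<in> offspring_measures"
  shows "integrable (measure_pmf \<nu>) (excess a)"
    "measure_pmf.expectation \<nu> (excess a) = pmf (type_marginal \<nu>) a
      - measure_pmf.expectation \<nu> (\<lambda>(b, c). real (count_list c a))"
proof -
  have i1: "integrable (measure_pmf \<nu>) (\<lambda>x. indicator {a} (fst x) :: real)"
    by (intro integrable_bounded_pmf boundedI[of _ 1]) (auto simp: indicator_def)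
  note i2 = integrable_count[OF assms, of a]
  show "integrable (measure_pmf \<nu>) (excess a)"
    unfolding excess_def[abs_def] by (intro Bochner_Integration.integrable_diff i1 i2)
  have eq: "(\<lambda>x. indicator {a} (fst x) :: real) = indicator (fst -` {a})"
    by (auto simp: indicator_def)
  have "measure_pmf.expectation \<nu> (indicator (fst -` {a}) :: _ \<Rightarrow> real) = pmf (type_marginal \<nu>) a"
    by (simp add: type_marginal_def pmf_map)
  then have "measure_pmf.expectation \<nu> (\<lambda>x. indicator {a} (fst x) :: real) = pmf (type_marginal \<nu>) a"
    by (simp only: eq)
  then show "measure_pmf.expectation \<nu> (excess a) = pmf (type_marginal \<nu>) a
      - measure_pmf.expectation \<nu> (\<lambda>(b, c). real (count_list c a))"
    unfolding excess_def[abs_def]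
    by (subst Bochner_Integration.integral_diff[OF i1 i2]) (simp add: case_prod_unfold)
qed

lemma shift_invariant_iff_excess:
  "\<nu> \<in> offspring_measures \<Longrightarrow> shift_invariant \<nu> \<longleftrightarrow> (\<forall>a. measure_pmf.expectation \<nu> (excess a) = 0)"
  by (auto simp: shift_invariant_def expectation_excess)

lemma continuous_map_excess:
  fixes a :: "'a::finite"
  shows "continuous_map offspring_topology euclideanreal (\<lambda>\<nu>. measure_pmf.expectation \<nu> (excess a))"
proof -
  have b: "bounded (range (\<lambda>x :: 'a \<times> 'a list. indicator {a} (fst x) :: real))"
    by (rule boundedI[of _ 1]) (auto simp: indicator_def)
  have "continuous_map offspring_topology euclideanreal
    (\<lambda>\<nu>. measure_pmf.expectation \<nu> (\<lambda>x. indicator {a} (fst x)) -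
         measure_pmf.expectation \<nu> (\<lambda>x. real (count_list (snd x) a)))"
    by (intro continuous_map_diff continuous_map_bounded b continuous_map_count)
  then show ?thesis
  proof (rule continuous_map_eq)
    fix \<nu> :: "('a \<times> 'a list) pmf" assume "\<nu> \<in> topspace offspring_topology"
    then have "\<nu> \<in> offspring_measures" by (simp add: topspace_offspring_topology)
    then show "measure_pmf.expectation \<nu> (\<lambda>x. indicator {a} (fst x)) -
         measure_pmf.expectation \<nu> (\<lambda>x. real (count_list (snd x) a)) = measure_pmf.expectation \<nu> (excess a)"
      unfolding excess_def[abs_def]
      by (subst Bochner_Integration.integral_diff[OF integrable_bounded_pmf[OF b] integrable_count]) auto
  qed
qed

text \<open>Sublevel sets are cut out by equations and inequalities that are linear in \<nu>. This
  is the form in which the rate function enters closedness, convexity, the upper bound and the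
  approximation.\<close>

lemma offspring_rate_le_iff:
  fixes Q :: "'a::finite \<Rightarrow> 'a list pmf"
  assumes "\<nu> \<in> offspring_measures"
  shows "offspring_rate Q \<nu> \<le> ereal \<alpha> \<longleftrightarrow>
    (\<forall>a. measure_pmf.expectation \<nu> (excess a) = 0) \<and> (\<forall>f\<in>tilts Q. measure_pmf.expectation \<nu> f \<le> \<alpha>)"
proof (cases "shift_invariant \<nu>")
  case True
  have "(\<forall>f\<in>tilts Q. measure_pmf.expectation \<nu> f \<le> \<alpha>)" if "entropy_rel Q \<nu> \<le> ereal \<alpha>"
    using tilt_le_entropy_rel order_trans[OF _ that] by (metis ereal_less_eq(3))
  then show ?thesis
    using True entropy_rel_leI[of Q \<nu> "ereal \<alpha>"]
    by (auto simp: offspring_rate_def shift_invariant_iff_excess[OF assms])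
next
  case False
  then have "offspring_rate Q \<nu> = \<infinity>" by (simp add: offspring_rate_def)
  then show ?thesis using False shift_invariant_iff_excess[OF assms] by simp
qed

lemma offspring_rate_nonneg: "0 \<le> offspring_rate Q (\<nu> :: ('a::finite \<times> 'a list) pmf)"
  by (simp add: offspring_rate_def entropy_rel_nonneg)

lemma closedin_offspring_rate:
  fixes Q :: "'a::finite \<Rightarrow> 'a list pmf"
  shows "closedin offspring_topology {\<nu> \<in> offspring_measures. offspring_rate Q \<nu> \<le> ereal \<alpha>}"
proof -
  let ?X = "offspring_topology :: ('a \<times> 'a list) pmf topology"
  have c1: "closedin ?X {\<nu> \<in> topspace ?X. measure_pmf.expectation \<nu> (excess a) \<in> {0}}" for a
    by (intro closedin_continuous_map_preimage[OF continuous_map_excess]) simp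
  have c2: "closedin ?X {\<nu> \<in> topspace ?X. measure_pmf.expectation \<nu> f \<in> {..\<alpha>}}" if "f \<in> tilts Q" for f
    using that by (intro closedin_continuous_map_preimage[OF continuous_map_bounded]) (auto simp: tilts_def)
  let ?F = "insert (topspace ?X) ((\<lambda>a. {\<nu> \<in> topspace ?X. measure_pmf.expectation \<nu> (excess a) \<in> {0}}) ` UNIV \<union>
    (\<lambda>f. {\<nu> \<in> topspace ?X. measure_pmf.expectation \<nu> f \<in> {..\<alpha>}}) ` tilts Q)"
  have "{\<nu> \<in> offspring_measures. offspring_rate Q \<nu> \<le> ereal \<alpha>} = \<Inter> ?F"
  proof (rule set_eqI)
    fix \<nu> show "\<nu> \<in> {\<nu> \<in> offspring_measures. offspring_rate Q \<nu> \<le> ereal \<alpha>} \<longleftrightarrow> \<nu> \<in> \<Inter> ?F"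
      by (cases "\<nu> \<in> offspring_measures") (simp_all add: topspace_offspring_topology offspring_rate_le_iff ball_Un)
  qed
  moreover have "closedin ?X (\<Inter> ?F)" by (rule closedin_Inter) (use c1 c2 in auto)
  ultimately show ?thesis by simp
qed

lemma expectation_mixture:
  fixes f :: "'b::countable \<Rightarrow> real"
  assumes mix: "\<And>x. pmf \<nu> x = (1 - s) * pmf \<nu>0 x + s * pmf \<nu>1 x"
    and i: "integrable (measure_pmf \<nu>) f" "integrable (measure_pmf \<nu>0) f" "integrable (measure_pmf \<nu>1) f"
  shows "measure_pmf.expectation \<nu> f
    = (1 - s) * measure_pmf.expectation \<nu>0 f + s * measure_pmf.expectation \<nu>1 f"
proof (rule LIMSEQ_unique[OF expectation_LIMSEQ[OF i(1)]])
  have "(\<lambda>k. (1 - s) * (\<Sum>x | to_nat x < k. pmf \<nu>0 x * f x) + s * (\<Sum>x | to_nat x < k. pmf \<nu>1 x * f x))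
    \<longlonglongrightarrow> (1 - s) * measure_pmf.expectation \<nu>0 f + s * measure_pmf.expectation \<nu>1 f"
    by (intro tendsto_intros expectation_LIMSEQ i)
  also have "(\<lambda>k. (1 - s) * (\<Sum>x | to_nat x < k. pmf \<nu>0 x * f x) + s * (\<Sum>x | to_nat x < k. pmf \<nu>1 x * f x))
      = (\<lambda>k. \<Sum>x | to_nat x < k. pmf \<nu> x * f x)"
    by (simp add: mix sum_distrib_left sum.distrib[symmetric] distrib_right mult.assoc)
  finally show "(\<lambda>k. \<Sum>x | to_nat x < k. pmf \<nu> x * f x)
    \<longlonglongrightarrow> (1 - s) * measure_pmf.expectation \<nu>0 f + s * measure_pmf.expectation \<nu>1 f" .
qed

lemma convex_offspring_rate:
  fixes Q :: "'a::finite \<Rightarrow> 'a list pmf"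
  shows "convex_on_pmfs offspring_measures (offspring_rate Q)"
  unfolding convex_on_pmfs_def
proof (intro ballI impI)
  fix \<nu> \<nu>0 \<nu>1 :: "('a \<times> 'a list) pmf" and s :: real
  assume om: "\<nu> \<in> offspring_measures" "\<nu>0 \<in> offspring_measures" "\<nu>1 \<in> offspring_measures"
    and s: "s \<in> {0..1}" and "\<forall>x. pmf \<nu> x = (1 - s) * pmf \<nu>0 x + s * pmf \<nu>1 x"
  then have mix: "\<And>x. pmf \<nu> x = (1 - s) * pmf \<nu>0 x + s * pmf \<nu>1 x" by blast
  show "offspring_rate Q \<nu> \<le> ereal (1 - s) * offspring_rate Q \<nu>0 + ereal s * offspring_rate Q \<nu>1"
  proof -
    \<comment> \<open>The endpoints are separated because \<open>0 * \<infinity> = 0\<close> drops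
      an infinite summand; for 0 < s < 1 an infinite rate makes the right-hand side
      infinite.\<close>
    consider "s = 0" | "s = 1" | "0 < s" "s < 1" using s by fastforce
    then show ?thesis
    proof cases
      case 1
      then have "\<nu> = \<nu>0" by (intro pmf_eqI) (simp add: mix)
      then show ?thesis using 1 by (simp add: one_ereal_def[symmetric] zero_ereal_def[symmetric])
    next
      case 2
      then have "\<nu> = \<nu>1" by (intro pmf_eqI) (simp add: mix)
      then show ?thesis using 2 by (simp add: one_ereal_def[symmetric] zero_ereal_def[symmetric])
    next
      case 3
      show ?thesis
      proof (cases "offspring_rate Q \<nu>0 = \<infinity> \<or> offspring_rate Q \<nu>1 = \<infinity>")
        case True
        then have "ereal (1 - s) * offspring_rate Q \<nu>0 + ereal s * offspring_rate Q \<nu>1 = \<infinity>"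
          using 3 offspring_rate_nonneg[of Q \<nu>0] offspring_rate_nonneg[of Q \<nu>1] by auto
        then show ?thesis by (simp only: ereal_less_eq(1))
      next
        case False
        then obtain r0 r1 where r: "offspring_rate Q \<nu>0 = ereal r0" "offspring_rate Q \<nu>1 = ereal r1"
          using offspring_rate_nonneg[of Q \<nu>0] offspring_rate_nonneg[of Q \<nu>1]
          by (metis ereal_cases ereal_infty_less_eq(2) PInfty_neq_ereal(1) MInfty_neq_ereal(2) zero_ereal_def)
        have le: "offspring_rate Q \<nu>0 \<le> ereal r0" "offspring_rate Q \<nu>1 \<le> ereal r1" using r by auto
        have "offspring_rate Q \<nu> \<le> ereal ((1 - s) * r0 + s * r1)"
          unfolding offspring_rate_le_iff[OF om(1)]
        proof (intro conjI allI ballI)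
          fix a show "measure_pmf.expectation \<nu> (excess a) = 0"
            using le unfolding offspring_rate_le_iff[OF om(2)] offspring_rate_le_iff[OF om(3)]
            by (subst expectation_mixture[OF mix]) (auto simp: expectation_excess om)
        next
          fix f assume f: "f \<in> tilts Q"
          have "measure_pmf.expectation \<nu> f
            = (1 - s) * measure_pmf.expectation \<nu>0 f + s * measure_pmf.expectation \<nu>1 f"
            using f by (intro expectation_mixture[OF mix]) (auto simp: tilts_def integrable_bounded_pmf)
          also have "\<dots> \<le> (1 - s) * r0 + s * r1"
            using le f 3 unfolding offspring_rate_le_iff[OF om(2)] offspring_rate_le_iff[OF om(3)]
            by (intro add_mono mult_left_mono) auto
          finally show "measure_pmf.expectation \<nu> f \<le> (1 - s) * r0 + s * r1" .
        qed
        then show ?thesis by (simp add: r)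
      qed
    qed
  qed
qed

text \<open>A mixture \<psi> of all exponentials \<open>exp (k n)\<close> has a logarithm that
  eventually exceeds every linear function. In the weights \<open>w k\<close>, the division by
  \<open>m k\<close>, a bound on the \<open>k\<close>-th exponential moments, and the factor
  \<open>(1/2) ^ Suc k\<close> give \<psi> mean at most 1, and the factor \<open>exp (- k^2)\<close>
  makes the series converge at every \<open>n\<close>. As \<phi> is the positive part of
  \<open>ln \<psi>\<close>, \<open>exp \<phi>\<close> is at most \<open>1 + \<psi>\<close>, whence
  the constant \<open>ln 2\<close>.\<close>

lemma exists_superlinear_moment:
  fixes Q :: "'a::finite \<Rightarrow> 'a list pmf"
  assumes "finite_exponential_moments Q"
  obtains \<phi> u where "superlinear \<phi>"
    "\<And>a. (\<integral>\<^sup>+c. ennreal (exp (\<phi> (length c))) \<partial>Q a) \<le> ennreal (exp u)"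
proof -
  define I where "I a k = (\<integral>\<^sup>+c. ennreal (exp (real k * real (length c))) \<partial>Q a)" for a and k :: nat
  have fin: "I a k < \<infinity>" for a k
  proof (cases "k = 0")
    case True then show ?thesis by (simp add: I_def)
  next
    case False
    then show ?thesis using assms by (simp add: I_def finite_exponential_moments_def)
  qed
  define m where "m k = 1 + (\<Sum>a\<in>UNIV. enn2real (I a k))" for k
  have m1: "1 \<le> m k" for k by (simp add: m_def sum_nonneg)
  have Im: "I a k \<le> ennreal (m k)" for a k
  proof -
    have "enn2real (I a k) \<le> (\<Sum>a\<in>UNIV. enn2real (I a k))" by (intro member_le_sum) auto
    then have "enn2real (I a k) \<le> m k" by (simp add: m_def)
    moreover have "I a k = ennreal (enn2real (I a k))" using fin[of a k] by simp
    ultimately show ?thesis by (metis ennreal_leI)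
  qed
  define w where "w k = (1/2) ^ Suc k * exp (- (real k)\<^sup>2) / m k" for k
  have w0: "0 < w k" for k using m1[of k] by (simp add: w_def)
  define \<psi> where "\<psi> n = (\<Sum>k. w k * exp (real k * real n))" for n :: nat
  have sm: "summable (\<lambda>k. w k * exp (real k * real n))" for n
  proof (rule summable_comparison_test')
    show "summable (\<lambda>k. (1/2) ^ Suc k * exp ((real n)\<^sup>2))"
      by (intro summable_mult2 summable_Suc_iff[THEN iffD2]) (simp add: summable_geometric)
    fix k
    \<comment> \<open>Completing the square shows \<open>k n - k^2 \<le> n^2\<close>, a bound
      independent of \<open>k\<close>.\<close>
    have "0 \<le> (real k - real n)\<^sup>2 + real k * real n" by simp
    then have "real k * real n - (real k)\<^sup>2 \<le> (real n)\<^sup>2" by (simp add: power2_diff)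
    then have "exp (- (real k)\<^sup>2) * exp (real k * real n) \<le> exp ((real n)\<^sup>2)"
      by (simp add: exp_add[symmetric])
    moreover have "w k * exp (real k * real n) \<le> (1/2) ^ Suc k * (exp (- (real k)\<^sup>2) * exp (real k * real n))"
    proof -
      have "w k \<le> (1/2) ^ Suc k * exp (- (real k)\<^sup>2) / 1"
        unfolding w_def using m1[of k] by (intro divide_left_mono) auto
      then have "w k * exp (real k * real n) \<le> ((1/2) ^ Suc k * exp (- (real k)\<^sup>2)) * exp (real k * real n)"
        by (intro mult_right_mono) auto
      then show ?thesis by (simp only: mult.assoc)
    qed
    ultimately have "w k * exp (real k * real n) \<le> (1/2) ^ Suc k * exp ((real n)\<^sup>2)"
      by (elim order_trans) (intro mult_left_mono, assumption, simp)
    then show "norm (w k * exp (real k * real n)) \<le> (1/2) ^ Suc k * exp ((real n)\<^sup>2)"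
      using w0[of k] by (simp only: real_norm_def abs_mult abs_exp_cancel abs_of_pos)
  qed
  have w\<psi>: "w k * exp (real k * real n) \<le> \<psi> n" for k n
    unfolding \<psi>_def using sum_le_suminf[OF sm, of "{k}" n] w0 by (simp add: less_imp_le)
  have \<psi>0: "0 < \<psi> n" for n using w\<psi>[of 0 n] w0[of 0] by simp
  have I\<psi>: "(\<integral>\<^sup>+c. ennreal (\<psi> (length c)) \<partial>Q a) \<le> 1" for a
  proof -
    have "(\<integral>\<^sup>+c. ennreal (\<psi> (length c)) \<partial>Q a)
        = (\<integral>\<^sup>+c. (\<Sum>k. ennreal (w k) * ennreal (exp (real k * real (length c)))) \<partial>Q a)"
    proof (rule nn_integral_cong)
      fix c :: "'a list"
      have "(\<Sum>k. ennreal (w k * exp (real k * real (length c)))) = ennreal (\<psi> (length c))"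
        unfolding \<psi>_def using w0 by (intro suminf_ennreal2 sm) (simp add: less_imp_le)
      then show "ennreal (\<psi> (length c)) = (\<Sum>k. ennreal (w k) * ennreal (exp (real k * real (length c))))"
        using w0 by (simp add: ennreal_mult less_imp_le)
    qed
    also have "\<dots> = (\<Sum>k. ennreal (w k) * I a k)"
      by (subst nn_integral_suminf) (auto simp: I_def nn_integral_cmult)
    also have "\<dots> \<le> (\<Sum>k. ennreal ((1/2) ^ Suc k))"
    proof (intro suminf_le summableI)
      fix k
      have "ennreal (w k) * I a k \<le> ennreal (w k) * ennreal (m k)" by (intro mult_left_mono Im) auto
      also have "\<dots> = ennreal ((1/2) ^ Suc k * exp (- (real k)\<^sup>2))"
        using m1[of k] w0[of k] by (simp add: ennreal_mult[symmetric] w_def del: power_Suc)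
      also have "\<dots> \<le> ennreal ((1/2) ^ Suc k)"
        by (intro ennreal_leI mult_left_le) auto
      finally show "ennreal (w k) * I a k \<le> ennreal ((1/2) ^ Suc k)" .
    qed
    also have "\<dots> = 1"
      by (rule suminf_ennreal_eq[OF _ power_half_series, simplified ennreal_1]) auto
    finally show ?thesis .
  qed
  define \<phi> where "\<phi> n = max 0 (ln (\<psi> n))" for n
  have "superlinear \<phi>"
    unfolding superlinear_def
  proof (intro conjI allI)
    fix r :: real
    \<comment> \<open>The slope \<open>r + 1\<close> leaves a surplus of \<open>n\<close> over the
      line of slope \<open>r\<close>, which outgrows the constants \<open>r\<close> and
      \<open>ln (w k)\<close> as soon as \<open>n\<close> exceeds \<open>M\<close>.\<close>
    obtain k :: nat where k: "r + 1 \<le> real k" using real_arch_simple by blast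
    obtain M :: nat where M: "r - ln (w k) \<le> real M" using real_arch_simple by blast
    have "{n. \<phi> n < r * (1 + real n)} \<subseteq> {..M}"
    proof safe
      fix n assume n: "\<phi> n < r * (1 + real n)"
      have "ln (w k * exp (real k * real n)) \<le> ln (\<psi> n)" using w\<psi>[of k n] w0[of k] by (intro ln_mono) auto
      then have "ln (w k) + real k * real n \<le> \<phi> n"
        using w0[of k] by (simp add: ln_mult \<phi>_def)
      moreover have "(r + 1) * real n \<le> real k * real n" using k by (intro mult_right_mono) auto
      ultimately have "ln (w k) + (r + 1) * real n < r * (1 + real n)" using n by linarith
      then have "real n < r - ln (w k)" by (simp add: algebra_simps)
      then show "n \<le> M" using M by linarith
    qed
    then show "finite {n. \<phi> n < r * (1 + real n)}" by (rule finite_subset) simp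
  qed (simp add: \<phi>_def)
  moreover have "(\<integral>\<^sup>+c. ennreal (exp (\<phi> (length c))) \<partial>Q a) \<le> ennreal (exp (ln 2))" for a
  proof -
    have "exp (\<phi> n) \<le> 1 + \<psi> n" for n using \<psi>0[of n] by (simp add: \<phi>_def max_def)
    then have "ennreal (exp (\<phi> n)) \<le> 1 + ennreal (\<psi> n)" for n
      by (metis \<psi>0 ennreal_1 ennreal_leI ennreal_plus less_imp_le zero_le_one)
    then have "(\<integral>\<^sup>+c. ennreal (exp (\<phi> (length c))) \<partial>Q a) \<le> (\<integral>\<^sup>+c. 1 + ennreal (\<psi> (length c)) \<partial>Q a)"
      by (intro nn_integral_mono)
    also have "\<dots> = 1 + (\<integral>\<^sup>+c. ennreal (\<psi> (length c)) \<partial>Q a)"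
      by (subst nn_integral_add) auto
    also have "\<dots> \<le> 1 + 1" by (intro add_left_mono I\<psi>)
    finally show ?thesis by simp
  qed
  ultimately show ?thesis using that by blast
qed

text \<open>\<open>\<phi> - u\<close> would be a tilt if it were bounded. It is truncated at a level
  that does not alter \<phi> on the finite set under consideration.\<close>

lemma moment_le_of_entropy_rel:
  fixes Q :: "'a::finite \<Rightarrow> 'a list pmf"
  assumes \<phi>: "\<And>n. 0 \<le> \<phi> n" "\<And>a. (\<integral>\<^sup>+c. ennreal (exp (\<phi> (length c))) \<partial>Q a) \<le> ennreal (exp u)"
    and le: "\<And>f. f \<in> tilts Q \<Longrightarrow> measure_pmf.expectation \<nu> f \<le> \<alpha>"
  shows "moment_le \<phi> (\<alpha> + u) \<nu>"
  unfolding moment_le_def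
proof (intro allI impI)
  fix F :: "('a \<times> 'a list) set" assume F: "finite F"
  \<comment> \<open>The sum over \<open>F\<close> dominates each of its terms, so truncation at
    \<open>R\<close> is invisible on \<open>F\<close>.\<close>
  define R where "R = (\<Sum>x\<in>F. \<phi> (length (snd x)))"
  have R: "\<phi> (length (snd x)) \<le> R" if "x \<in> F" for x
    unfolding R_def by (rule member_le_sum[OF that _ F]) (simp add: \<phi>)
  have R0: "0 \<le> R" by (simp add: R_def sum_nonneg \<phi>)
  define g where "g x = min (\<phi> (length (snd x))) R" for x :: "'a \<times> 'a list"
  have g0: "0 \<le> g x" "g x \<le> R" for x using \<phi> R0 by (auto simp: g_def)
  have bg: "bounded (range g)" using g0 by (intro boundedI[of _ R]) auto
  have bgu: "bounded (range (\<lambda>x. g x - u))" by (intro bounded_minus_comp bg) simp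
  have "measure_pmf.expectation (Q a) (\<lambda>c. exp (g (a, c) - u)) \<le> 1" for a
  proof -
    have i: "integrable (measure_pmf (Q a)) (\<lambda>c. exp (g (a, c)))"
      by (rule integrable_bounded_pmf[OF bounded_range_compose(2)[OF bg]])
    have "ennreal (measure_pmf.expectation (Q a) (\<lambda>c. exp (g (a, c)))) = (\<integral>\<^sup>+c. ennreal (exp (g (a, c))) \<partial>Q a)"
      using nn_integral_eq_integral[OF i] by simp
    also have "\<dots> \<le> (\<integral>\<^sup>+c. ennreal (exp (\<phi> (length c))) \<partial>Q a)"
      by (intro nn_integral_mono ennreal_leI) (simp add: g_def)
    also have "\<dots> \<le> ennreal (exp u)" by (rule \<phi>)
    finally have "measure_pmf.expectation (Q a) (\<lambda>c. exp (g (a, c))) \<le> exp u"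
      by (subst (asm) ennreal_le_iff) auto
    then show ?thesis by (simp add: exp_diff divide_le_eq)
  qed
  then have "(\<lambda>x. g x - u) \<in> tilts Q" using bgu by (simp add: tilts_def)
  from le[OF this] have Eg: "measure_pmf.expectation \<nu> g \<le> \<alpha> + u"
    using integrable_bounded_pmf[OF bg, of \<nu>] by simp
  have "(\<Sum>x\<in>F. pmf \<nu> x * \<phi> (length (snd x))) = (\<Sum>x\<in>F. pmf \<nu> x * g x)"
    using R by (intro sum.cong) (auto simp: g_def)
  also have "\<dots> = measure_pmf.expectation \<nu> (\<lambda>x. indicator F x * g x)"
    by (subst integral_measure_pmf[OF F]) (auto simp: indicator_def)
  also have "\<dots> \<le> measure_pmf.expectation \<nu> g"
  proof (rule integral_mono)
    show "integrable (measure_pmf \<nu>) (\<lambda>x. indicator F x * g x)"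
      using integrable_real_mult_indicator[OF _ integrable_bounded_pmf[OF bg, of \<nu>], of F]
      by (simp add: mult.commute)
    show "indicator F x * g x \<le> g x" for x using g0[of x] by (simp add: indicator_def)
  qed (rule integrable_bounded_pmf[OF bg])
  also note Eg
  finally show "(\<Sum>x\<in>F. pmf \<nu> x * \<phi> (length (snd x))) \<le> \<alpha> + u" .
qed

lemma compactin_offspring_rate:
  fixes Q :: "'a::finite \<Rightarrow> 'a list pmf"
  assumes "finite_exponential_moments Q"
  shows "compactin offspring_topology {\<nu> \<in> offspring_measures. offspring_rate Q \<nu> \<le> ereal \<alpha>}"
proof -
  obtain \<phi> u where \<phi>: "superlinear \<phi>"
    "\<And>a. (\<integral>\<^sup>+c. ennreal (exp (\<phi> (length c))) \<partial>Q a) \<le> ennreal (exp u)"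
    using exists_superlinear_moment[OF assms] by metis
  have "{\<nu> \<in> offspring_measures. offspring_rate Q \<nu> \<le> ereal \<alpha>} \<subseteq> {\<nu>. moment_le \<phi> (\<alpha> + u) \<nu>}"
    using moment_le_of_entropy_rel[of \<phi> Q u _ \<alpha>] \<phi> by (auto simp: offspring_rate_le_iff superlinear_def)
  then show ?thesis
    by (rule closed_compactin[OF compactin_moment_le[OF \<phi>(1)] _ closedin_offspring_rate])
qed

lemma good_offspring_rate:
  fixes Q :: "'a::finite \<Rightarrow> 'a list pmf"
  assumes "finite_exponential_moments Q"
  shows "good_rate_function offspring_topology (offspring_rate Q)"
  using compactin_offspring_rate[OF assms] closedin_offspring_rate[of Q]
  by (auto simp: good_rate_function_def rate_function_def topspace_offspring_topology offspring_rate_nonneg)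

text \<open>A positive lower semicontinuous function with compact sublevel sets is bounded away from
  0 on a closed set. It turns uniqueness of the zero of a rate function into exponential decay away
  from it.\<close>

lemma offspring_rate_pos_bound:
  fixes Q :: "'a::finite \<Rightarrow> 'a list pmf"
  assumes Q: "finite_exponential_moments Q" and F: "closedin offspring_topology F"
    and pos: "\<And>\<nu>. \<nu> \<in> F \<Longrightarrow> 0 < offspring_rate Q \<nu>"
  obtains \<alpha> where "0 < \<alpha>" "\<And>\<nu>. \<nu> \<in> F \<Longrightarrow> ereal \<alpha> < offspring_rate Q \<nu>"
proof -
  let ?X = "offspring_topology :: ('a \<times> 'a list) pmf topology"
  let ?U = "\<lambda>k::nat. {\<nu> \<in> offspring_measures. ereal (1 / Suc k) < offspring_rate Q \<nu>}"
  have Uo: "openin ?X (?U k)" for k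
  proof -
    have "?U k = topspace ?X - {\<nu> \<in> offspring_measures. offspring_rate Q \<nu> \<le> ereal (1 / Suc k)}"
      by (auto simp: topspace_offspring_topology)
    then show ?thesis using closedin_offspring_rate[of Q "1 / Suc k"] by (simp add: openin_diff)
  qed
  have FM: "F \<subseteq> offspring_measures" using closedin_subset[OF F] by (simp add: topspace_offspring_topology)
  \<comment> \<open>Beyond this compact part of \<open>F\<close> the rate exceeds 1 anyway.\<close>
  let ?K = "F \<inter> {\<nu> \<in> offspring_measures. offspring_rate Q \<nu> \<le> ereal 1}"
  have K: "compactin ?X ?K" by (rule closed_Int_compactin[OF F compactin_offspring_rate[OF Q]])
  have "?K \<subseteq> \<Union> (range ?U)"
  proof
    fix \<nu> assume \<nu>: "\<nu> \<in> ?K"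
    then have "0 < offspring_rate Q \<nu>" using pos by blast
    then obtain e where e: "0 < e" "ereal e < offspring_rate Q \<nu>"
      using ereal_dense2[of 0 "offspring_rate Q \<nu>"] by (auto simp: zero_ereal_def)
    obtain k :: nat where "1 / Suc k < e" using nat_approx_posE[OF e(1)] by auto
    then have "ereal (1 / Suc k) < offspring_rate Q \<nu>" using e(2) by (meson ereal_less_eq(3) less_imp_le order_le_less_trans)
    then show "\<nu> \<in> \<Union> (range ?U)" using \<nu> by blast
  qed
  then obtain \<U> where \<U>: "finite \<U>" "\<U> \<subseteq> range ?U" "?K \<subseteq> \<Union> \<U>"
    using compactinD[OF K, of "range ?U"] Uo by blast
  then obtain A where A: "finite A" "\<U> = ?U ` A" by (meson finite_subset_image)
  define m where "m = Max (insert 0 A)"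
  have m: "k \<le> m" if "k \<in> A" for k using A that by (simp add: m_def)
  have "ereal (1 / Suc (Suc m)) < offspring_rate Q \<nu>" if \<nu>: "\<nu> \<in> F" for \<nu>
  proof (cases "offspring_rate Q \<nu> \<le> ereal 1")
    case True
    then have "\<nu> \<in> ?K" using \<nu> FM by blast
    then obtain k where "k \<in> A" "ereal (1 / Suc k) < offspring_rate Q \<nu>" using \<U> A by auto
    moreover have "1 / Suc (Suc m) \<le> 1 / Suc k" using m[OF \<open>k \<in> A\<close>] by (intro divide_left_mono) auto
    ultimately show ?thesis by (meson ereal_less_eq(3) order_le_less_trans)
  next
    case False
    moreover have "ereal (1 / Suc (Suc m)) \<le> ereal 1" by simp
    ultimately show ?thesis by (meson not_le order_le_less_trans)
  qed
  then show ?thesis using that[of "1 / Suc (Suc m)"] by simp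
qed

section \<open>The large deviation upper bound\<close>

abbreviation offspring_prob :: "('a \<Rightarrow> 'a list pmf) \<Rightarrow> 'a \<times> 'a list \<Rightarrow> real" where
  "offspring_prob Q \<equiv> (\<lambda>(a, c). pmf (Q a) c)"

lemma sum_count_mset: "(\<Sum>x\<in>set_mset C. real (count C x) * f x) = (\<Sum>x\<in>#C. f x)"
proof (induction C)
  case (add y C)
  have "(\<Sum>x\<in>set_mset (add_mset y C). real (count (add_mset y C) x) * f x)
      = (\<Sum>x\<in>insert y (set_mset C). real (count C x) * f x + (if x = y then f x else 0))"
    by (intro sum.cong) (auto simp: distrib_right)
  also have "\<dots> = (\<Sum>x\<in>insert y (set_mset C). real (count C x) * f x) + f y"
    by (simp add: sum.distrib)
  also have "(\<Sum>x\<in>insert y (set_mset C). real (count C x) * f x) = (\<Sum>x\<in>set_mset C. real (count C x) * f x)"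
    by (intro sum.mono_neutral_right) (auto simp: not_in_iff)
  finally show ?case using add by simp
qed simp

lemma set_pmf_emp: "set_pmf (emp t) = set_mset (tree_cnt t)"
  by (simp add: emp_def)

lemma expectation_emp:
  fixes f :: "'a \<times> 'a list \<Rightarrow> real"
  shows "measure_pmf.expectation (emp t) f = (\<Sum>x\<in>#tree_cnt t. f x) / real (size (tree_cnt t))"
proof -
  have "measure_pmf.expectation (emp t) f = (\<Sum>x\<in>set_mset (tree_cnt t). pmf (emp t) x * f x)"
    by (subst integral_measure_pmf[of "set_mset (tree_cnt t)"]) (auto simp: set_pmf_emp)
  also have "\<dots> = (\<Sum>x\<in>set_mset (tree_cnt t). real (count (tree_cnt t) x) * f x) / real (size (tree_cnt t))"
    by (simp add: pmf_emp sum_divide_distrib)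
  finally show ?thesis by (simp add: sum_count_mset)
qed

lemma finite_set_pmf_offspring_measures:
  "finite (set_pmf \<nu>) \<Longrightarrow> \<nu> \<in> offspring_measures"
  by (simp add: offspring_measures_def nn_integral_measure_pmf_finite case_prod_unfold ennreal_mult_less_top)

lemma emp_offspring_measures: "emp t \<in> offspring_measures"
  by (rule finite_set_pmf_offspring_measures) (simp add: set_pmf_emp)

lemma sum_mset_diff_real: "(\<Sum>x\<in>#C. f x - g x :: real) = (\<Sum>x\<in>#C. f x) - (\<Sum>x\<in>#C. g x)"
  by (induction C) auto

lemma expectation_emp_excess:
  "measure_pmf.expectation (emp t) (excess a) = indicator {root_type t} a / real (size (tree_cnt t))"
  unfolding expectation_emp excess_def[abs_def]
  using sum_mset_count_children[where t = t and a = a] by (simp add: sum_mset_diff_real)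

lemma tree_weight_mono_sum:
  "finite A \<Longrightarrow> B \<subseteq> A \<Longrightarrow> (\<And>x. 0 \<le> q x) \<Longrightarrow> sum (tree_weight q) B \<le> sum (tree_weight q) A"
  by (intro sum_mono2) (auto intro: tree_weight_nonneg)

lemma offspring_prob_nonneg [simp]: "0 \<le> offspring_prob Q x"
  by (simp add: case_prod_unfold)

lemma tree_prob_nonneg: "0 \<le> tree_prob Q n a B"
  unfolding tree_prob_def by (intro sum_nonneg tree_weight_nonneg) simp

lemma tree_prob_mono:
  fixes Q :: "'a::finite \<Rightarrow> 'a list pmf"
  shows "(\<And>t. t \<in> sized_trees n a \<Longrightarrow> emp t \<in> B \<Longrightarrow> emp t \<in> B') \<Longrightarrow> tree_prob Q n a B \<le> tree_prob Q n a B'"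
  unfolding tree_prob_def by (intro tree_weight_mono_sum) auto

lemma tree_prob_Un:
  fixes Q :: "'a::finite \<Rightarrow> 'a list pmf"
  shows "tree_prob Q n a (B \<union> B') \<le> tree_prob Q n a B + tree_prob Q n a B'"
proof -
  let ?A = "\<lambda>B. {t \<in> sized_trees n a. emp t \<in> B}"
  have "?A (B \<union> B') = ?A B \<union> ?A B'" by auto
  then have "tree_prob Q n a (B \<union> B') = tree_prob Q n a B + tree_prob Q n a B'
      - (\<Sum>t\<in>?A B \<inter> ?A B'. tree_weight (offspring_prob Q) t)"
    unfolding tree_prob_def by (simp only:) (rule sum_Un; simp)
  moreover have "0 \<le> (\<Sum>t\<in>?A B \<inter> ?A B'. tree_weight (offspring_prob Q) t)"
    by (intro sum_nonneg tree_weight_nonneg) simp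
  ultimately show ?thesis by linarith
qed

lemma tree_prob_Union:
  fixes Q :: "'a::finite \<Rightarrow> 'a list pmf"
  shows "finite \<U> \<Longrightarrow> tree_prob Q n a (\<Union> \<U>) \<le> (\<Sum>U\<in>\<U>. tree_prob Q n a U)"
proof (induction \<U> rule: finite_induct)
  case (insert U \<U>)
  then show ?case using tree_prob_Un[of Q n a U "\<Union> \<U>"] by simp
qed (simp add: tree_prob_def)

lemma prod_mset_mult_exp:
  "(\<Prod>x\<in>#C. q x * exp (f x)) = (\<Prod>x\<in>#C. q x) * exp (\<Sum>x\<in>#C. f x :: real)"
  by (induction C) (auto simp: exp_add)

text \<open>Multiplying the weights by \<open>exp f\<close> multiplies a tree in \<open>B\<close> by
  at least \<open>exp (n \<alpha>)\<close>, while the total tilted mass is at most 1. The mean is a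
  nonnegative integral, so that the unbounded function \<open>\<phi> - u\<close> is admissible as
  well.\<close>

lemma tree_prob_chernoff:
  fixes Q :: "'a::finite \<Rightarrow> 'a list pmf"
  assumes f: "\<And>a. (\<integral>\<^sup>+c. ennreal (exp (f (a, c))) \<partial>Q a) \<le> 1"
    and B: "\<And>t. t \<in> sized_trees n a \<Longrightarrow> emp t \<in> B \<Longrightarrow> \<alpha> \<le> measure_pmf.expectation (emp t) f"
  shows "tree_prob Q n a B \<le> exp (- (real n * \<alpha>))"
proof -
  let ?q = "\<lambda>x. offspring_prob Q x * exp (f x)"
  have sub: "(\<Sum>c | length c \<le> N. ?q (a, c)) \<le> 1" for a N
  proof -
    have "ennreal (\<Sum>c | length c \<le> N. ?q (a, c))
        = (\<integral>\<^sup>+c. ennreal (?q (a, c)) * indicator {c. length c \<le> N} c \<partial>count_space UNIV)"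
      by (subst nn_integral_count_space'[OF finite_words[of N]]) (auto simp: indicator_def)
    also have "\<dots> \<le> (\<integral>\<^sup>+c. ennreal (exp (f (a, c))) \<partial>Q a)"
      unfolding nn_integral_measure_pmf
      by (intro nn_integral_mono) (auto simp: indicator_def ennreal_mult)
    also have "\<dots> \<le> 1" by (rule f)
    finally show ?thesis by (simp add: ennreal_le_1)
  qed
  have "exp (real n * \<alpha>) * tree_prob Q n a B
      = (\<Sum>t\<in>{t \<in> sized_trees n a. emp t \<in> B}. exp (real n * \<alpha>) * tree_weight (offspring_prob Q) t)"
    by (simp add: tree_prob_def sum_distrib_left)
  also have "\<dots> \<le> (\<Sum>t\<in>{t \<in> sized_trees n a. emp t \<in> B}. tree_weight ?q t)"
  proof (rule sum_mono)
    fix t assume t: "t \<in> {t \<in> sized_trees n a. emp t \<in> B}"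
    then have sz: "size (tree_cnt t) = n" by (simp add: sized_trees_def)
    have n0: "0 < n" using sz tree_cnt_nonempty[of t] by (metis nonempty_has_size)
    have "\<alpha> \<le> (\<Sum>x\<in>#tree_cnt t. f x) / real n" 
      using B[of t] t by (simp add: expectation_emp sz)
    then have "real n * \<alpha> \<le> (\<Sum>x\<in>#tree_cnt t. f x)" using n0 by (simp add: field_simps)
    then have "tree_weight (offspring_prob Q) t * exp (real n * \<alpha>)
        \<le> tree_weight (offspring_prob Q) t * exp (\<Sum>x\<in>#tree_cnt t. f x)"
      by (intro mult_left_mono tree_weight_nonneg) auto
    then show "exp (real n * \<alpha>) * tree_weight (offspring_prob Q) t \<le> tree_weight ?q t"
      unfolding tree_weight_def prod_mset_mult_exp by (simp only: mult.commute[of "exp (real n * \<alpha>)"])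
  qed
  also have "\<dots> \<le> (\<Sum>t\<in>sized_trees n a. tree_weight ?q t)"
    by (intro tree_weight_mono_sum) auto
  also have "\<dots> \<le> 1" by (intro sum_sized_trees_le_1 sub) auto
  finally show ?thesis by (simp add: exp_minus field_simps)
qed

text \<open>The part of \<open>F\<close> outside a compact set is treated by the single function
  \<open>\<phi> - u\<close>; the rest is covered by finitely many open sets, each of which satisfies
  the bound on its own. The factor \<open>m\<close> counts these sets.\<close>

lemma tree_prob_upper_bound:
  fixes Q :: "'a::finite \<Rightarrow> 'a list pmf"
  assumes Q: "finite_exponential_moments Q" and F: "closedin offspring_topology F"
    and \<alpha>: "\<And>\<nu>. \<nu> \<in> F \<Longrightarrow> ereal \<alpha> < offspring_rate Q \<nu>"
  shows "\<exists>m. \<forall>\<^sub>F n in sequentially. \<forall>a. tree_prob Q n a F \<le> m * exp (- (real n * \<alpha>))"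
proof -
  let ?X = "offspring_topology :: ('a \<times> 'a list) pmf topology"
  obtain \<phi> u where \<phi>: "superlinear \<phi>"
    "\<And>a. (\<integral>\<^sup>+c. ennreal (exp (\<phi> (length c))) \<partial>Q a) \<le> ennreal (exp u)"
    using exists_superlinear_moment[OF Q] by metis
  have nn: "0 \<le> \<phi> n" for n using \<phi>(1) by (simp add: superlinear_def)
  \<comment> \<open>The level \<open>\<alpha> + u\<close> is the one at which the tightness estimate
    already has rate \<alpha>.\<close>
  let ?K = "{\<nu> :: ('a \<times> 'a list) pmf. moment_le \<phi> (\<alpha> + u) \<nu>}"
  have K: "compactin ?X (F \<inter> ?K)" by (rule closed_Int_compactin[OF F compactin_moment_le[OF \<phi>(1)]])
  have FM: "F \<subseteq> offspring_measures" using closedin_subset[OF F] by (simp add: topspace_offspring_topology)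
  define small where "small U \<longleftrightarrow> (\<forall>\<^sub>F n in sequentially. \<forall>a. tree_prob Q n a U \<le> exp (- (real n * \<alpha>)))" for U
  have tight: "small (- ?K)"
    unfolding small_def
  proof (intro always_eventually allI)
    fix n a
    show "tree_prob Q n a (- ?K) \<le> exp (- (real n * \<alpha>))"
    proof (rule tree_prob_chernoff)
      show "(\<integral>\<^sup>+c. ennreal (exp (\<phi> (length (snd (b, c))) - u)) \<partial>Q b) \<le> 1" for b
      proof -
        have "(\<integral>\<^sup>+c. ennreal (exp (\<phi> (length c) - u)) \<partial>Q b)
            = (\<integral>\<^sup>+c. ennreal (exp (- u)) * ennreal (exp (\<phi> (length c))) \<partial>Q b)"
          by (simp add: exp_diff exp_minus divide_inverse mult.commute ennreal_mult)
        also have "\<dots> = ennreal (exp (- u)) * (\<integral>\<^sup>+c. ennreal (exp (\<phi> (length c))) \<partial>Q b)"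
          by (rule nn_integral_cmult) simp
        also have "\<dots> \<le> ennreal (exp (- u)) * ennreal (exp u)" by (intro mult_left_mono \<phi>(2)) simp
        also have "\<dots> = 1" by (simp add: ennreal_mult[symmetric] exp_add[symmetric])
        finally show ?thesis by simp
      qed
      fix t assume "emp t \<in> - ?K"
      then obtain W where W: "finite W" "\<alpha> + u < (\<Sum>x\<in>W. pmf (emp t) x * \<phi> (length (snd x)))"
        by (auto simp: moment_le_def not_le)
      have i: "integrable (measure_pmf (emp t)) f" for f :: "_ \<Rightarrow> real"
        by (rule integrable_measure_pmf_finite) (simp add: set_pmf_emp)
      note W(2)
      also have "(\<Sum>x\<in>W. pmf (emp t) x * \<phi> (length (snd x)))
          = measure_pmf.expectation (emp t) (\<lambda>x. indicator W x * \<phi> (length (snd x)))"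
        by (subst integral_measure_pmf[OF W(1)]) (auto simp: indicator_def)
      also have "\<dots> \<le> measure_pmf.expectation (emp t) (\<lambda>x. \<phi> (length (snd x)))"
        by (intro integral_mono i) (auto simp: indicator_def nn)
      finally show "\<alpha> \<le> measure_pmf.expectation (emp t) (\<lambda>x. \<phi> (length (snd x)) - u)"
        by (simp add: i)
    qed
  qed
  have cover: "\<exists>U. openin ?X U \<and> \<nu> \<in> U \<and> small U" if \<nu>: "\<nu> \<in> F" for \<nu>
  proof -
    have \<nu>M: "\<nu> \<in> offspring_measures" using \<nu> FM by blast
    have "\<not> offspring_rate Q \<nu> \<le> ereal \<alpha>" using \<alpha>[OF \<nu>] by simp
    then consider (excess) a where "measure_pmf.expectation \<nu> (excess a) \<noteq> 0"
      | (tilt) f where "f \<in> tilts Q" "\<alpha> < measure_pmf.expectation \<nu> f"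
      unfolding offspring_rate_le_iff[OF \<nu>M] by (auto simp: not_le)
    then show ?thesis
    proof cases
      \<comment> \<open>The balance of an empirical measure is at most \<open>1 / n\<close>, so once
        \<open>n\<close> exceeds \<open>2 / \<delta>\<close> no tree of size \<open>n\<close> has
        its empirical measure in this neighbourhood, and the probability is 0.\<close>
      case excess
      define \<delta> where "\<delta> = \<bar>measure_pmf.expectation \<nu> (excess a)\<bar>"
      have \<delta>: "0 < \<delta>" using excess by (simp add: \<delta>_def)
      let ?V = "{x :: real. \<delta> / 2 < \<bar>x\<bar>}"
      have "open ?V" by (intro open_Collect_less continuous_intros)
      then have "openin ?X {\<nu> \<in> topspace ?X. measure_pmf.expectation \<nu> (excess a) \<in> ?V}"
        by (intro openin_continuous_map_preimage[OF continuous_map_excess]) simp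
      moreover have "small {\<nu> \<in> topspace ?X. measure_pmf.expectation \<nu> (excess a) \<in> ?V}"
        unfolding small_def
      proof -
        have "\<forall>\<^sub>F n in sequentially. 2 / \<delta> < real n"
          by (metis eventually_at_top_dense eventually_compose_filterlim filterlim_real_sequentially)
        then show "\<forall>\<^sub>F n in sequentially. \<forall>b. tree_prob Q n b
            {\<nu> \<in> topspace ?X. measure_pmf.expectation \<nu> (excess a) \<in> ?V} \<le> exp (- (real n * \<alpha>))"
        proof eventually_elim
          case (elim n)
          have "False" if t: "t \<in> sized_trees n b" "\<delta> / 2 < \<bar>measure_pmf.expectation (emp t) (excess a)\<bar>" for t b
          proof -
            have "\<bar>measure_pmf.expectation (emp t) (excess a)\<bar> \<le> 1 / real n"
              using t(1) by (auto simp: expectation_emp_excess sized_trees_def indicator_def)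
            moreover have "1 / real n < \<delta> / 2"
            proof -
              have "0 < real n" using elim \<delta> by (meson divide_pos_pos less_trans zero_less_numeral)
              then show ?thesis using elim \<delta> by (simp add: field_simps)
            qed
            ultimately show False using t(2) by linarith
          qed
          then have z: "{t \<in> sized_trees n b. emp t \<in> {\<nu> \<in> topspace ?X. measure_pmf.expectation \<nu> (excess a) \<in> ?V}} = {}" for b
            by auto
          show ?case unfolding tree_prob_def z by simp
        qed
      qed
      moreover have "\<nu> \<in> {\<nu> \<in> topspace ?X. measure_pmf.expectation \<nu> (excess a) \<in> ?V}"
        using \<delta> \<nu>M by (simp add: topspace_offspring_topology \<delta>_def[symmetric])
      ultimately show ?thesis by blast
    next
      case tilt
      let ?U = "{\<nu> \<in> topspace ?X. measure_pmf.expectation \<nu> f \<in> {\<alpha><..}}"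
      have bf: "bounded (range f)" using tilt(1) by (simp add: tilts_def)
      have "openin ?X ?U" by (intro openin_continuous_map_preimage[OF continuous_map_bounded[OF bf]]) simp
      moreover have "small ?U"
        unfolding small_def
      proof (intro always_eventually allI tree_prob_chernoff)
        fix a
        have "(\<integral>\<^sup>+c. ennreal (exp (f (a, c))) \<partial>Q a) = ennreal (measure_pmf.expectation (Q a) (\<lambda>c. exp (f (a, c))))"
          by (intro nn_integral_eq_integral integrable_bounded_pmf[OF bounded_range_compose(2)[OF bf]]) simp
        also have "\<dots> \<le> 1" using tilt(1) by (simp add: tilts_def ennreal_le_1)
        finally show "(\<integral>\<^sup>+c. ennreal (exp (f (a, c))) \<partial>Q a) \<le> 1" .
      qed auto
      moreover have "\<nu> \<in> ?U" using tilt \<nu>M by (simp add: topspace_offspring_topology)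
      ultimately show ?thesis by blast
    qed
  qed
  have "F \<inter> ?K \<subseteq> \<Union> {U. openin ?X U \<and> small U}" using cover by blast
  then obtain \<U> where \<U>: "finite \<U>" "\<U> \<subseteq> {U. openin ?X U \<and> small U}" "F \<inter> ?K \<subseteq> \<Union> \<U>"
    using compactinD[OF K, of "{U. openin ?X U \<and> small U}"] by blast
  have "\<forall>\<^sub>F n in sequentially. \<forall>U\<in>insert (- ?K) \<U>. \<forall>a. tree_prob Q n a U \<le> exp (- (real n * \<alpha>))"
    using \<U> tight by (intro eventually_ball_finite) (auto simp: small_def)
  then have "\<forall>\<^sub>F n in sequentially. \<forall>a. tree_prob Q n a F
      \<le> real (card (insert (- ?K) \<U>)) * exp (- (real n * \<alpha>))"
  proof eventually_elim
    case (elim n)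
    show ?case
    proof
      fix a
      have "tree_prob Q n a F \<le> tree_prob Q n a (\<Union> (insert (- ?K) \<U>))"
        using \<U>(3) by (intro tree_prob_mono) auto
      also have "\<dots> \<le> (\<Sum>U\<in>insert (- ?K) \<U>. tree_prob Q n a U)"
        using \<U>(1) by (intro tree_prob_Union) simp
      also have "\<dots> \<le> (\<Sum>U\<in>insert (- ?K) \<U>. exp (- (real n * \<alpha>)))"
        using elim by (intro sum_mono) blast
      finally show "tree_prob Q n a F \<le> real (card (insert (- ?K) \<U>)) * exp (- (real n * \<alpha>))"
        by simp
    qed
  qed
  then show ?thesis by blast
qed

section \<open>The type graph and the Perron vector\<close>

text \<open>Pairs are (parent, child), opposite to the index order of the mean matrix, whose column
  index is the parent.\<close>

definition type_edges :: "('a \<Rightarrow> 'a list pmf) \<Rightarrow> ('a \<times> 'a) set" where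
  "type_edges Q = {(b, a). \<exists>c\<in>set_pmf (Q b). a \<in> set c}"

lemma integrable_count_kernel:
  assumes "finite_exponential_moments Q"
  shows "integrable (measure_pmf (Q b)) (\<lambda>c. real (count_list c a))"
proof (rule integrableI_bounded)
  have "(\<integral>\<^sup>+c. ennreal (norm (real (count_list c a))) \<partial>Q b)
      \<le> (\<integral>\<^sup>+c. ennreal (exp (1 * real (length c))) \<partial>Q b)"
  proof (intro nn_integral_mono ennreal_leI)
    fix c :: "'a list"
    have "real (count_list c a) \<le> real (length c)" by (rule count_list_le)
    also have "\<dots> \<le> exp (1 * real (length c))" using exp_ge_add_one_self[of "1 * real (length c)"] by linarith
    finally show "norm (real (count_list c a)) \<le> exp (1 * real (length c))" by simp
  qed
  also have "\<dots> < \<infinity>" using assms unfolding finite_exponential_moments_def by (meson zero_less_one)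
  finally show "(\<integral>\<^sup>+c. ennreal (norm (real (count_list c a))) \<partial>Q b) < \<infinity>" .
qed simp

lemma mean_matrix_nonneg: "0 \<le> mean_matrix Q $ a $ b"
  by (simp add: mean_matrix_def integral_nonneg)

text \<open>Integrability of the counts is essential: the integral of a non-integrable function
  would be 0 although the edge exists.\<close>

lemma mean_matrix_pos_iff:
  assumes "finite_exponential_moments Q"
  shows "0 < mean_matrix Q $ a $ b \<longleftrightarrow> (b, a) \<in> type_edges Q"
proof -
  have "mean_matrix Q $ a $ b = 0 \<longleftrightarrow> (AE c in measure_pmf (Q b). real (count_list c a) = 0)"
    unfolding mean_matrix_def
    by (simp add: integral_nonneg_eq_0_iff_AE[OF integrable_count_kernel[OF assms]])
  also have "\<dots> \<longleftrightarrow> (b, a) \<notin> type_edges Q"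
    by (auto simp: AE_measure_pmf_iff type_edges_def count_list_0_iff)
  finally show ?thesis using mean_matrix_nonneg[of Q a b] by linarith
qed

lemma matrix_power_pos_iff:
  assumes "finite_exponential_moments Q"
  shows "0 \<le> matrix_power (mean_matrix Q) k $ a $ b \<and>
    (0 < matrix_power (mean_matrix Q) k $ a $ b \<longleftrightarrow> (b, a) \<in> type_edges Q ^^ k)"
proof (induction k arbitrary: a)
  case 0
  then show ?case by (auto simp: mat_def)
next
  case (Suc k)
  let ?A = "mean_matrix Q"
  have eq: "matrix_power ?A (Suc k) $ a $ b = (\<Sum>d\<in>UNIV. ?A $ a $ d * matrix_power ?A k $ d $ b)"
    by (simp add: matrix_matrix_mult_def)
  have nn: "0 \<le> ?A $ a $ d * matrix_power ?A k $ d $ b" for d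
    using Suc mean_matrix_nonneg by (intro mult_nonneg_nonneg) auto
  have pos: "0 < ?A $ a $ d * matrix_power ?A k $ d $ b \<longleftrightarrow> (d, a) \<in> type_edges Q \<and> (b, d) \<in> type_edges Q ^^ k" for d
    using Suc[of d] mean_matrix_nonneg[of Q a d] mean_matrix_pos_iff[OF assms, of a d]
    by (auto simp: zero_less_mult_iff)
  have "0 < (\<Sum>d\<in>UNIV. ?A $ a $ d * matrix_power ?A k $ d $ b)
      \<longleftrightarrow> (\<exists>d. 0 < ?A $ a $ d * matrix_power ?A k $ d $ b)"
  proof
    assume "0 < (\<Sum>d\<in>UNIV. ?A $ a $ d * matrix_power ?A k $ d $ b)"
    then show "\<exists>d. 0 < ?A $ a $ d * matrix_power ?A k $ d $ b"
      by (metis (no_types, lifting) not_less sum_nonpos)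
  next
    assume "\<exists>d. 0 < ?A $ a $ d * matrix_power ?A k $ d $ b"
    then obtain d where "0 < ?A $ a $ d * matrix_power ?A k $ d $ b" by blast
    also have "\<dots> \<le> (\<Sum>d\<in>UNIV. ?A $ a $ d * matrix_power ?A k $ d $ b)"
      using nn by (intro member_le_sum) auto
    finally show "0 < (\<Sum>d\<in>UNIV. ?A $ a $ d * matrix_power ?A k $ d $ b)" .
  qed
  then show ?case unfolding eq pos using nn by (auto simp: sum_nonneg relcomp_unfold)
qed

lemma matrix_star_pos_iff:
  assumes "finite_exponential_moments Q"
  shows "0 < matrix_star (mean_matrix Q) a b \<longleftrightarrow> (b, a) \<in> (type_edges Q)\<^sup>+"
proof -
  have "0 < matrix_star (mean_matrix Q) a b \<longleftrightarrow> (\<exists>k. 0 < matrix_power (mean_matrix Q) (Suc k) $ a $ b)"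
    unfolding matrix_star_def by (subst suminf_pos_iff) (auto simp del: matrix_power.simps)
  also have "\<dots> \<longleftrightarrow> (\<exists>k. (b, a) \<in> type_edges Q ^^ Suc k)"
    using matrix_power_pos_iff[OF assms] by blast
  also have "\<dots> \<longleftrightarrow> (b, a) \<in> (type_edges Q)\<^sup>+"
    unfolding trancl_power by (metis gr0_conv_Suc)
  finally show ?thesis .
qed

section \<open>Perron-Frobenius theory for a weakly irreducible mean matrix\<close>

locale recurrent_types =
  fixes Q :: "'a::finite \<Rightarrow> 'a list pmf" and Xr Xt :: "'a set" and K :: nat
  assumes exp_moments: "finite_exponential_moments Q"
    and irreducible: "weakly_irreducible_wrt (mean_matrix Q) Xr Xt"
    and transient_bound: "\<And>b c. c \<in> set_pmf (Q b) \<Longrightarrow> (\<Sum>a\<in>Xt. count_list c a) \<le> K"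
    and critical: "critical_gw Q"
begin

abbreviation E where "E \<equiv> type_edges Q"
abbreviation A where "A a b \<equiv> mean_matrix Q $ a $ b"

lemma types_split: "Xr \<union> Xt = UNIV" "Xr \<inter> Xt = {}" "Xr \<noteq> {}"
  using irreducible by (auto simp: weakly_irreducible_wrt_def)

lemma in_Xt_iff: "a \<in> Xt \<longleftrightarrow> a \<notin> Xr"
  using types_split by auto

lemma recurrent_reach: "b \<in> Xr \<Longrightarrow> (b, a) \<in> E\<^sup>+"
  using irreducible matrix_star_pos_iff[OF exp_moments] by (auto simp: weakly_irreducible_wrt_def)

lemma transient_not_reach: "b \<in> Xt \<Longrightarrow> (b, a) \<in> E\<^sup>+ \<Longrightarrow> a \<in> Xt \<and> a \<noteq> b"
  using irreducible unfolding weakly_irreducible_wrt_def matrix_star_pos_iff[OF exp_moments, symmetric]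
  by (metis in_Xt_iff less_irrefl)

lemma transient_child: "b \<in> Xt \<Longrightarrow> (b, a) \<in> E \<Longrightarrow> a \<in> Xt"
  using transient_not_reach by blast

lemma A_nonneg: "0 \<le> A a b" by (rule mean_matrix_nonneg)

lemma A_pos: "(b, a) \<in> E \<Longrightarrow> 0 < A a b" using mean_matrix_pos_iff[OF exp_moments] by blast

lemma A_zero: "(b, a) \<notin> E \<Longrightarrow> A a b = 0"
  using mean_matrix_pos_iff[OF exp_moments] A_nonneg by (metis less_le)

text \<open>Transient types have only transient children, so the row of a recurrent type vanishes at
  transient parents.\<close>

lemma sum_A_recurrent:
  assumes "a \<in> Xr" shows "(\<Sum>b\<in>UNIV. A a b * f b) = (\<Sum>b\<in>Xr. A a b * f b)"
proof (rule sum.mono_neutral_right)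
  show "\<forall>b\<in>UNIV - Xr. A a b * f b = 0"
    using assms transient_child A_zero by (auto simp: in_Xt_iff)
qed auto

lemma wf_transient: "wf (E \<inter> Xt \<times> Xt)"
proof (rule finite_acyclic_wf)
  show "finite (E \<inter> Xt \<times> Xt)" by (rule finite_subset[of _ UNIV]) auto
  show "acyclic (E \<inter> Xt \<times> Xt)"
  proof (rule acyclicI, intro allI notI)
    fix a assume "(a, a) \<in> (E \<inter> Xt \<times> Xt)\<^sup>+"
    moreover from this have "a \<in> Xt" by (metis Int_iff SigmaD1 tranclD)
    moreover have "(E \<inter> Xt \<times> Xt)\<^sup>+ \<subseteq> E\<^sup>+" by (intro trancl_mono_subset) auto
    ultimately show False using transient_not_reach by blast
  qed
qed

text \<open>Brouwer's theorem on the simplex of vectors supported on the recurrent types, for the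
  normalised action of the matrix. The normalising factor \<open>l\<close> is positive since a
  recurrent type with mass has a recurrent child, and positivity of the fixed vector spreads along
  the edges.\<close>

lemma exists_recurrent_eigenvector:
  obtains x :: "'a \<Rightarrow> real" and l where "0 < l" "\<And>a. a \<in> Xr \<Longrightarrow> 0 < x a" "\<And>a. a \<in> Xt \<Longrightarrow> x a = 0"
    "\<And>a. a \<in> Xr \<Longrightarrow> (\<Sum>b\<in>UNIV. A a b * x b) = l * x a"
proof -
  define S where "S = {x :: real^'a. (\<forall>i. 0 \<le> x $ i) \<and> (\<forall>i\<in>Xt. x $ i = 0) \<and> (\<Sum>i\<in>UNIV. x $ i) = 1}"
  define B where "B x = (\<chi> a. if a \<in> Xr then \<Sum>b\<in>UNIV. A a b * x $ b else 0)" for x :: "real^'a"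
  define l where "l x = (\<Sum>i\<in>UNIV. B x $ i)" for x
  have Bnn: "0 \<le> B x $ i" if "x \<in> S" for x i
    using that by (auto simp: B_def S_def intro!: sum_nonneg mult_nonneg_nonneg A_nonneg)
  have Bpos: "0 < B x $ d" if "x \<in> S" "0 < x $ b" "(b, d) \<in> E" "d \<in> Xr" for x b d
  proof -
    have "0 < A d b * x $ b" using that A_pos by auto
    also have "\<dots> \<le> (\<Sum>b\<in>UNIV. A d b * x $ b)"
      using that(1) by (intro member_le_sum) (auto simp: S_def intro!: mult_nonneg_nonneg A_nonneg)
    finally show ?thesis using that(4) by (simp add: B_def)
  qed
  have ex: "\<exists>b\<in>Xr. 0 < x $ b" if "x \<in> S" for x
  proof (rule ccontr)
    assume "\<not> (\<exists>b\<in>Xr. 0 < x $ b)"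
    then have "x $ b = 0" for b using that in_Xt_iff[of b] by (force simp: S_def less_le)
    then show False using that by (simp add: S_def)
  qed
  have lpos: "0 < l x" if x: "x \<in> S" for x
  proof -
    obtain b where b: "b \<in> Xr" "0 < x $ b" using ex[OF x] by blast
    \<comment> \<open>\<open>d\<close> is the first step of a cycle through \<open>b\<close>; as it
      leads back to a recurrent type it cannot be transient.\<close>
    obtain d where d: "(b, d) \<in> E" "(d, b) \<in> E\<^sup>*" using recurrent_reach[OF b(1), of b] by (meson tranclD)
    have "d \<in> Xr"
      using d(2) b(1) transient_not_reach[of d b] in_Xt_iff by (metis rtranclD)
    then have "0 < B x $ d" using Bpos[OF x b(2) d(1)] by blast
    also have "\<dots> \<le> l x" unfolding l_def using Bnn[OF x] by (intro member_le_sum) auto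
    finally show ?thesis .
  qed
  have cS: "compact S"
  proof (rule compact_eq_bounded_closed[THEN iffD2], intro conjI)
    have "norm x \<le> 1" if "x \<in> S" for x
      using that norm_le_l1_cart[of x] by (simp add: S_def)
    then show "bounded S" by (intro boundedI[of _ 1])
    show "closed S"
      unfolding S_def Collect_conj_eq Collect_ball_eq Collect_all_eq
      by (intro closed_Int closed_INT ballI closed_Collect_le closed_Collect_eq continuous_intros)
  qed
  have vS: "convex S"
    unfolding convex_def S_def
    by (auto simp: sum.distrib sum_distrib_left[symmetric] intro!: add_nonneg_nonneg)
  obtain r where r: "r \<in> Xr" using types_split by blast
  have "axis r 1 \<in> S" using r in_Xt_iff by (auto simp: S_def axis_def)
  then have nS: "S \<noteq> {}" by blast
  have cB: "continuous_on S (\<lambda>x. B x $ a)" for a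
    by (cases "a \<in> Xr") (auto simp: B_def intro!: continuous_intros)
  then have cl: "continuous_on S l" unfolding l_def by (intro continuous_on_sum)
  define f where "f x = (\<chi> a. B x $ a / l x)" for x
  have "continuous_on S f"
    unfolding f_def by (intro continuous_on_vec_lambda continuous_on_divide cB cl) (use lpos in force)
  moreover have "f \<in> S \<rightarrow> S"
  proof
    fix x assume x: "x \<in> S"
    have "(\<Sum>i\<in>UNIV. B x $ i / l x) = 1"
      using lpos[OF x] by (simp add: sum_divide_distrib[symmetric] l_def[symmetric])
    then show "f x \<in> S"
      using Bnn[OF x] lpos[OF x] in_Xt_iff by (auto simp: S_def f_def B_def)
  qed
  ultimately obtain x where x: "x \<in> S" "f x = x" using brouwer[OF cS vS nS] by blast
  have eig: "B x $ a = l x * x $ a" for a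
    using x(2) lpos[OF x(1)] by (metis f_def nonzero_eq_divide_eq less_irrefl mult.commute vec_lambda_beta)
  show ?thesis
  proof (rule that[of "l x" "\<lambda>a. x $ a"])
    show "0 < l x" by (rule lpos[OF x(1)])
    show "x $ a = 0" if "a \<in> Xt" for a using x(1) that by (simp add: S_def)
    show "(\<Sum>b\<in>UNIV. A a b * x $ b) = l x * x $ a" if "a \<in> Xr" for a
      using eig[of a] that by (simp add: B_def)
    obtain b where b: "b \<in> Xr" "0 < x $ b" using ex[OF x(1)] by blast
    have "d \<in> Xr \<longrightarrow> 0 < x $ d" if "(b, d) \<in> E\<^sup>*" for d
      using that
    proof (induction rule: rtrancl_induct)
      case (step d e)
      show ?case
      proof
        assume e: "e \<in> Xr"
        then have "d \<in> Xr" using step transient_child in_Xt_iff by blast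
        then have "0 < B x $ e" using step Bpos[OF x(1) _ step(2) e] by blast
        then show "0 < x $ e" using lpos[OF x(1)] by (simp add: eig zero_less_mult_iff)
      qed
    qed (use b in auto)
    then show "0 < x $ a" if "a \<in> Xr" for a
      using that recurrent_reach[OF b(1), of a] by (meson trancl_into_rtrancl)
  qed
qed

text \<open>The recurrent block is its own system, so its eigenvector can be continued to the
  transient types by iterating \<open>A / l\<close>. Its eigenvalue is at most 1 because 1 is the
  largest modulus. It is at least 1 by comparing the moduli \<open>u\<close> of an eigenvector for
  1, which satisfy \<open>u \<le> A u\<close>, with \<open>x\<close> on the recurrent types.\<close>

lemma exists_perron_vector:
  obtains p :: "'a \<Rightarrow> real" where "\<And>a. 0 < p a" "(\<Sum>a\<in>UNIV. p a) = 1" "\<And>a. (\<Sum>b\<in>UNIV. A a b * p b) = p a"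
proof -
  obtain x l where l: "0 < l" and x: "\<And>a. a \<in> Xr \<Longrightarrow> 0 < x a" "\<And>a. a \<in> Xt \<Longrightarrow> x a = (0::real)"
    "\<And>a. a \<in> Xr \<Longrightarrow> (\<Sum>b\<in>UNIV. A a b * x b) = l * x a"
    using exists_recurrent_eigenvector by metis
  define y where "y k = ((\<lambda>z a. (\<Sum>b\<in>UNIV. A a b * z b) / l) ^^ k) x" for k
  have y0: "y 0 = x" and yS: "y (Suc k) a = (\<Sum>b\<in>UNIV. A a b * y k b) / l" for k a
    by (simp_all add: y_def)
  have ynn: "0 \<le> y k a" for k a
  proof (induction k arbitrary: a)
    case 0 then show ?case using x in_Xt_iff[of a] by (cases "a \<in> Xr") (auto simp: y0 less_imp_le)
  next
    case (Suc k)
    have "0 \<le> (\<Sum>b\<in>UNIV. A a b * y k b)" by (intro sum_nonneg mult_nonneg_nonneg A_nonneg Suc)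
    then show ?case using l by (simp add: yS)
  qed
  have yr: "y k a = x a" if "a \<in> Xr" for k a
    using that
  proof (induction k arbitrary: a)
    case (Suc k)
    have "(\<Sum>b\<in>UNIV. A a b * y k b) = (\<Sum>b\<in>UNIV. A a b * x b)"
      unfolding sum_A_recurrent[OF Suc.prems] using Suc.IH by (intro sum.cong) auto
    then show ?case using x(3)[OF Suc.prems] l by (simp add: yS)
  qed (simp add: y0)
  \<comment> \<open>The graph of transient types has no cycle, so by induction from parents to
    children every coordinate becomes constant after finitely many iterations, and the iterate
    reached is an exact eigenvector.\<close>
  have stab: "\<exists>N. \<forall>k\<ge>N. y k a = y N a" for a
    using wf_transient
  proof (induction a rule: wf_induct_rule)
    case (less a)
    have "\<exists>N. \<forall>k\<ge>N. A a b * y k b = A a b * y N b" for b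
    proof (cases "b \<in> Xr \<or> (b, a) \<notin> E")
      case True then show ?thesis using A_zero by (auto simp: yr)
    next
      case False
      then have "b \<in> Xt" "a \<in> Xt" using in_Xt_iff transient_child by blast+
      with False have "(b, a) \<in> E \<inter> Xt \<times> Xt" by blast
      from less[OF this] show ?thesis by metis
    qed
    then obtain N where N: "\<And>b k. k \<ge> N b \<Longrightarrow> A a b * y k b = A a b * y (N b) b" by metis
    define M where "M = Max (range N)"
    have M: "N b \<le> M" for b by (simp add: M_def)
    have "y k a = y (Suc M) a" if "k \<ge> Suc M" for k
    proof -
      obtain k' where k': "k = Suc k'" "k' \<ge> M" using \<open>k \<ge> Suc M\<close> by (cases k) auto
      have "A a b * y k' b = A a b * y M b" for b
        using N[of b k'] N[of b M] M[of b] k' by (metis order_trans)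
      then have "(\<Sum>b\<in>UNIV. A a b * y k' b) = (\<Sum>b\<in>UNIV. A a b * y M b)" by (intro sum.cong refl)
      then show ?thesis by (simp only: k'(1) yS)
    qed
    then show ?case by blast
  qed
  then obtain N where N: "\<And>a k. k \<ge> N a \<Longrightarrow> y k a = y (N a) a" by metis
  define M where "M = Max (range N)"
  have M: "N b \<le> M" for b by (simp add: M_def)
  define z where "z = y M"
  have zfix: "(\<Sum>b\<in>UNIV. A a b * z b) = l * z a" for a
  proof -
    have "y (Suc M) a = y M a" using N[of a M] N[of a "Suc M"] M[of a] by simp
    then show ?thesis using l by (simp add: yS z_def field_simps)
  qed
  have znn: "0 \<le> z a" for a by (simp add: z_def ynn)
  have zr: "z a = x a" if "a \<in> Xr" for a using yr[OF that] by (simp add: z_def)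
  obtain r where r: "r \<in> Xr" using types_split by blast
  have zpos: "0 < z a" for a
  proof -
    have "0 < z d" if "(r, d) \<in> E\<^sup>*" for d
      using that
    proof (induction rule: rtrancl_induct)
      case base then show ?case using x(1)[OF r] zr[OF r] by simp
    next
      case (step d e)
      have "0 < A e d * z d" using step A_pos by auto
      also have "\<dots> \<le> (\<Sum>b\<in>UNIV. A e b * z b)"
        by (intro member_le_sum) (auto intro!: mult_nonneg_nonneg A_nonneg znn)
      finally show ?case using l by (simp add: zfix zero_less_mult_iff)
    qed
    then show ?thesis using recurrent_reach[OF r, of a] by (meson trancl_into_rtrancl)
  qed
  let ?B = "\<chi> a b. complex_of_real (A a b)"
  have ev: "is_eigenvalue ?B 1" and evle: "\<And>w. is_eigenvalue ?B w \<Longrightarrow> cmod w \<le> 1"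
    using critical by (auto simp: critical_gw_def is_largest_eigenvalue_def Let_def)
  have "is_eigenvalue ?B (complex_of_real l)"
    unfolding is_eigenvalue_def
  proof (intro exI conjI)
    show "(\<chi> a. complex_of_real (z a)) \<noteq> 0"
      using zpos[of undefined] by (auto simp: vec_eq_iff intro!: exI[of _ undefined])
    show "?B *v (\<chi> a. complex_of_real (z a)) = complex_of_real l *s (\<chi> a. complex_of_real (z a))"
      by (simp add: vec_eq_iff matrix_vector_mult_def zfix of_real_mult[symmetric] of_real_sum[symmetric]
          del: of_real_mult of_real_sum)
  qed
  from evle[OF this] have l1: "l \<le> 1" using l by simp
  have "1 \<le> l"
  proof -
    obtain v where v: "v \<noteq> 0" "?B *v v = 1 *s v" using ev by (auto simp: is_eigenvalue_def)
    define u where "u a = cmod (v $ a)" for a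
    have u: "u a \<le> (\<Sum>b\<in>UNIV. A a b * u b)" for a
    proof -
      have "v $ a = (\<Sum>b\<in>UNIV. complex_of_real (A a b) * v $ b)"
        using v(2) by (simp add: vec_eq_iff matrix_vector_mult_def)
      then have "u a \<le> (\<Sum>b\<in>UNIV. cmod (complex_of_real (A a b) * v $ b))"
        unfolding u_def by (metis norm_sum)
      then show ?thesis by (simp add: norm_mult u_def A_nonneg)
    qed
    \<comment> \<open>A vector with \<open>u \<le> A u\<close> that vanishes on the recurrent types
      would vanish on the transient ones as well, by induction from parents to children.\<close>
    have "\<exists>a\<in>Xr. u a \<noteq> 0"
    proof (rule ccontr)
      assume c: "\<not> (\<exists>a\<in>Xr. u a \<noteq> 0)"
      have "u a = 0" for a
        using wf_transient
      proof (induction a rule: wf_induct_rule)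
        case (less a)
        have "A a b * u b = 0" for b
        proof (cases "b \<in> Xr \<or> (b, a) \<notin> E")
          case True then show ?thesis using A_zero c by auto
        next
          case False
          then have "b \<in> Xt" "a \<in> Xt" using in_Xt_iff transient_child by blast+
          with False less show ?thesis by auto
        qed
        then have "(\<Sum>b\<in>UNIV. A a b * u b) = 0" by (intro sum.neutral ballI)
        then have "u a \<le> 0" using u[of a] by simp
        then show ?case by (simp add: u_def)
      qed
      then have "v = 0" by (simp add: u_def vec_eq_iff)
      then show False using v by simp
    qed
    then obtain a1 where a1: "a1 \<in> Xr" "u a1 \<noteq> 0" by blast
    \<comment> \<open>At a recurrent type where \<open>u / x\<close> attains its maximum
      \<open>t\<close>, the inequality \<open>u \<le> A u \<le> t A x = t l x\<close> forces
      \<open>1 \<le> l\<close>.\<close>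
    define t where "t = Max ((\<lambda>a. u a / x a) ` Xr)"
    have "t \<in> (\<lambda>a. u a / x a) ` Xr" unfolding t_def using a1 by (intro Max_in) auto
    then obtain a0 where a0: "a0 \<in> Xr" "t = u a0 / x a0" by blast
    have tle: "u a / x a \<le> t" if "a \<in> Xr" for a unfolding t_def using that by (intro Max_ge) auto
    have ut: "u a \<le> t * x a" if "a \<in> Xr" for a
      using tle[OF that] x(1)[OF that] by (simp add: pos_divide_le_eq)
    have "0 < u a1 / x a1" using a1 x(1)[OF a1(1)] by (simp add: u_def)
    then have t0: "0 < t" using tle[OF a1(1)] by linarith
    have "t * x a0 = u a0" using a0 x(1)[OF a0(1)] by simp
    also have "\<dots> \<le> (\<Sum>b\<in>UNIV. A a0 b * u b)" by (rule u)
    also have "\<dots> = (\<Sum>b\<in>Xr. A a0 b * u b)" by (rule sum_A_recurrent[OF a0(1)])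
    also have "\<dots> \<le> (\<Sum>b\<in>Xr. A a0 b * (t * x b))" by (intro sum_mono mult_left_mono ut A_nonneg)
    also have "\<dots> = t * (\<Sum>b\<in>Xr. A a0 b * x b)" by (simp add: sum_distrib_left mult_ac)
    also have "(\<Sum>b\<in>Xr. A a0 b * x b) = l * x a0"
      using x(3)[OF a0(1)] sum_A_recurrent[OF a0(1), of x] by simp
    finally have "t * x a0 * 1 \<le> t * x a0 * l" by (simp add: mult_ac)
    then show ?thesis using t0 x(1)[OF a0(1)] by (simp add: mult_le_cancel_left)
  qed
  with l1 have l_eq: "l = 1" by simp
  define Z where "Z = (\<Sum>a\<in>UNIV. z a)"
  have Z: "0 < Z" unfolding Z_def using zpos by (intro sum_pos) auto
  show ?thesis
  proof (rule that[of "\<lambda>a. z a / Z"])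
    show "0 < z a / Z" for a using zpos Z by simp
    show "(\<Sum>a\<in>UNIV. z a / Z) = 1" using Z by (simp add: sum_divide_distrib[symmetric] Z_def[symmetric])
    show "(\<Sum>b\<in>UNIV. A a b * (z b / Z)) = z a / Z" for a
      using zfix[of a] by (simp add: sum_divide_distrib[symmetric] l_eq)
  qed
qed

end

section \<open>Trees with holes\<close>

definition pos_mset :: "('a \<Rightarrow> 'a list pmf) \<Rightarrow> ('a \<times> 'a list) multiset \<Rightarrow> bool" where
  "pos_mset Q C \<longleftrightarrow> (\<forall>x\<in>#C. 0 < offspring_prob Q x)"

lemma pos_mset_plus [simp]: "pos_mset Q (C + D) \<longleftrightarrow> pos_mset Q C \<and> pos_mset Q D"
  unfolding pos_mset_def set_mset_union by (rule ball_Un)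

lemma pos_mset_add_mset [simp]: "pos_mset Q (add_mset (a, c) D) \<longleftrightarrow> c \<in> set_pmf (Q a) \<and> pos_mset Q D"
  by (auto simp: pos_mset_def pmf_positive_iff)

lemma pos_mset_empty [simp]: "pos_mset Q {#}"
  by (simp add: pos_mset_def)

lemma pos_mset_sum_list [simp]: "pos_mset Q (sum_list Cs) \<longleftrightarrow> (\<forall>C\<in>set Cs. pos_mset Q C)"
  by (induction Cs) auto

text \<open>A path inside these edges exists under every kernel that charges all entries of
  \<open>C\<close>. Recording it with a hole allows reachability to be transferred from
  \<open>Q\<close> to the kernel of an approximating measure.\<close>

definition mset_edges :: "('a \<times> 'a list) multiset \<Rightarrow> ('a \<times> 'a) set" where
  "mset_edges C = {(b, a). \<exists>c. (b, c) \<in># C \<and> a \<in> set c}"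

lemma mset_edges_plus: "mset_edges (C + D) = mset_edges C \<union> mset_edges D"
  by (auto simp: mset_edges_def)

text \<open>
  The multiset \<open>C\<close> records the vertices of a finite tree with root type \<open>b\<close> in which one leaf of
  type \<open>a\<close> (for \<open>hole2\<close>: two leaves of types \<open>d\<close> and \<open>a\<close>) is left open, to be replaced by a
  tree with that root type.
\<close>

definition hole1 :: "('a \<Rightarrow> 'a list pmf) \<Rightarrow> 'a \<Rightarrow> 'a \<Rightarrow> ('a \<times> 'a list) multiset \<Rightarrow> bool" where
  "hole1 Q b a C \<longleftrightarrow> pos_mset Q C \<and> (b, a) \<in> (mset_edges C)\<^sup>* \<and>
     (\<exists>f. (\<forall>t. root_type t = a \<longrightarrow> root_type (f t) = b \<and> tree_cnt (f t) = tree_cnt t + C) \<and>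
          inj_on f {t. root_type t = a})"

definition hole2 :: "('a \<Rightarrow> 'a list pmf) \<Rightarrow> 'a \<Rightarrow> 'a \<Rightarrow> 'a \<Rightarrow> ('a \<times> 'a list) multiset \<Rightarrow> bool" where
  "hole2 Q b d a C \<longleftrightarrow> pos_mset Q C \<and> (b, d) \<in> (mset_edges C)\<^sup>* \<and>
     (\<exists>f. (\<forall>t u. root_type t = d \<longrightarrow> root_type u = a \<longrightarrow>
            root_type (f (t, u)) = b \<and> tree_cnt (f (t, u)) = tree_cnt t + tree_cnt u + C) \<and>
          inj_on f ({t. root_type t = d} \<times> {u. root_type u = a}))"

lemma hole1_refl: "hole1 Q a a {#}"
  unfolding hole1_def by (auto intro!: exI[of _ id])

lemma rtrancl_mset_edges_plus:
  assumes "(b, e) \<in> (mset_edges C)\<^sup>*" "(e, a) \<in> (mset_edges D)\<^sup>*"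
  shows "(b, a) \<in> (mset_edges (C + D))\<^sup>*"
proof -
  have "(b, e) \<in> (mset_edges (C + D))\<^sup>*" "(e, a) \<in> (mset_edges (C + D))\<^sup>*"
    using assms by (auto simp: mset_edges_plus intro: in_rtrancl_UnI)
  then show ?thesis by (rule rtrancl_trans)
qed

lemma hole1_trans:
  assumes "hole1 Q b e C" "hole1 Q e a D" shows "hole1 Q b a (C + D)"
proof -
  obtain f where f: "\<And>t. root_type t = e \<Longrightarrow> root_type (f t) = b \<and> tree_cnt (f t) = tree_cnt t + C"
    "inj_on f {t. root_type t = e}" using assms(1) by (auto simp: hole1_def)
  obtain g where g: "\<And>t. root_type t = a \<Longrightarrow> root_type (g t) = e \<and> tree_cnt (g t) = tree_cnt t + D"
    "inj_on g {t. root_type t = a}" using assms(2) by (auto simp: hole1_def)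
  have "inj_on (f \<circ> g) {t. root_type t = a}"
    by (rule comp_inj_on[OF g(2)]) (rule inj_on_subset[OF f(2)], use g(1) in auto)
  moreover have "root_type ((f \<circ> g) t) = b \<and> tree_cnt ((f \<circ> g) t) = tree_cnt t + (C + D)" if "root_type t = a" for t
    using f(1)[of "g t"] g(1)[OF that] by (simp add: ac_simps)
  ultimately show ?thesis
    using assms rtrancl_mset_edges_plus[of b e C a D]
    by (auto simp: hole1_def intro!: exI[of _ "f \<circ> g"])
qed

lemma hole1_hole2:
  assumes "hole1 Q b e C" "hole2 Q e d a D" shows "hole2 Q b d a (C + D)"
proof -
  obtain f where f: "\<And>t. root_type t = e \<Longrightarrow> root_type (f t) = b \<and> tree_cnt (f t) = tree_cnt t + C"
    "inj_on f {t. root_type t = e}" using assms(1) by (auto simp: hole1_def)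
  obtain g where g: "\<And>t u. root_type t = d \<Longrightarrow> root_type u = a \<Longrightarrow>
      root_type (g (t, u)) = e \<and> tree_cnt (g (t, u)) = tree_cnt t + tree_cnt u + D"
    "inj_on g ({t. root_type t = d} \<times> {u. root_type u = a})" using assms(2) by (auto simp: hole2_def)
  have "inj_on (f \<circ> g) ({t. root_type t = d} \<times> {u. root_type u = a})"
    by (rule comp_inj_on[OF g(2)]) (rule inj_on_subset[OF f(2)], use g(1) in auto)
  moreover have "root_type ((f \<circ> g) (t, u)) = b \<and> tree_cnt ((f \<circ> g) (t, u)) = tree_cnt t + tree_cnt u + (C + D)"
    if "root_type t = d" "root_type u = a" for t u
    using f(1)[of "g (t, u)"] g(1)[OF that] by (simp add: ac_simps)
  ultimately show ?thesis
    using assms rtrancl_mset_edges_plus[of b e C d D]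
    by (auto simp: hole1_def hole2_def intro!: exI[of _ "f \<circ> g"])
qed

lemma hole2_hole1:
  assumes "hole2 Q b d' a' C" "hole1 Q d' d D1" "hole1 Q a' a D2" shows "hole2 Q b d a (C + D1 + D2)"
proof -
  obtain h where h: "\<And>t u. root_type t = d' \<Longrightarrow> root_type u = a' \<Longrightarrow>
      root_type (h (t, u)) = b \<and> tree_cnt (h (t, u)) = tree_cnt t + tree_cnt u + C"
    "inj_on h ({t. root_type t = d'} \<times> {u. root_type u = a'})" using assms(1) by (auto simp: hole2_def)
  obtain f where f: "\<And>t. root_type t = d \<Longrightarrow> root_type (f t) = d' \<and> tree_cnt (f t) = tree_cnt t + D1"
    "inj_on f {t. root_type t = d}" using assms(2) by (auto simp: hole1_def)
  obtain g where g: "\<And>t. root_type t = a \<Longrightarrow> root_type (g t) = a' \<and> tree_cnt (g t) = tree_cnt t + D2"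
    "inj_on g {t. root_type t = a}" using assms(3) by (auto simp: hole1_def)
  have "inj_on (h \<circ> map_prod f g) ({t. root_type t = d} \<times> {u. root_type u = a})"
    by (rule comp_inj_on[OF map_prod_inj_on[OF f(2) g(2)]])
       (rule inj_on_subset[OF h(2)], use f(1) g(1) in auto)
  moreover have "root_type ((h \<circ> map_prod f g) (t, u)) = b \<and>
      tree_cnt ((h \<circ> map_prod f g) (t, u)) = tree_cnt t + tree_cnt u + (C + D1 + D2)"
    if "root_type t = d" "root_type u = a" for t u
    using h(1)[of "f t" "g u"] f(1)[OF that(1)] g(1)[OF that(2)] by (simp add: ac_simps)
  moreover have "(b, d) \<in> (mset_edges (C + D1 + D2))\<^sup>*"
    using assms rtrancl_mset_edges_plus[of b d' C d D1]
    by (auto simp: hole1_def hole2_def mset_edges_plus intro: in_rtrancl_UnI)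
  ultimately show ?thesis
    using assms by (auto simp: hole1_def hole2_def intro!: exI[of _ "h \<circ> map_prod f g"])
qed

lemma sum_list_update_0:
  fixes xs :: "'b::comm_monoid_add list"
  shows "i < length xs \<Longrightarrow> sum_list (xs[i := x]) = x + sum_list (xs[i := 0])"
  by (induction xs arbitrary: i) (auto split: nat.splits simp: ac_simps)

lemma tree_cnt_hole:
  assumes "\<And>a. root_type (\<tau> a) = a" "i < length c" "root_type t = c ! i"
  shows "tree_cnt (GNode b ((map \<tau> c)[i := t]))
    = tree_cnt t + add_mset (b, c) (sum_list ((map (tree_cnt \<circ> \<tau>) c)[i := {#}]))"
proof -
  have "map root_type ((map \<tau> c)[i := t]) = c"
    using assms by (auto simp: map_update o_def list_update_same_conv)
  moreover have "map tree_cnt ((map \<tau> c)[i := t]) = (map (tree_cnt \<circ> \<tau>) c)[i := tree_cnt t]"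
    by (simp add: map_update)
  ultimately show ?thesis
    using assms(2) sum_list_update_0[of i "map (tree_cnt \<circ> \<tau>) c" "tree_cnt t"] by simp
qed

text \<open>All children but the \<open>i\<close>-th are completed by the fixed finite trees
  \<open>\<tau>\<close>. The open position is fixed, so the inserted tree can be read off again and
  the filling is injective.\<close>

lemma hole1_step:
  assumes \<tau>: "\<And>a. root_type (\<tau> a) = a" "\<And>a. pos_mset Q (tree_cnt (\<tau> a))"
    and c: "c \<in> set_pmf (Q b)" "i < length c"
  shows "\<exists>C. hole1 Q b (c ! i) C"
proof -
  let ?C = "add_mset (b, c) (sum_list ((map (tree_cnt \<circ> \<tau>) c)[i := {#}]))"
  let ?f = "\<lambda>t. GNode b ((map \<tau> c)[i := t])"
  have "inj_on ?f {t. root_type t = c ! i}"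
    using c(2) by (intro inj_onI) (metis gtree.inject length_map nth_list_update_eq)
  moreover have "pos_mset Q ?C"
    using c \<tau>(2) by (auto dest!: set_update_subset_insert[THEN subsetD])
  moreover have "(b, c ! i) \<in> mset_edges ?C" using c(2) by (auto simp: mset_edges_def)
  ultimately have "hole1 Q b (c ! i) ?C"
    unfolding hole1_def using tree_cnt_hole[OF \<tau>(1) c(2)]
    by (intro conjI exI[of _ ?f]) auto
  then show ?thesis by blast
qed

lemma hole2_step:
  assumes \<tau>: "\<And>a. root_type (\<tau> a) = a" "\<And>a. pos_mset Q (tree_cnt (\<tau> a))"
    and c: "c \<in> set_pmf (Q b)" "i < length c" "j < length c" "i \<noteq> j"
  shows "\<exists>C. hole2 Q b (c ! i) (c ! j) C"
proof -
  let ?C = "add_mset (b, c) (sum_list ((map (tree_cnt \<circ> \<tau>) c)[i := {#}, j := {#}]))"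
  let ?f = "\<lambda>(t, u). GNode b ((map \<tau> c)[i := t, j := u])"
  have "inj_on ?f ({t. root_type t = c ! i} \<times> {u. root_type u = c ! j})"
  proof (rule inj_onI)
    fix x x' assume "?f x = ?f x'"
    moreover obtain t u t' u' where x: "x = (t, u)" "x' = (t', u')" by (cases x, cases x')
    ultimately have "GNode b ((map \<tau> c)[i := t, j := u]) = GNode b ((map \<tau> c)[i := t', j := u'])" by simp
    then have eq: "(map \<tau> c)[i := t, j := u] = (map \<tau> c)[i := t', j := u']" by simp
    have "(map \<tau> c)[i := t, j := u] ! i = t" "(map \<tau> c)[i := t', j := u'] ! i = t'"
      "(map \<tau> c)[i := t, j := u] ! j = u" "(map \<tau> c)[i := t', j := u'] ! j = u'"
      using c by simp_all
    then show "x = x'" using eq x by simp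
  qed
  moreover have "pos_mset Q ?C"
    using c \<tau>(2) by (auto dest!: set_update_subset_insert[THEN subsetD])
  moreover have "(b, c ! i) \<in> mset_edges ?C" using c(2) by (auto simp: mset_edges_def)
  moreover have "root_type (?f (t, u)) = b \<and> tree_cnt (?f (t, u)) = tree_cnt t + tree_cnt u + ?C"
    if "root_type t = c ! i" "root_type u = c ! j" for t u
  proof -
    have "map root_type ((map \<tau> c)[i := t, j := u]) = c"
      using that \<tau>(1) c by (simp add: map_update o_def)
    moreover have "map tree_cnt ((map \<tau> c)[i := t, j := u]) = (map (tree_cnt \<circ> \<tau>) c)[i := tree_cnt t, j := tree_cnt u]"
      by (simp add: map_update)
    moreover have "sum_list ((map (tree_cnt \<circ> \<tau>) c)[i := tree_cnt t, j := tree_cnt u])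
        = tree_cnt u + (tree_cnt t + sum_list ((map (tree_cnt \<circ> \<tau>) c)[i := {#}, j := {#}]))"
    proof -
      let ?L = "map (tree_cnt \<circ> \<tau>) c"
      have "sum_list (?L[i := tree_cnt t, j := tree_cnt u]) = tree_cnt u + sum_list (?L[i := tree_cnt t, j := {#}])"
        using c by (intro sum_list_update_0) simp
      also have "?L[i := tree_cnt t, j := {#}] = ?L[j := {#}, i := tree_cnt t]"
        using c by (intro list_update_swap)
      also have "sum_list (?L[j := {#}, i := tree_cnt t]) = tree_cnt t + sum_list (?L[j := {#}, i := {#}])"
        using c by (intro sum_list_update_0) simp
      also have "?L[j := {#}, i := {#}] = ?L[i := {#}, j := {#}]"
        using c by (intro list_update_swap) simp
      finally show ?thesis .
    qed
    ultimately show ?thesis by simp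
  qed
  ultimately have "hole2 Q b (c ! i) (c ! j) ?C"
    unfolding hole2_def by (intro conjI exI[of _ ?f]) blast+
  then show ?thesis by blast
qed

lemma sum_mset_excess_tree:
  "(\<Sum>x\<in>#tree_cnt t. excess a x) = indicator {root_type t} a"
  unfolding excess_def[abs_def] sum_mset_diff_real
  using sum_mset_count_children[where t = t and a = a] by simp

text \<open>A complete tree has the indicator of its root type as its total balance. Filling both
  leaves and subtracting the balances of the inserted trees leaves that of the frame.\<close>

lemma sum_mset_excess_hole2:
  assumes "hole2 Q b d a C" and "\<And>a. \<exists>t :: 'a gtree. root_type t = a"
  shows "(\<Sum>x\<in>#C. excess e x) = indicator {b} e - indicator {d} e - indicator {a :: 'a} e"
proof -
  obtain f where f: "\<And>t u. root_type t = d \<Longrightarrow> root_type u = a \<Longrightarrow>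
      root_type (f (t, u)) = b \<and> tree_cnt (f (t, u)) = tree_cnt t + tree_cnt u + C"
    using assms(1) by (auto simp: hole2_def)
  obtain t u where tu: "root_type t = d" "root_type u = a" using assms(2) by metis
  have "(\<Sum>x\<in>#tree_cnt (f (t, u)). excess e x) = indicator {b} e"
    unfolding sum_mset_excess_tree using f[OF tu] by simp
  moreover have "(\<Sum>x\<in>#tree_cnt (f (t, u)). excess e x)
      = indicator {d} e + indicator {a} e + (\<Sum>x\<in>#C. excess e x)"
    using f[OF tu] sum_mset_excess_tree[of e t] sum_mset_excess_tree[of e u] tu by simp
  ultimately show ?thesis by simp
qed

section \<open>Finite trees and branching under a critical kernel\<close>

context recurrent_types
begin

lemma pos_tree_GNode:
  "pos_mset Q (tree_cnt (GNode a ts)) \<longleftrightarrow>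
    map root_type ts \<in> set_pmf (Q a) \<and> (\<forall>s\<in>set ts. pos_mset Q (tree_cnt s))"
  by auto

text \<open>All children of a transient vertex are transient, so there are at most \<open>K\<close>
  of them, and their types lie further along an acyclic graph. Induction bounds the size by one plus
  \<open>K\<close> times the bound for the children.\<close>

lemma transient_trees_bounded:
  "\<exists>N. \<forall>t. root_type t \<in> Xt \<longrightarrow> pos_mset Q (tree_cnt t) \<longrightarrow> size (tree_cnt t) \<le> N"
proof -
  have "wf ((E \<inter> Xt \<times> Xt)\<inverse>)"
    by (rule finite_acyclic_wf_converse[OF finite wf_acyclic[OF wf_transient]])
  then have bd: "\<exists>N. \<forall>t. root_type t = a \<longrightarrow> pos_mset Q (tree_cnt t) \<longrightarrow> size (tree_cnt t) \<le> N" if "a \<in> Xt" for a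
    using that
  proof (induction a rule: wf_induct_rule)
    case (less a)
    have "\<forall>d. \<exists>N. (a, d) \<in> E \<longrightarrow> (\<forall>t. root_type t = d \<longrightarrow> pos_mset Q (tree_cnt t) \<longrightarrow> size (tree_cnt t) \<le> N)"
    proof
      fix d show "\<exists>N. (a, d) \<in> E \<longrightarrow> (\<forall>t. root_type t = d \<longrightarrow> pos_mset Q (tree_cnt t) \<longrightarrow> size (tree_cnt t) \<le> N)"
      proof (cases "(a, d) \<in> E")
        case True
        then have d: "d \<in> Xt" by (rule transient_child[OF less.prems])
        then have "(d, a) \<in> (E \<inter> Xt \<times> Xt)\<inverse>" using True less.prems by simp
        from less.IH[OF this d] show ?thesis by simp
      qed simp
    qed
    from choice[OF this] obtain N where N: "\<And>d t. (a, d) \<in> E \<Longrightarrow> root_type t = d \<Longrightarrow>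
      pos_mset Q (tree_cnt t) \<Longrightarrow> size (tree_cnt t) \<le> N d" by auto
    define M where "M = Max (range N)"
    have M: "N d \<le> M" for d by (simp add: M_def)
    have "size (tree_cnt t) \<le> Suc (K * M)" if t: "root_type t = a" "pos_mset Q (tree_cnt t)" for t
    proof -
      obtain ts where ts: "t = GNode a ts" using t by (cases t) auto
      have c: "map root_type ts \<in> set_pmf (Q a)" "\<And>s. s \<in> set ts \<Longrightarrow> pos_mset Q (tree_cnt s)"
        using t(2) unfolding ts pos_tree_GNode by auto
      have ed: "(a, root_type s) \<in> E" if "s \<in> set ts" for s
        using c(1) that by (force simp: type_edges_def)
      have "set (map root_type ts) \<subseteq> Xt" using ed transient_child[OF less.prems] by auto
      then have "length ts = (\<Sum>a\<in>Xt. count_list (map root_type ts) a)"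
        by (metis finite sum_count_set length_map)
      then have len: "length ts \<le> K" using transient_bound[OF c(1)] by simp
      have "size (tree_cnt t) = Suc (sum_list (map (\<lambda>s. size (tree_cnt s)) ts))"
        by (simp add: ts size_sum_list o_def)
      also have "sum_list (map (\<lambda>s. size (tree_cnt s)) ts) \<le> sum_list (map (\<lambda>s. M) ts)"
        by (intro sum_list_mono order_trans[OF N[OF ed refl c(2)] M])
      also have "\<dots> \<le> K * M" using len by (simp add: sum_list_triv)
      finally show ?thesis by simp
    qed
    then show ?case by blast
  qed
  have "\<forall>a. \<exists>N. a \<in> Xt \<longrightarrow> (\<forall>t. root_type t = a \<longrightarrow> pos_mset Q (tree_cnt t) \<longrightarrow> size (tree_cnt t) \<le> N)"
    using bd by simp
  from choice[OF this] obtain N where N: "\<And>a t. a \<in> Xt \<Longrightarrow> root_type t = a \<Longrightarrow>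
    pos_mset Q (tree_cnt t) \<Longrightarrow> size (tree_cnt t) \<le> N a" by auto
  have "size (tree_cnt t) \<le> Max (range N)" if "root_type t \<in> Xt" "pos_mset Q (tree_cnt t)" for t
    using N[OF that(1) refl that(2)] by (rule order_trans) simp
  then show ?thesis by blast
qed

lemma expectation_count_sum:
  "integrable (measure_pmf (Q b)) (\<lambda>c. \<Sum>a\<in>U. real (count_list c a))"
  "(\<Sum>a\<in>U. A a b) = measure_pmf.expectation (Q b) (\<lambda>c. \<Sum>a\<in>U. real (count_list c a))"
  using integrable_count_kernel[OF exp_moments] by (simp_all add: mean_matrix_def)

text \<open>Let \<open>U\<close> be the types without finite trees. Each vertex with type in
  \<open>U\<close> has a child in \<open>U\<close>, so the columns of \<open>A\<close> summed over
  \<open>U\<close> are at least 1 there. Invariance of the Perron vector then leaves nothing for the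
  other columns: types outside \<open>U\<close> have no children in \<open>U\<close>. But the
  recurrent type \<open>r\<close> lies outside \<open>U\<close> and reaches every type.\<close>

lemma exists_finite_trees:
  assumes "r \<in> Xr" "root_type t0 = r" "pos_mset Q (tree_cnt t0)"
  shows "\<exists>t. root_type t = a \<and> pos_mset Q (tree_cnt t)"
proof (rule ccontr)
  assume a: "\<not> ?thesis"
  define U where "U = {b. \<not> (\<exists>t. root_type t = b \<and> pos_mset Q (tree_cnt t))}"
  have aU: "a \<in> U" and rU: "r \<notin> U" using a assms by (auto simp: U_def)
  have U: "\<exists>d\<in>set c. d \<in> U" if "b \<in> U" "c \<in> set_pmf (Q b)" for b c
  proof (rule ccontr)
    assume "\<not> (\<exists>d\<in>set c. d \<in> U)"
    then have "\<forall>d\<in>set c. \<exists>t. root_type t = d \<and> pos_mset Q (tree_cnt t)" by (auto simp: U_def)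
    then obtain \<tau> where \<tau>: "\<And>d. d \<in> set c \<Longrightarrow> root_type (\<tau> d) = d \<and> pos_mset Q (tree_cnt (\<tau> d))" by metis
    have "map root_type (map \<tau> c) = c" using \<tau> by (simp add: map_idI)
    then have "pos_mset Q (tree_cnt (GNode b (map \<tau> c)))"
      unfolding pos_tree_GNode using that(2) \<tau> by auto
    then show False using that(1) unfolding U_def by (metis (mono_tags, lifting) gtree.sel(1) mem_Collect_eq)
  qed
  obtain p where p: "\<And>a. 0 < p a" "(\<Sum>a\<in>UNIV. p a) = 1" "\<And>a. (\<Sum>b\<in>UNIV. A a b * p b) = p a"
    using exists_perron_vector by metis
  define col where "col b = (\<Sum>a\<in>U. A a b)" for b
  have col0: "0 \<le> col b" for b unfolding col_def by (intro sum_nonneg A_nonneg)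
  have col1: "1 \<le> col b" if bU: "b \<in> U" for b
  proof -
    have "measure_pmf.expectation (Q b) (\<lambda>_. 1) \<le> measure_pmf.expectation (Q b) (\<lambda>c. \<Sum>a\<in>U. real (count_list c a))"
    proof (rule integral_mono_AE)
      show "AE c in measure_pmf (Q b). 1 \<le> (\<Sum>a\<in>U. real (count_list c a))"
        unfolding AE_measure_pmf_iff
      proof
        fix c assume "c \<in> set_pmf (Q b)"
        then obtain d where d: "d \<in> set c" "d \<in> U" using U[OF bU] by blast
        have "1 \<le> real (count_list c d)"
          using d(1) count_list_0_iff[of c d] by (metis One_nat_def Suc_leI gr0I of_nat_1 of_nat_le_iff)
        also have "\<dots> \<le> (\<Sum>a\<in>U. real (count_list c a))" using d(2) by (intro member_le_sum) auto
        finally show "1 \<le> (\<Sum>a\<in>U. real (count_list c a))" .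
      qed
    qed (use expectation_count_sum in auto)
    then show ?thesis by (simp add: col_def expectation_count_sum(2))
  qed
  have "(\<Sum>a\<in>U. p a) = (\<Sum>a\<in>U. \<Sum>b\<in>UNIV. A a b * p b)" by (simp add: p(3))
  also have "\<dots> = (\<Sum>b\<in>UNIV. col b * p b)"
    unfolding col_def sum_distrib_right by (rule sum.swap)
  also have "\<dots> = (\<Sum>b\<in>U. col b * p b) + (\<Sum>b\<in>-U. col b * p b)"
    by (subst sum.union_disjoint[symmetric]) auto
  also have "\<dots> \<ge> (\<Sum>b\<in>U. p b) + (\<Sum>b\<in>-U. col b * p b)"
    using col1 p(1) by (intro add_right_mono sum_mono) (simp add: less_imp_le)
  finally have "(\<Sum>b\<in>-U. col b * p b) \<le> 0" by simp
  then have "(\<Sum>b\<in>-U. col b * p b) = 0"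
    using p(1) col0 by (intro antisym sum_nonneg mult_nonneg_nonneg) (auto simp: less_imp_le)
  then have "col b * p b = 0" if "b \<notin> U" for b
    using that p(1) col0 by (subst (asm) sum_nonneg_eq_0_iff) (auto simp: less_imp_le)
  then have "col b = 0" if "b \<notin> U" for b using that p(1)[of b] by (metis less_irrefl mult_eq_0_iff)
  then have zero: "A a b = 0" if "b \<notin> U" "a \<in> U" for a b
    using that unfolding col_def by (subst (asm) sum_nonneg_eq_0_iff) (auto simp: A_nonneg)
  have "d \<notin> U" if "(r, d) \<in> E\<^sup>+" for d
    using that
  proof (induction rule: trancl_induct)
    case (base d) then show ?case using zero[OF rU, of d] A_pos[of r d] by auto
  next
    case (step d e) then show ?case using zero[of d e] A_pos[of d e] by auto
  qed
  then show False using aU recurrent_reach[OF assms(1)] by blast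
qed

text \<open>Were there never two recurrent children, the recurrent column sums would be at most 1,
  and invariance of the Perron vector would make them equal to 1. Every recurrent vertex would then
  have exactly one recurrent child, and no tree with a recurrent root would be finite.\<close>

lemma exists_branching:
  assumes "r \<in> Xr" "root_type t0 = r" "pos_mset Q (tree_cnt t0)"
  obtains b c i j where "b \<in> Xr" "c \<in> set_pmf (Q b)" "i < length c" "j < length c" "i \<noteq> j"
    "c ! i \<in> Xr" "c ! j \<in> Xr"
proof (rule ccontr)
  assume "\<not> thesis"
  with that have no: "\<And>b c i j. b \<in> Xr \<Longrightarrow> c \<in> set_pmf (Q b) \<Longrightarrow> i < length c \<Longrightarrow> j < length c \<Longrightarrow>
    c ! i \<in> Xr \<Longrightarrow> c ! j \<in> Xr \<Longrightarrow> i = j" by blast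
  define cnt where "cnt c = (\<Sum>a\<in>Xr. real (count_list c a))" for c
  have cnt_length: "cnt c = real (length (filter (\<lambda>a. a \<in> Xr) c))" for c
  proof (induction c)
    case (Cons x c)
    have "cnt (x # c) = (\<Sum>a\<in>Xr. real (count_list c a) + (if a = x then 1 else 0))"
      unfolding cnt_def by (intro sum.cong) auto
    then show ?case using Cons by (simp add: sum.distrib cnt_def)
  qed (simp add: cnt_def)
  have cnt1: "cnt c \<le> 1" if "b \<in> Xr" "c \<in> set_pmf (Q b)" for b c
  proof -
    have "card {i. i < length c \<and> c ! i \<in> Xr} \<le> 1"
      using no[OF that] by (subst card_le_Suc0_iff_eq[unfolded One_nat_def[symmetric]]) auto
    then show ?thesis by (simp add: cnt_length length_filter_conv_card)
  qed
  obtain p where p: "\<And>a. 0 < p a" "(\<Sum>a\<in>UNIV. p a) = 1" "\<And>a. (\<Sum>b\<in>UNIV. A a b * p b) = p a"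
    using exists_perron_vector by metis
  have E: "(\<Sum>a\<in>Xr. A a b) = measure_pmf.expectation (Q b) cnt" "integrable (measure_pmf (Q b)) cnt" for b
    using expectation_count_sum[of b Xr] by (simp_all add: cnt_def[abs_def])
  have col: "(\<Sum>a\<in>Xr. A a b) \<le> 1" if "b \<in> Xr" for b
  proof -
    have "measure_pmf.expectation (Q b) cnt \<le> measure_pmf.expectation (Q b) (\<lambda>_. 1)"
      using cnt1[OF that] E(2) by (intro integral_mono_AE) (auto simp: AE_measure_pmf_iff)
    then show ?thesis by (simp add: E)
  qed
  have "(\<Sum>b\<in>Xr. p b) = (\<Sum>a\<in>Xr. \<Sum>b\<in>Xr. A a b * p b)"
    using sum_A_recurrent[of _ p] p(3) by (intro sum.cong) auto
  also have "\<dots> = (\<Sum>b\<in>Xr. (\<Sum>a\<in>Xr. A a b) * p b)" unfolding sum_distrib_right by (rule sum.swap)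
  finally have "(\<Sum>b\<in>Xr. (1 - (\<Sum>a\<in>Xr. A a b)) * p b) = 0"
    by (simp add: left_diff_distrib sum_subtractf)
  then have "(1 - (\<Sum>a\<in>Xr. A a b)) * p b = 0" if "b \<in> Xr" for b
    using that p(1) col by (subst (asm) sum_nonneg_eq_0_iff) (auto simp: less_imp_le)
  then have col1: "measure_pmf.expectation (Q b) cnt = 1" if "b \<in> Xr" for b
  proof -
    have "1 - (\<Sum>a\<in>Xr. A a b) = 0"
      using \<open>\<And>b. b \<in> Xr \<Longrightarrow> (1 - (\<Sum>a\<in>Xr. A a b)) * p b = 0\<close>[OF that] p(1)[of b] by simp
    then show ?thesis using E(1)[of b] by linarith
  qed
  \<comment> \<open>A variable bounded by 1 with mean 1 equals 1 on the whole support.\<close>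
  have one: "cnt c = 1" if b: "b \<in> Xr" and c: "c \<in> set_pmf (Q b)" for b c
  proof -
    have "measure_pmf.expectation (Q b) (\<lambda>c. 1 - cnt c) = 0" using col1[OF b] E(2)[of b] by simp
    then have "AE c in measure_pmf (Q b). 1 - cnt c = 0"
      using cnt1[OF b] E(2)[of b]
      by (subst (asm) integral_nonneg_eq_0_iff_AE) (auto simp: AE_measure_pmf_iff)
    then show ?thesis using c by (simp add: AE_measure_pmf_iff)
  qed
  have "\<not> pos_mset Q (tree_cnt t)" if "root_type t \<in> Xr" for t
    using that
  proof (induction t)
    case (GNode b ts)
    show ?case
    proof
      assume pos: "pos_mset Q (tree_cnt (GNode b ts))"
      then have "cnt (map root_type ts) = 1" using one[of b] GNode.prems unfolding pos_tree_GNode by auto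
      then have "filter (\<lambda>a. a \<in> Xr) (map root_type ts) \<noteq> []"
        unfolding cnt_length by (metis list.size(3) of_nat_0 zero_neq_one)
      then obtain s where "s \<in> set ts" "root_type s \<in> Xr" by (auto simp: filter_empty_conv)
      then show False using GNode.IH pos unfolding pos_tree_GNode by blast
    qed
  qed
  then show False using assms by blast
qed

lemma hole1_reach:
  assumes \<tau>: "\<And>a. root_type (\<tau> a) = a" "\<And>a. pos_mset Q (tree_cnt (\<tau> a))" and "(b, a) \<in> E\<^sup>*"
  shows "\<exists>C. hole1 Q b a C"
  using assms(3)
proof (induction rule: rtrancl_induct)
  case base show ?case by (rule exI[of _ "{#}"], rule hole1_refl)
next
  case (step d e)
  then obtain c where "c \<in> set_pmf (Q d)" "e \<in> set c" by (auto simp: type_edges_def)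
  then obtain D where "hole1 Q d e D" using hole1_step[OF \<tau>, of c d] by (metis in_set_conv_nth)
  moreover obtain C where "hole1 Q b d C" using step.IH by (elim exE)
  ultimately have "hole1 Q b e (C + D)" by (intro hole1_trans)
  then show ?case by (rule exI)
qed

text \<open>From \<open>b\<close> a path leads to a branching recurrent type; one recurrent child is
  continued to the arbitrary type \<open>a\<close>, the other back to \<open>b\<close>. The return
  to \<open>b\<close> lets frames be stacked and makes root and leaf cancel in the balance.\<close>

lemma exists_hole2:
  assumes \<tau>: "\<And>a. root_type (\<tau> a) = a" "\<And>a. pos_mset Q (tree_cnt (\<tau> a))" and b: "b \<in> Xr"
  shows "\<exists>C. hole2 Q b a b C"
proof -
  obtain b0 c i j where c: "b0 \<in> Xr" "c \<in> set_pmf (Q b0)" "i < length c" "j < length c" "i \<noteq> j"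
    "c ! i \<in> Xr" "c ! j \<in> Xr"
    using exists_branching[OF b \<tau>(1) \<tau>(2)] by metis
  obtain C where "hole2 Q b0 (c ! i) (c ! j) C" using hole2_step[OF \<tau> c(2-5)] by (elim exE)
  moreover have reach: "\<exists>D. hole1 Q d e D" if "d \<in> Xr" for d e
    by (rule hole1_reach[OF \<tau>]) (rule trancl_into_rtrancl[OF recurrent_reach[OF that]])
  from reach[OF b, of b0] reach[OF c(6), of a] reach[OF c(7), of b]
  obtain D1 D2 D3 where "hole1 Q b b0 D1" "hole1 Q (c ! i) a D2" "hole1 Q (c ! j) b D3"
    by (elim exE)
  ultimately have "hole2 Q b a b (D1 + (C + D2 + D3))"
    by (intro hole1_hole2[of Q b b0 D1] hole2_hole1[of Q b0 "c ! i" "c ! j"])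
  then show ?thesis by (rule exI)
qed

end

section \<open>Approximation by finitely supported measures\<close>

lemma exists_pmf_finite_support:
  fixes w :: "'b \<Rightarrow> real"
  assumes nn: "\<And>x. 0 \<le> w x" and G: "finite G" "\<And>x. x \<notin> G \<Longrightarrow> w x = 0" and one: "sum w G = 1"
  shows "\<exists>p. \<forall>x. pmf p x = w x"
proof -
  have "(\<integral>\<^sup>+x. ennreal (w x) \<partial>count_space UNIV) = (\<Sum>x\<in>G. ennreal (w x))"
    using G by (intro nn_integral_count_space') auto
  also have "\<dots> = 1" using nn one by (simp add: sum_ennreal)
  finally show ?thesis using pmf_embed_pmf[of w] nn by blast
qed

text \<open>Replacing \<open>f\<close> by 0 outside \<open>F\<close> adds at most \<open>s\<close>
  to its exponential mean, so the truncation is a tilt after subtracting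
  \<open>ln (1 + s)\<close>.\<close>

lemma sum_truncated_tilt_le:
  fixes Q :: "'a::finite \<Rightarrow> 'a list pmf"
  assumes \<nu>: "\<And>f. f \<in> tilts Q \<Longrightarrow> measure_pmf.expectation \<nu> f \<le> J"
    and f: "f \<in> tilts Q" and F: "finite F" and s: "\<And>a. measure (Q a) {c. (a, c) \<notin> F} \<le> s"
  shows "(\<Sum>x\<in>F. pmf \<nu> x * f x) \<le> J + s"
proof -
  have bf: "bounded (range f)" using f by (simp add: tilts_def)
  have s0: "0 \<le> s" using s[of undefined] by (meson measure_nonneg order_trans)
  define g where "g x = indicator F x * f x" for x
  obtain B where B: "\<And>x. \<bar>f x\<bar> \<le> B" using bf by (auto simp: bounded_iff)
  have bg: "bounded (range g)"
  proof (rule boundedI)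
    fix y assume "y \<in> range g"
    then obtain x where "y = g x" by blast
    then show "norm y \<le> \<bar>B\<bar>" using B[of x] by (cases "x \<in> F") (auto simp: g_def)
  qed
  have "measure_pmf.expectation (Q a) (\<lambda>c. exp (g (a, c) - ln (1 + s))) \<le> 1" for a
  proof -
    let ?C = "{c. (a, c) \<notin> F}"
    have i: "integrable (measure_pmf (Q a)) (\<lambda>c. exp (f (a, c)))"
      by (rule integrable_bounded_pmf[OF bounded_range_compose(2)[OF bf]])
    have "measure_pmf.expectation (Q a) (\<lambda>c. exp (g (a, c)))
        \<le> measure_pmf.expectation (Q a) (\<lambda>c. exp (f (a, c)) + indicator ?C c)"
    proof (rule integral_mono)
      show "integrable (measure_pmf (Q a)) (\<lambda>c. exp (g (a, c)))"
        by (rule integrable_bounded_pmf[OF bounded_range_compose(2)[OF bg]])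
      show "integrable (measure_pmf (Q a)) (\<lambda>c. exp (f (a, c)) + indicator ?C c)"
        by (intro Bochner_Integration.integrable_add i integrable_indicator_pmf)
    qed (auto simp: g_def indicator_def)
    also have "\<dots> = measure_pmf.expectation (Q a) (\<lambda>c. exp (f (a, c))) + measure (Q a) ?C"
      using i by simp
    also have "\<dots> \<le> 1 + s" using f s[of a] by (intro add_mono) (auto simp: tilts_def)
    finally show ?thesis using s0 by (simp add: exp_diff)
  qed
  then have "(\<lambda>x. g x - ln (1 + s)) \<in> tilts Q"
    using bg by (auto simp: tilts_def intro: bounded_minus_comp)
  from \<nu>[OF this] have "measure_pmf.expectation \<nu> g \<le> J + ln (1 + s)"
    using integrable_bounded_pmf[OF bg, of \<nu>] by simp
  also have "ln (1 + s) \<le> s" using s0 by (rule ln_add_one_self_le_self)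
  also have "measure_pmf.expectation \<nu> g = (\<Sum>x\<in>F. pmf \<nu> x * f x)"
    by (subst integral_measure_pmf[OF F]) (auto simp: g_def indicator_def)
  finally show ?thesis by simp
qed

text \<open>One term of a sum that is at most 1. The bound does not depend on \<open>f\<close>, so a
  few added vertices raise the supremum over all tilts by a controlled amount.\<close>

lemma tilt_le_minus_ln:
  assumes f: "f \<in> tilts Q" and pos: "0 < offspring_prob Q x"
  shows "f x \<le> - ln (offspring_prob Q x)"
proof -
  obtain a c where x: "x = (a, c)" by (cases x)
  have bf: "bounded (range f)" using f by (simp add: tilts_def)
  have i: "integrable (measure_pmf (Q a)) (\<lambda>c. exp (f (a, c)))"
    by (rule integrable_bounded_pmf[OF bounded_range_compose(2)[OF bf]])
  have "pmf (Q a) c * exp (f (a, c)) = measure_pmf.expectation (Q a) (\<lambda>d. indicator {c} d * exp (f (a, d)))"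
    by (subst integral_measure_pmf[of "{c}"]) (auto simp: indicator_def)
  also have "\<dots> \<le> measure_pmf.expectation (Q a) (\<lambda>d. exp (f (a, d)))"
    using integrable_real_mult_indicator[OF _ i, of "{c}"]
    by (intro integral_mono i) (auto simp: indicator_def mult.commute)
  also have "\<dots> \<le> 1" using f by (simp add: tilts_def)
  finally have "exp (f x) \<le> 1 / pmf (Q a) c" using pos by (simp add: x field_simps)
  then have "f x \<le> ln (1 / pmf (Q a) c)" using pos by (simp add: x ln_ge_iff)
  then show ?thesis using pos by (simp add: x ln_div)
qed

lemma sum_mset_tilt_le:
  assumes "f \<in> tilts Q" "pos_mset Q C"
  shows "(\<Sum>x\<in>#C. f x) \<le> (\<Sum>x\<in>#C. - ln (offspring_prob Q x))"
  using assms(2)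
proof (induction C)
  case (add x C)
  then show ?case using tilt_le_minus_ln[OF assms(1), of x]
    by (auto simp: pos_mset_def intro!: add_mono)
qed simp

lemma sum_count_superset:
  assumes "finite G" "set_mset C \<subseteq> G"
  shows "(\<Sum>x\<in>G. real (count C x) * f x) = (\<Sum>x\<in>#C. f x)"
proof -
  have "(\<Sum>x\<in>G. real (count C x) * f x) = (\<Sum>x\<in>set_mset C. real (count C x) * f x)"
    using assms by (intro sum.mono_neutral_right) (auto simp: not_in_iff)
  then show ?thesis by (simp add: sum_count_mset)
qed

text \<open>\<open>t0\<close> rules out critical kernels under which recurrent lines of descent
  never end, for instance exactly one child at every vertex. It comes from a size in
  \<open>S\<close> beyond the sizes of trees with transient roots.\<close>

locale surviving_types = recurrent_types +
  fixes t0 :: "'a gtree"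
  assumes t0: "root_type t0 \<in> Xr" "pos_mset Q (tree_cnt t0)"
begin

definition \<tau> :: "'a \<Rightarrow> 'a gtree" where
  "\<tau> a = (SOME t. root_type t = a \<and> pos_mset Q (tree_cnt t))"

lemma root_\<tau>: "root_type (\<tau> a) = a" and pos_\<tau>: "pos_mset Q (tree_cnt (\<tau> a))"
  using someI_ex[OF exists_finite_trees[OF t0(1) refl t0(2), of a]] by (auto simp: \<tau>_def)

definition hole :: "'a \<Rightarrow> 'a \<Rightarrow> ('a \<times> 'a list) multiset" where
  "hole b a = (SOME C. hole2 Q b a b C)"

lemma hole2_hole: "b \<in> Xr \<Longrightarrow> hole2 Q b a b (hole b a)"
  unfolding hole_def by (rule someI_ex) (rule exists_hole2[OF root_\<tau> pos_\<tau>])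

text \<open>Charging these vertices gives every type positive mass, keeps a finite tree with each
  root type possible under the conditional kernel, and lets every recurrent type reach all
  types.\<close>

definition rich :: "('a \<times> 'a list) set \<Rightarrow> bool" where
  "rich W \<longleftrightarrow> (\<forall>a. set_mset (tree_cnt (\<tau> a)) \<subseteq> W) \<and> (\<forall>b\<in>Xr. \<forall>a. set_mset (hole b a) \<subseteq> W)"

definition hole_sum :: "('a \<times> 'a list \<Rightarrow> real) \<Rightarrow> real" where
  "hole_sum f = (\<Sum>b\<in>Xr. \<Sum>a\<in>UNIV. \<Sum>x\<in>#hole b a. f x)"

text \<open>In \<open>hole b a\<close> the root and the leaf of type \<open>b\<close> cancel, and a
  deficit of one at \<open>a\<close> remains. Summing over all \<open>a\<close> and all recurrent
  \<open>b\<close> gives the same deficit in every type.\<close>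

lemma hole_sum_excess: "hole_sum (excess e) = - real (card Xr)"
proof -
  have "(\<Sum>x\<in>#hole b a. excess e x) = - indicator {a} e" if "b \<in> Xr" for a b
  proof -
    have "\<exists>t :: 'a gtree. root_type t = a" for a using root_\<tau> by blast
    from sum_mset_excess_hole2[OF hole2_hole[OF that, of a] this, of e] show ?thesis by simp
  qed
  then have "hole_sum (excess e) = (\<Sum>b\<in>Xr. \<Sum>a\<in>UNIV. - indicator {a} e)"
    unfolding hole_sum_def by (intro sum.cong refl)
  also have "(\<Sum>a\<in>UNIV. - indicator {a} e :: real) = - 1"
    by (simp add: sum_negf indicator_def if_distrib cong: if_cong)
  finally show ?thesis by simp
qed

text \<open>A truncation of \<nu>, plus \<open>d\<close> copies of every frame, plus
  \<open>t a\<close> copies of the complete trees \<open>\<tau> a\<close>, not yet normalised.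
  Frames lower all balances and \<open>\<tau> a\<close> raises only that of \<open>a\<close>, so
  suitable positive amounts \<open>t a\<close> balance every type.\<close>

definition mixed_weight :: "('a \<times> 'a list) pmf \<Rightarrow> real \<Rightarrow> nat \<Rightarrow> ('a \<Rightarrow> real) \<Rightarrow> 'a \<times> 'a list \<Rightarrow> real" where
  "mixed_weight \<nu> d k t x = (1 - d) * (if to_nat x < k then pmf \<nu> x else 0)
     + d * (\<Sum>b\<in>Xr. \<Sum>a\<in>UNIV. real (count (hole b a) x))
     + (\<Sum>a\<in>UNIV. t a * real (count (tree_cnt (\<tau> a)) x))"

definition mixed_support :: "nat \<Rightarrow> ('a \<times> 'a list) set" where
  "mixed_support k = {x. to_nat x < k} \<union> (\<Union>b\<in>Xr. \<Union>a. set_mset (hole b a)) \<union> (\<Union>a. set_mset (tree_cnt (\<tau> a)))"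

lemma finite_mixed_support: "finite (mixed_support k)"
  by (simp add: mixed_support_def)

lemma mixed_weight_outside: "x \<notin> mixed_support k \<Longrightarrow> mixed_weight \<nu> d k t x = 0"
  by (auto simp: mixed_support_def mixed_weight_def not_in_iff)

definition mixed_sum :: "('a \<times> 'a list) pmf \<Rightarrow> real \<Rightarrow> nat \<Rightarrow> ('a \<Rightarrow> real) \<Rightarrow> ('a \<times> 'a list \<Rightarrow> real) \<Rightarrow> real" where
  "mixed_sum \<nu> d k t f = (1 - d) * (\<Sum>x | to_nat x < k. pmf \<nu> x * f x) + d * hole_sum f
     + (\<Sum>a\<in>UNIV. t a * (\<Sum>x\<in>#tree_cnt (\<tau> a). f x))"

lemma sum_mixed_weight:
  "(\<Sum>x\<in>mixed_support k. mixed_weight \<nu> d k t x * f x) = mixed_sum \<nu> d k t f"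
proof -
  let ?G = "mixed_support k"
  have fin: "finite ?G" by (rule finite_mixed_support)
  have "(\<Sum>x\<in>?G. mixed_weight \<nu> d k t x * f x)
      = (1 - d) * (\<Sum>x\<in>?G. (if to_nat x < k then pmf \<nu> x else 0) * f x)
        + d * (\<Sum>x\<in>?G. (\<Sum>b\<in>Xr. \<Sum>a\<in>UNIV. real (count (hole b a) x) * f x))
        + (\<Sum>x\<in>?G. (\<Sum>a\<in>UNIV. t a * (real (count (tree_cnt (\<tau> a)) x) * f x)))"
    by (simp add: mixed_weight_def distrib_right sum.distrib sum_distrib_left sum_distrib_right mult.assoc)
  also have "(\<Sum>x\<in>?G. (if to_nat x < k then pmf \<nu> x else 0) * f x) = (\<Sum>x | to_nat x < k. pmf \<nu> x * f x)"
    using fin by (intro sum.mono_neutral_cong_right) (auto simp: mixed_support_def)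
  also have "(\<Sum>x\<in>?G. (\<Sum>b\<in>Xr. \<Sum>a\<in>UNIV. real (count (hole b a) x) * f x)) = hole_sum f"
  proof -
    have "(\<Sum>x\<in>?G. (\<Sum>b\<in>Xr. \<Sum>a\<in>UNIV. real (count (hole b a) x) * f x))
        = (\<Sum>b\<in>Xr. \<Sum>x\<in>?G. \<Sum>a\<in>UNIV. real (count (hole b a) x) * f x)" by (rule sum.swap)
    also have "\<dots> = (\<Sum>b\<in>Xr. \<Sum>a\<in>UNIV. \<Sum>x\<in>?G. real (count (hole b a) x) * f x)"
      by (intro sum.cong refl sum.swap)
    also have "\<dots> = hole_sum f"
      unfolding hole_sum_def
      by (intro sum.cong refl sum_count_superset fin) (auto simp: mixed_support_def)
    finally show ?thesis .
  qed
  also have "(\<Sum>x\<in>?G. (\<Sum>a\<in>UNIV. t a * (real (count (tree_cnt (\<tau> a)) x) * f x)))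
      = (\<Sum>a\<in>UNIV. t a * (\<Sum>x\<in>#tree_cnt (\<tau> a). f x))"
  proof -
    have "(\<Sum>x\<in>?G. (\<Sum>a\<in>UNIV. t a * (real (count (tree_cnt (\<tau> a)) x) * f x)))
      = (\<Sum>a\<in>UNIV. \<Sum>x\<in>?G. t a * (real (count (tree_cnt (\<tau> a)) x) * f x))" by (rule sum.swap)
    also have "\<dots> = (\<Sum>a\<in>UNIV. t a * (\<Sum>x\<in>#tree_cnt (\<tau> a). f x))"
      unfolding sum_distrib_left[symmetric]
      by (intro sum.cong refl arg_cong2[where f = "(*)"] sum_count_superset fin) (auto simp: mixed_support_def)
    finally show ?thesis .
  qed
  finally show ?thesis by (simp add: mixed_sum_def)
qed

lemma exists_mixed_pmf:
  assumes d: "0 < d" "d < 1" and t: "\<And>a. 0 < t a"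
  shows "0 < mixed_sum \<nu> d k t (\<lambda>_. 1)"
    "\<exists>\<nu>'. (\<forall>f. measure_pmf.expectation \<nu>' f = mixed_sum \<nu> d k t f / mixed_sum \<nu> d k t (\<lambda>_. 1)) \<and>
       finite (set_pmf \<nu>') \<and> rich (set_pmf \<nu>')"
proof -
  let ?w = "mixed_weight \<nu> d k t" and ?G = "mixed_support k" and ?m = "mixed_sum \<nu> d k t (\<lambda>_. 1)"
  have w0: "0 \<le> ?w x" for x
    using d t by (auto simp: mixed_weight_def less_imp_le intro!: add_nonneg_nonneg mult_nonneg_nonneg sum_nonneg)
  have wt: "0 < ?w x" if "x \<in># tree_cnt (\<tau> a)" for x a
  proof -
    have "0 < t a * real (count (tree_cnt (\<tau> a)) x)" using t that by simp
    also have "\<dots> \<le> (\<Sum>a\<in>UNIV. t a * real (count (tree_cnt (\<tau> a)) x))"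
      using t by (intro member_le_sum) (auto simp: less_imp_le)
    also have "\<dots> \<le> ?w x"
      unfolding mixed_weight_def using d by (auto intro!: add_nonneg_nonneg mult_nonneg_nonneg sum_nonneg)
    finally show ?thesis .
  qed
  have wh: "0 < ?w x" if "b \<in> Xr" "x \<in># hole b a" for x a b
  proof -
    have "0 < d * real (count (hole b a) x)" using d that by simp
    also have "\<dots> \<le> d * (\<Sum>b\<in>Xr. \<Sum>a\<in>UNIV. real (count (hole b a) x))"
    proof (intro mult_left_mono)
      have "real (count (hole b a) x) \<le> (\<Sum>a\<in>UNIV. real (count (hole b a) x))"
        by (intro member_le_sum) auto
      also have "\<dots> \<le> (\<Sum>b\<in>Xr. \<Sum>a\<in>UNIV. real (count (hole b a) x))"
        using that(1) by (intro member_le_sum[where f = "\<lambda>b. \<Sum>a\<in>UNIV. real (count (hole b a) x)"]) (auto intro: sum_nonneg)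
      finally show "real (count (hole b a) x) \<le> (\<Sum>b\<in>Xr. \<Sum>a\<in>UNIV. real (count (hole b a) x))" .
    qed (use d in simp)
    also have "\<dots> \<le> ?w x"
      unfolding mixed_weight_def using d t by (auto simp: less_imp_le intro!: add_nonneg_nonneg mult_nonneg_nonneg sum_nonneg)
    finally show ?thesis .
  qed
  have m: "sum ?w ?G = ?m" using sum_mixed_weight[of \<nu> d k t "\<lambda>_. 1"] by simp
  obtain x0 where x0: "x0 \<in># tree_cnt (\<tau> undefined)" using tree_cnt_nonempty multiset_nonemptyE by blast
  then have "x0 \<in> ?G" by (auto simp: mixed_support_def)
  then have "?w x0 \<le> sum ?w ?G" using w0 by (intro member_le_sum finite_mixed_support) auto
  then show pos: "0 < ?m" using wt[OF x0] m by simp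
  have "sum (\<lambda>x. ?w x / ?m) ?G = 1" using m pos by (simp add: sum_divide_distrib[symmetric])
  then obtain \<nu>' where \<nu>': "\<And>x. pmf \<nu>' x = ?w x / ?m"
    using exists_pmf_finite_support[of "\<lambda>x. ?w x / ?m" ?G] w0 pos finite_mixed_support mixed_weight_outside
    by (auto simp: less_imp_le)
  have sup: "set_pmf \<nu>' \<subseteq> ?G"
  proof
    fix x assume "x \<in> set_pmf \<nu>'"
    then have "?w x \<noteq> 0" by (simp add: set_pmf_iff \<nu>')
    then show "x \<in> ?G" using mixed_weight_outside by blast
  qed
  have "measure_pmf.expectation \<nu>' f = mixed_sum \<nu> d k t f / ?m" for f
  proof -
    have "measure_pmf.expectation \<nu>' f = (\<Sum>x\<in>?G. pmf \<nu>' x * f x)"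
      using sup by (subst integral_measure_pmf[OF finite_mixed_support[of k]]) auto
    then show ?thesis by (simp add: \<nu>' sum_divide_distrib[symmetric] sum_mixed_weight)
  qed
  moreover have "rich (set_pmf \<nu>')"
    unfolding rich_def using wt wh pos by (fastforce simp: set_pmf_iff \<nu>')
  ultimately show "\<exists>\<nu>'. (\<forall>f. measure_pmf.expectation \<nu>' f = mixed_sum \<nu> d k t f / ?m) \<and>
       finite (set_pmf \<nu>') \<and> rich (set_pmf \<nu>')"
    using finite_subset[OF sup finite_mixed_support] by blast
qed

lemma mixed_sum_tilt_le:
  assumes \<nu>: "\<And>f. f \<in> tilts Q \<Longrightarrow> measure_pmf.expectation \<nu> f \<le> J"
    and f: "f \<in> tilts Q" and d: "0 < d" "d < 1" and t: "\<And>a. 0 < t a"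
    and s: "\<And>a. measure (Q a) {c. \<not> to_nat (a, c) < k} \<le> s"
  shows "mixed_sum \<nu> d k t f \<le> (1 - d) * (J + s) + d * hole_sum (\<lambda>x. - ln (offspring_prob Q x))
     + (\<Sum>a\<in>UNIV. t a * (\<Sum>x\<in>#tree_cnt (\<tau> a). - ln (offspring_prob Q x)))"
proof -
  have "(\<Sum>x | to_nat x < k. pmf \<nu> x * f x) \<le> J + s"
    using s by (intro sum_truncated_tilt_le[OF \<nu> f]) auto
  moreover have "hole_sum f \<le> hole_sum (\<lambda>x. - ln (offspring_prob Q x))"
    unfolding hole_sum_def using hole2_hole
    by (intro sum_mono sum_mset_tilt_le[OF f]) (auto simp: hole2_def)
  moreover have "(\<Sum>a\<in>UNIV. t a * (\<Sum>x\<in>#tree_cnt (\<tau> a). f x))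
      \<le> (\<Sum>a\<in>UNIV. t a * (\<Sum>x\<in>#tree_cnt (\<tau> a). - ln (offspring_prob Q x)))"
    using t by (intro sum_mono mult_left_mono sum_mset_tilt_le[OF f] pos_\<tau>) (auto simp: less_imp_le)
  ultimately show ?thesis
    unfolding mixed_sum_def using d by (intro add_mono mult_left_mono) auto
qed

text \<open>Truncating \<nu> upsets the balances by small amounts of unknown sign. Frames in
  proportion \<open>d j\<close> make all balances strictly negative, and trees in small positive
  amounts \<open>t j e\<close> cancel them exactly. What is added alters test integrals by a
  vanishing amount and raises integrals of tilts by at most a vanishing amount, uniformly over the
  tilts.\<close>

lemma exists_rich_approximation:
  assumes \<nu>M: "\<nu> \<in> offspring_measures" and J: "offspring_rate Q \<nu> \<le> ereal J"
    and \<Phi>: "finite \<Phi>" "\<Phi> \<subseteq> offspring_test_functions" and \<epsilon>: "0 < \<epsilon>"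
  shows "\<exists>\<nu>'. finite (set_pmf \<nu>') \<and> rich (set_pmf \<nu>') \<and> offspring_rate Q \<nu>' \<le> ereal (J + \<epsilon>) \<and> near \<Phi> \<epsilon> \<nu> \<nu>'"
proof -
  have ex0: "measure_pmf.expectation \<nu> (excess e) = 0" for e
    using J unfolding offspring_rate_le_iff[OF \<nu>M] by auto
  have tl: "measure_pmf.expectation \<nu> f \<le> J" if "f \<in> tilts Q" for f
    using J that unfolding offspring_rate_le_iff[OF \<nu>M] by auto
  define d where "d j = 1 / (real j + 2)" for j
  have d: "0 < d j" "d j < 1" for j by (auto simp: d_def)
  have d_lim: "d \<longlonglongrightarrow> 0" 
    unfolding d_def using LIMSEQ_ignore_initial_segment[OF lim_1_over_n, of 2] by (simp add: add.commute)
  \<comment> \<open>The cut is chosen after \<open>d j\<close>, so late that the imbalance stays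
    below half of \<open>d j\<close>. It also tends to infinity with \<open>j\<close>, and it keeps
    the loss in truncating a tilt below \<open>d j\<close>.\<close>
  have "\<forall>j. \<exists>k. j \<le> k \<and> (\<forall>e. \<bar>\<Sum>x | to_nat x < k. pmf \<nu> x * excess e x\<bar> < d j / 2) \<and>
      (\<forall>a. measure (Q a) {c. \<not> to_nat (a, c) < k} < d j)" (is "\<forall>j. ?P j")
  proof
    fix j
    have "\<forall>\<^sub>F k in sequentially. \<forall>e\<in>UNIV. \<bar>\<Sum>x | to_nat x < k. pmf \<nu> x * excess e x\<bar> < d j / 2"
    proof (intro eventually_ball_finite ballI)
      fix e
      have "(\<lambda>k. \<bar>\<Sum>x | to_nat x < k. pmf \<nu> x * excess e x\<bar>) \<longlonglongrightarrow> \<bar>measure_pmf.expectation \<nu> (excess e)\<bar>"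
        by (intro tendsto_rabs expectation_LIMSEQ expectation_excess(1)[OF \<nu>M])
      then show "\<forall>\<^sub>F k in sequentially. \<bar>\<Sum>x | to_nat x < k. pmf \<nu> x * excess e x\<bar> < d j / 2"
        using d(1)[of j] by (intro order_tendstoD) (auto simp: ex0)
    qed simp
    moreover have "\<forall>\<^sub>F k in sequentially. \<forall>a\<in>UNIV. measure (Q a) {c. \<not> to_nat (a, c) < k} < d j"
    proof (intro eventually_ball_finite ballI)
      fix a :: 'a
      let ?A = "\<lambda>k. {c :: 'a list. \<not> to_nat (a, c) < k}"
      have "(\<lambda>k. measure (Q a) (?A k)) \<longlonglongrightarrow> measure (Q a) (\<Inter>k. ?A k)"
        by (intro measure_pmf.finite_Lim_measure_decseq) (auto simp: decseq_def)
      also have "(\<Inter>k. ?A k) = {}" by auto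
      finally show "\<forall>\<^sub>F k in sequentially. measure (Q a) (?A k) < d j"
        using d(1)[of j] by (intro order_tendstoD) auto
    qed simp
    ultimately have "\<forall>\<^sub>F k in sequentially. j \<le> k \<and>
        (\<forall>e. \<bar>\<Sum>x | to_nat x < k. pmf \<nu> x * excess e x\<bar> < d j / 2) \<and>
        (\<forall>a. measure (Q a) {c. \<not> to_nat (a, c) < k} < d j)"
      using eventually_ge_at_top[of j] by eventually_elim simp
    then show "?P j" by (rule eventually_happens'[OF sequentially_bot])
  qed
  from choice[OF this] obtain k where k: "\<And>j. j \<le> k j"
    "\<And>j e. \<bar>\<Sum>x | to_nat x < k j. pmf \<nu> x * excess e x\<bar> < d j / 2"
    "\<And>j a. measure (Q a) {c. \<not> to_nat (a, c) < k j} < d j" by blast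
  have k_lim: "filterlim k at_top sequentially"
    by (rule filterlim_at_top_mono[OF filterlim_ident]) (simp add: k(1))
  \<comment> \<open>The solution of the balance equation at type \<open>e\<close>; it is positive
    because the deficit from the frames, at least \<open>d j\<close>, exceeds the imbalance of the
    truncation.\<close>
  define t where "t j e = d j * real (card Xr) - (1 - d j) * (\<Sum>x | to_nat x < k j. pmf \<nu> x * excess e x)" for j e
  have card: "1 \<le> real (card Xr)"
    using types_split(3) by (simp add: Suc_le_eq card_gt_0_iff)
  have small: "\<bar>(1 - d j) * (\<Sum>x | to_nat x < k j. pmf \<nu> x * excess e x)\<bar> \<le> d j / 2" for j e
  proof -
    have "\<bar>(1 - d j) * (\<Sum>x | to_nat x < k j. pmf \<nu> x * excess e x)\<bar>
        \<le> 1 * \<bar>\<Sum>x | to_nat x < k j. pmf \<nu> x * excess e x\<bar>"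
      unfolding abs_mult using d[of j] by (intro mult_right_mono) auto
    then show ?thesis using k(2)[where j = j and e = e] by linarith
  qed
  have t: "0 < t j e" "t j e \<le> d j * (real (card Xr) + 1)" for j e
  proof -
    have "d j * 1 \<le> d j * real (card Xr)" using card d[of j] by (intro mult_left_mono) auto
    then show "0 < t j e" using small[where j = j and e = e] d(1)[of j] unfolding t_def abs_le_iff by linarith
    show "t j e \<le> d j * (real (card Xr) + 1)"
      using small[where j = j and e = e] d(1)[of j] unfolding t_def abs_le_iff distrib_left by linarith
  qed
  have t_lim: "(\<lambda>j. t j e) \<longlonglongrightarrow> 0" for e
  proof (rule tendsto_sandwich[where f = "\<lambda>_. 0" and h = "\<lambda>j. d j * (real (card Xr) + 1)"])
    show "(\<lambda>j. d j * (real (card Xr) + 1)) \<longlonglongrightarrow> 0" using tendsto_mult_left_zero[OF d_lim] .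
  qed (auto intro!: always_eventually simp: t less_imp_le)
  define S where "S j f = mixed_sum \<nu> (d j) (k j) (t j) f" for j f
  have S_lim: "(\<lambda>j. S j f) \<longlonglongrightarrow> measure_pmf.expectation \<nu> f" if "integrable (measure_pmf \<nu>) f" for f
  proof -
    have "(\<lambda>j. (1 - d j) * (\<Sum>x | to_nat x < k j. pmf \<nu> x * f x) + d j * hole_sum f
       + (\<Sum>a\<in>UNIV. t j a * (\<Sum>x\<in>#tree_cnt (\<tau> a). f x)))
      \<longlonglongrightarrow> (1 - 0) * measure_pmf.expectation \<nu> f + 0 * hole_sum f
       + (\<Sum>a\<in>UNIV. 0 * (\<Sum>x\<in>#tree_cnt (\<tau> a). f x))"
      by (intro tendsto_intros d_lim t_lim filterlim_compose[OF expectation_LIMSEQ[OF that] k_lim])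
    then show ?thesis by (simp add: S_def mixed_sum_def)
  qed
  have S1: "(\<lambda>j. S j (\<lambda>_. 1)) \<longlonglongrightarrow> 1" using S_lim[of "\<lambda>_. 1"] by simp
  have S1_pos: "0 < S j (\<lambda>_. 1)" for j unfolding S_def by (rule exists_mixed_pmf(1)[OF d t(1)])
  have "\<forall>j. \<exists>\<nu>'. (\<forall>f. measure_pmf.expectation \<nu>' f = S j f / S j (\<lambda>_. 1)) \<and> finite (set_pmf \<nu>') \<and> rich (set_pmf \<nu>')"
    unfolding S_def by (intro allI exists_mixed_pmf(2)[OF d t(1)])
  from choice[OF this]
  obtain N where N: "\<And>j f. measure_pmf.expectation (N j) f = S j f / S j (\<lambda>_. 1)"
    "\<And>j. finite (set_pmf (N j))" "\<And>j. rich (set_pmf (N j))" by blast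
  have N_lim: "(\<lambda>j. measure_pmf.expectation (N j) f) \<longlonglongrightarrow> measure_pmf.expectation \<nu> f"
    if "integrable (measure_pmf \<nu>) f" for f :: "'a \<times> 'a list \<Rightarrow> real"
    using tendsto_divide[OF S_lim[OF that] S1] by (simp add: N(1))
  define c where "c x = - ln (offspring_prob Q x)" for x
  \<comment> \<open>A bound for all tilts at once, since the added vertices are estimated by minus
    the logarithms of their probabilities; it tends to \<open>J\<close>.\<close>
  define R where "R j = ((1 - d j) * (J + d j) + d j * hole_sum c + (\<Sum>a\<in>UNIV. t j a * (\<Sum>x\<in>#tree_cnt (\<tau> a). c x))) / S j (\<lambda>_. 1)" for j
  have "R \<longlonglongrightarrow> ((1 - 0) * (J + 0) + 0 * hole_sum c + (\<Sum>a\<in>UNIV. 0 * (\<Sum>x\<in>#tree_cnt (\<tau> a). c x))) / 1"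
    unfolding R_def by (intro tendsto_intros d_lim t_lim S1) simp
  then have "\<forall>\<^sub>F j in sequentially. R j < J + \<epsilon>" using \<epsilon> by (intro order_tendstoD) auto
  moreover have "\<forall>\<^sub>F j in sequentially. \<forall>f\<in>\<Phi>. \<bar>measure_pmf.expectation (N j) f - measure_pmf.expectation \<nu> f\<bar> < \<epsilon>"
  proof (intro eventually_ball_finite ballI \<Phi>(1))
    fix f assume "f \<in> \<Phi>"
    then have "f \<in> offspring_test_functions" using \<Phi>(2) by (rule subsetD[rotated])
    from test_function_growth[OF this] obtain C where "\<forall>x. \<bar>f x\<bar> \<le> C * (1 + real (length (snd x)))"
      by (elim exE conjE)
    then have "integrable (measure_pmf \<nu>) f" by (intro integrable_linear_growth[OF \<nu>M]) (rule spec)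
    from N_lim[OF this] have "\<forall>\<^sub>F j in sequentially. dist (measure_pmf.expectation (N j) f) (measure_pmf.expectation \<nu> f) < \<epsilon>"
      using \<epsilon> by (rule tendstoD)
    then show "\<forall>\<^sub>F j in sequentially. \<bar>measure_pmf.expectation (N j) f - measure_pmf.expectation \<nu> f\<bar> < \<epsilon>"
      by (simp add: dist_real_def)
  qed
  ultimately have "\<forall>\<^sub>F j in sequentially. R j < J + \<epsilon> \<and> near \<Phi> \<epsilon> \<nu> (N j)"
    unfolding near_def by (rule eventually_conj)
  from eventually_happens'[OF sequentially_bot this]
  obtain j where j: "R j < J + \<epsilon>" "near \<Phi> \<epsilon> \<nu> (N j)" by (elim exE conjE)
  have "offspring_rate Q (N j) \<le> ereal (R j)"
    unfolding offspring_rate_le_iff[OF finite_set_pmf_offspring_measures[OF N(2)]]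
  proof (intro conjI allI ballI)
    fix e
    have "(\<Sum>a\<in>UNIV. t j a * (\<Sum>x\<in>#tree_cnt (\<tau> a). excess e x)) = (\<Sum>a\<in>UNIV. if a = e then t j a else 0)"
      by (intro sum.cong) (auto simp: sum_mset_excess_tree root_\<tau> indicator_def)
    also have "\<dots> = t j e" by simp
    finally have "S j (excess e) = 0"
      unfolding S_def mixed_sum_def hole_sum_excess by (simp add: t_def)
    then show "measure_pmf.expectation (N j) (excess e) = 0" by (simp add: N(1))
  next
    fix f assume f: "f \<in> tilts Q"
    have "S j f \<le> (1 - d j) * (J + d j) + d j * hole_sum c + (\<Sum>a\<in>UNIV. t j a * (\<Sum>x\<in>#tree_cnt (\<tau> a). c x))"
      unfolding S_def c_def using k(3) by (intro mixed_sum_tilt_le[OF tl f d t(1)]) (auto simp: less_imp_le)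
    then show "measure_pmf.expectation (N j) f \<le> R j"
      unfolding N(1) R_def using S1_pos[of j] by (intro divide_right_mono) auto
  qed
  also have "ereal (R j) \<le> ereal (J + \<epsilon>)" using j(1) by simp
  finally show ?thesis using N(2,3) j(2) by (intro exI[of _ "N j"] conjI)
qed

text \<open>The Perron vector is an invariant type law, so P \<otimes> Q is shift-invariant. Its
  entropy relative to itself vanishes: for a tilt the mean of \<open>f\<close> is at most that of
  \<open>exp f - 1\<close>, which is at most 0.\<close>

lemma exists_zero_of_rate: "\<exists>\<nu>\<in>offspring_measures. offspring_rate Q \<nu> \<le> ereal 0"
proof -
  obtain p where p: "\<And>a. 0 < p a" "(\<Sum>a\<in>UNIV. p a) = 1" "\<And>a. (\<Sum>b\<in>UNIV. A a b * p b) = p a"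
    using exists_perron_vector by metis
  obtain P where P: "\<And>a. pmf P a = p a"
    using exists_pmf_finite_support[of p UNIV] p by (auto simp: less_imp_le)
  define \<nu> where "\<nu> = kernel_product P Q"
  have cnt: "integrable (measure_pmf \<nu>) (\<lambda>x. real (count_list (snd x) a))"
    "measure_pmf.expectation \<nu> (\<lambda>x. real (count_list (snd x) a)) = p a" for a
    using expectation_kernel_product[where f = "\<lambda>x. real (count_list (snd x) a)" and Q = Q and \<mu> = P]
      integrable_count_kernel[OF exp_moments] p(3)[of a]
    by (simp_all add: \<nu>_def P mean_matrix_def mult.commute)
  have len: "(\<lambda>x :: 'a \<times> 'a list. real (length (snd x))) = (\<lambda>x. \<Sum>a\<in>UNIV. real (count_list (snd x) a))"
    by (rule ext) (metis finite of_nat_sum subset_UNIV sum_count_set)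
  have "integrable (measure_pmf \<nu>) (\<lambda>x. real (length (snd x)))"
    unfolding len using cnt(1) by simp
  then have \<nu>M: "\<nu> \<in> offspring_measures"
    by (auto simp: offspring_measures_def case_prod_unfold integrable_iff_bounded)
  have marg: "type_marginal \<nu> = P"
    by (simp add: type_marginal_def \<nu>_def kernel_product_def map_bind_pmf pmf.map_comp o_def bind_return_pmf')
  have "offspring_rate Q \<nu> \<le> ereal 0"
    unfolding offspring_rate_le_iff[OF \<nu>M]
  proof (intro conjI allI ballI)
    fix a show "measure_pmf.expectation \<nu> (excess a) = 0"
      unfolding expectation_excess(2)[OF \<nu>M] using cnt(2)[of a] by (simp add: marg P case_prod_unfold)
  next
    fix f assume f: "f \<in> tilts Q"
    then have bf: "bounded (range f)" by (simp add: tilts_def)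
    have i: "integrable (measure_pmf \<nu>) (\<lambda>x. exp (f x))"
      using integrable_bounded_pmf[OF bounded_range_compose(2)[OF bf, of "\<lambda>x. x"]] .
    have "measure_pmf.expectation \<nu> f \<le> measure_pmf.expectation \<nu> (\<lambda>x. exp (f x) - 1)"
    proof (rule integral_mono)
      show "f x \<le> exp (f x) - 1" for x using exp_ge_add_one_self[of "f x"] by linarith
    qed (use i in \<open>auto intro: integrable_bounded_pmf[OF bf]\<close>)
    also have "\<dots> = measure_pmf.expectation \<nu> (\<lambda>x. exp (f x)) - 1" using i by simp
    also have "\<dots> \<le> 0" using expectation_exp_tilt_le[OF f, of P] by (simp add: \<nu>_def)
    finally show "measure_pmf.expectation \<nu> f \<le> 0" .
  qed
  then show ?thesis using \<nu>M by blast
qed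

end

section \<open>The conditional kernel of a finitely supported measure\<close>

locale conditional_kernel = surviving_types +
  fixes \<nu> :: "('a \<times> 'a list) pmf" and Q' :: "'a \<Rightarrow> 'a list pmf" and J :: real
  assumes fin: "finite (set_pmf \<nu>)" and rich: "rich (set_pmf \<nu>)"
    and Q': "\<And>a c. pmf (Q' a) c = pmf \<nu> (a, c) / pmf (type_marginal \<nu>) a"
    and J: "offspring_rate Q \<nu> \<le> ereal J"
begin

abbreviation m where "m a \<equiv> pmf (type_marginal \<nu>) a"

lemma om: "\<nu> \<in> offspring_measures" by (rule finite_set_pmf_offspring_measures[OF fin])

lemma tree_\<tau>_support: "x \<in># tree_cnt (\<tau> a) \<Longrightarrow> x \<in> set_pmf \<nu>"
  using rich unfolding rich_def by blast

lemma m_pos: "0 < m a"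
proof -
  obtain ts where "\<tau> a = GNode a ts" using root_\<tau>[of a] by (cases "\<tau> a") auto
  then have "(a, map root_type ts) \<in> set_pmf \<nu>" by (intro tree_\<tau>_support[of _ a]) simp
  then have "0 < pmf \<nu> (a, map root_type ts)" by (rule pmf_positive)
  also have "\<dots> \<le> m a" by (rule pmf_type_marginal_ge)
  finally show ?thesis .
qed

lemma pmf_\<nu>: "pmf \<nu> (a, c) = m a * pmf (Q' a) c"
  using m_pos[of a] by (simp add: Q')

lemma \<nu>_eq: "\<nu> = kernel_product (type_marginal \<nu>) Q'"
  by (rule pmf_eqI) (auto simp: pmf_kernel_product pmf_\<nu>)

lemma set_pmf_Q'_iff: "c \<in> set_pmf (Q' a) \<longleftrightarrow> (a, c) \<in> set_pmf \<nu>"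
  using m_pos[of a] by (simp add: set_pmf_iff Q')

lemma excess_\<nu>: "measure_pmf.expectation \<nu> (excess a) = 0"
  using J unfolding offspring_rate_le_iff[OF om] by blast

lemma entropy_finite:
  shows "absolutely_continuous (measure_pmf (kernel_product (type_marginal \<nu>) Q)) (measure_pmf \<nu>)"
    and "measure_pmf.expectation \<nu> (entropy_density (exp 1) (kernel_product (type_marginal \<nu>) Q) \<nu>) \<le> J"
proof -
  have *: "relative_entropy \<nu> (kernel_product (type_marginal \<nu>) Q) \<le> ereal J"
    using J by (simp add: offspring_rate_def split: if_splits)
  then show "absolutely_continuous (measure_pmf (kernel_product (type_marginal \<nu>) Q)) (measure_pmf \<nu>)"
    and "measure_pmf.expectation \<nu> (entropy_density (exp 1) (kernel_product (type_marginal \<nu>) Q) \<nu>) \<le> J"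
    by (auto simp: relative_entropy_def KL_divergence_def split: if_splits)
qed

lemma support_Q: "(a, c) \<in> set_pmf \<nu> \<Longrightarrow> c \<in> set_pmf (Q a)"
  using entropy_density_pmf(1)[OF entropy_finite(1), of "(a, c)"] by (auto simp: pmf_kernel_product set_pmf_iff)

text \<open>The logarithmic cost per vertex of passing from \<open>Q'\<close> to \<open>Q\<close>,
  with \<nu>-mean equal to the relative entropy. The value 0 off the finite support makes it
  bounded, hence a test function of the topology.\<close>

definition g :: "'a \<times> 'a list \<Rightarrow> real" where
  "g x = (if x \<in> set_pmf \<nu> then ln (offspring_prob Q' x / offspring_prob Q x) else 0)"

lemma expectation_g: "measure_pmf.expectation \<nu> g \<le> J"
proof -
  have "measure_pmf.expectation \<nu> g
      = measure_pmf.expectation \<nu> (entropy_density (exp 1) (kernel_product (type_marginal \<nu>) Q) \<nu>)"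
  proof (rule integral_cong_AE)
    show "AE x in measure_pmf \<nu>. g x = entropy_density (exp 1) (kernel_product (type_marginal \<nu>) Q) \<nu> x"
      unfolding AE_measure_pmf_iff
    proof
      fix x assume x: "x \<in> set_pmf \<nu>"
      obtain a c where ac: "x = (a, c)" by (cases x)
      show "g x = entropy_density (exp 1) (kernel_product (type_marginal \<nu>) Q) \<nu> x"
        using entropy_density_pmf(2)[OF entropy_finite(1) x] x m_pos[of a]
        by (simp add: g_def ac pmf_kernel_product pmf_\<nu>)
    qed
  qed auto
  then show ?thesis using entropy_finite(2) by simp
qed

lemma bounded_g: "bounded (range g)"
proof (rule finite_imp_bounded, rule finite_subset)
  have "g x \<in> insert 0 (g ` set_pmf \<nu>)" for x by (cases "x \<in> set_pmf \<nu>") (simp_all add: g_def)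
  then show "range g \<subseteq> insert 0 (g ` set_pmf \<nu>)" by blast
qed (simp add: fin)

lemma tree_weight_Q:
  assumes "set_mset (tree_cnt t) \<subseteq> set_pmf \<nu>"
  shows "tree_weight (offspring_prob Q) t
    = tree_weight (offspring_prob Q') t * exp (- (\<Sum>x\<in>#tree_cnt t. g x))"
proof -
  have "(\<Prod>x\<in>#tree_cnt t. offspring_prob Q x) = (\<Prod>x\<in>#tree_cnt t. offspring_prob Q' x * exp (- g x))"
  proof (intro arg_cong[of _ _ prod_mset] image_mset_cong)
    fix x assume "x \<in># tree_cnt t"
    then have x: "x \<in> set_pmf \<nu>" using assms by blast
    obtain a c where ac: "x = (a, c)" by (cases x)
    have "0 < pmf (Q a) c" "0 < pmf (Q' a) c"
      using support_Q[of a c] set_pmf_Q'_iff[of c a] x by (auto simp: ac intro: pmf_positive)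
    then show "offspring_prob Q x = offspring_prob Q' x * exp (- g x)"
      using x by (simp add: g_def ac exp_minus)
  qed
  also have "\<dots> = tree_weight (offspring_prob Q') t * exp (\<Sum>x\<in>#tree_cnt t. - g x)"
    unfolding prod_mset_mult_exp tree_weight_def ..
  finally show ?thesis using sum_mset_diff_real[of "\<lambda>_. 0" g "tree_cnt t"] by (simp add: tree_weight_def)
qed

lemma tree_weight_Q'_zero:
  assumes "\<not> set_mset (tree_cnt t) \<subseteq> set_pmf \<nu>"
  shows "tree_weight (offspring_prob Q') t = 0"
proof -
  obtain a c where ac: "(a, c) \<in># tree_cnt t" "(a, c) \<notin> set_pmf \<nu>" using assms by auto
  then have "offspring_prob Q' (a, c) = 0" using set_pmf_Q'_iff[of c a] by (simp add: set_pmf_iff)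
  then have "0 \<in># image_mset (offspring_prob Q') (tree_cnt t)" using ac(1) by (metis image_eqI set_image_mset)
  then show ?thesis by (simp only: tree_weight_def prod_mset_zero_iff)
qed

lemma finite_exponential_moments_Q': "finite_exponential_moments Q'"
  unfolding finite_exponential_moments_def
proof (intro allI impI)
  fix a \<eta>
  have "set_pmf (Q' a) \<subseteq> snd ` set_pmf \<nu>" using set_pmf_Q'_iff by force
  then have "finite (set_pmf (Q' a))" using fin finite_subset by blast
  then show "(\<integral>\<^sup>+c. ennreal (exp (\<eta> * real (length c))) \<partial>measure_pmf (Q' a)) < \<infinity>"
    by (simp add: nn_integral_measure_pmf_finite ennreal_mult_less_top)
qed

section \<open>Uniqueness of the zero of the rate function of the conditional kernel\<close>

definition A' :: "'a \<Rightarrow> 'a \<Rightarrow> real" where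
  "A' a b = measure_pmf.expectation (Q' b) (\<lambda>c. real (count_list c a))"

lemma A'_nonneg: "0 \<le> A' a b" by (simp add: A'_def integral_nonneg)

lemma A'_pos: "(b, c) \<in> set_pmf \<nu> \<Longrightarrow> a \<in> set c \<Longrightarrow> 0 < A' a b"
proof -
  assume *: "(b, c) \<in> set_pmf \<nu>" "a \<in> set c"
  have "(b, a) \<in> type_edges Q'" using * by (auto simp: type_edges_def set_pmf_Q'_iff)
  then show ?thesis
    using mean_matrix_pos_iff[OF finite_exponential_moments_Q', of a b] by (simp add: mean_matrix_def A'_def)
qed

lemma A'_edge: "A' a b \<noteq> 0 \<Longrightarrow> (b, a) \<in> E"
proof -
  assume "A' a b \<noteq> 0"
  then have "0 < A' a b" using A'_nonneg[of a b] by linarith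
  then have "(b, a) \<in> type_edges Q'"
    using mean_matrix_pos_iff[OF finite_exponential_moments_Q', of a b]
    by (simp add: mean_matrix_def A'_def)
  then show ?thesis using set_pmf_Q'_iff support_Q by (auto simp: type_edges_def)
qed

lemma fixed_point_of_excess:
  assumes "\<mu> \<in> offspring_measures" "\<mu> = kernel_product (type_marginal \<mu>) Q'"
    "measure_pmf.expectation \<mu> (excess a) = 0"
  shows "pmf (type_marginal \<mu>) a = (\<Sum>b\<in>UNIV. pmf (type_marginal \<mu>) b * A' a b)"
proof -
  have "pmf (type_marginal \<mu>) a = measure_pmf.expectation \<mu> (\<lambda>x. real (count_list (snd x) a))"
    using assms(3) unfolding expectation_excess(2)[OF assms(1)] by (simp add: case_prod_unfold)
  also have "\<dots> = measure_pmf.expectation (kernel_product (type_marginal \<mu>) Q') (\<lambda>x. real (count_list (snd x) a))"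
    using assms(2) by simp
  also have "\<dots> = (\<Sum>b\<in>UNIV. pmf (type_marginal \<mu>) b * A' a b)"
    using integrable_count_kernel[OF finite_exponential_moments_Q']
    by (subst expectation_kernel_product(2)) (simp_all add: A'_def)
  finally show ?thesis .
qed

text \<open>A nonnegative fixed vector that vanishes at a type vanishes at all its possible parents.
  The frame \<open>hole b a0\<close> is charged by \<nu> and contains a path from the recurrent type
  \<open>b\<close> to \<open>a0\<close>, so \<open>w\<close> vanishes on all recurrent types; the
  transient ones follow by induction from parents to children.\<close>

lemma fixed_vector_zero:
  assumes w0: "\<And>a. 0 \<le> w a" and fix_w: "\<And>a. w a = (\<Sum>b\<in>UNIV. w b * A' a b)" and a0: "w a0 = 0"
  shows "w a = 0"
proof -
  have pred: "w b = 0" if "w d = 0" "0 < A' d b" for b d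
  proof -
    have "(\<Sum>b\<in>UNIV. w b * A' d b) = 0" using fix_w[of d] that(1) by simp
    then have "w b * A' d b = 0"
      using w0 A'_nonneg by (subst (asm) sum_nonneg_eq_0_iff) auto
    then show ?thesis using that(2) by simp
  qed
  have wr: "w b = 0" if b: "b \<in> Xr" for b
  proof -
    have "(b, a0) \<in> (mset_edges (hole b a0))\<^sup>*" using hole2_hole[OF b] by (simp add: hole2_def)
    then show ?thesis
    proof (induction rule: converse_rtrancl_induct)
      case (step y z)
      then obtain c where "(y, c) \<in># hole b a0" "z \<in> set c" by (auto simp: mset_edges_def)
      moreover from this have "(y, c) \<in> set_pmf \<nu>" using rich b unfolding rich_def by blast
      ultimately have "0 < A' z y" by (intro A'_pos)
      then show ?case using pred step.IH by blast
    qed (rule a0)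
  qed
  show ?thesis
    using wf_transient
  proof (induction a rule: wf_induct_rule)
    case (less a)
    have "w b * A' a b = 0" for b
    proof (cases "b \<in> Xr \<or> A' a b = 0")
      case True then show ?thesis using wr by auto
    next
      case False
      then have "b \<in> Xt" "(b, a) \<in> E" using in_Xt_iff A'_edge by auto
      then show ?thesis using less.IH[of b] transient_child by auto
    qed
    then have "(\<Sum>b\<in>UNIV. w b * A' a b) = 0" by (intro sum.neutral ballI)
    then show ?case using fix_w[of a] by simp
  qed
qed

text \<open>Rate zero means that \<mu> is its own marginal combined with \<open>Q'\<close>, and that
  this marginal is fixed by \<open>A'\<close>. Uniqueness thus reduces to that of the fixed
  probability vector.\<close>

lemma rate_zero_unique:
  assumes \<mu>: "\<mu> \<in> offspring_measures" and z: "\<not> 0 < offspring_rate Q' \<mu>"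
  shows "\<mu> = \<nu>"
proof -
  have z': "offspring_rate Q' \<mu> = 0" using z offspring_rate_nonneg[of Q' \<mu>] by simp
  then have "offspring_rate Q' \<mu> \<le> ereal 0" by (simp add: zero_ereal_def)
  then have ex: "measure_pmf.expectation \<mu> (excess a) = 0" for a
    unfolding offspring_rate_le_iff[OF \<mu>] by blast
  let ?q = "kernel_product (type_marginal \<mu>) Q'"
  have re: "relative_entropy \<mu> ?q = 0" using z' by (simp add: offspring_rate_def split: if_splits)
  then have ac: "absolutely_continuous (measure_pmf ?q) (measure_pmf \<mu>)"
    and int: "integrable (measure_pmf \<mu>) (entropy_density (exp 1) (measure_pmf ?q) (measure_pmf \<mu>))"
    by (auto simp: relative_entropy_def split: if_splits)
  then have KL: "KL_divergence (exp 1) (measure_pmf ?q) (measure_pmf \<mu>) = 0"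
    using re by (simp add: relative_entropy_def zero_ereal_def)
  interpret information_space "measure_pmf ?q" "exp 1" by unfold_locales simp
  have "measure_pmf \<mu> = measure_pmf ?q"
    using KL_eq_0_iff_eq_ac[OF prob_space_measure_pmf ac _ int] KL by simp
  then have \<mu>q: "\<mu> = ?q" by (simp add: measure_pmf_inject)
  have fm: "pmf (type_marginal \<mu>) a = (\<Sum>b\<in>UNIV. pmf (type_marginal \<mu>) b * A' a b)" for a
    by (rule fixed_point_of_excess[OF \<mu> \<mu>q ex])
  have f\<nu>: "m a = (\<Sum>b\<in>UNIV. m b * A' a b)" for a
    by (rule fixed_point_of_excess[OF om \<nu>_eq excess_\<nu>])
  \<comment> \<open>Subtracting the largest multiple of \<open>m\<close> that keeps the difference
    nonnegative leaves a fixed vector with a zero, hence the zero vector; total mass then gives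
    \<open>s = 1\<close>.\<close>
  define s where "s = Min (range (\<lambda>a. pmf (type_marginal \<mu>) a / m a))"
  have s: "s \<le> pmf (type_marginal \<mu>) a / m a" for a by (simp add: s_def)
  have "s \<in> range (\<lambda>a. pmf (type_marginal \<mu>) a / m a)" unfolding s_def by (intro Min_in) auto
  then obtain a0 where a0: "s = pmf (type_marginal \<mu>) a0 / m a0" by blast
  define w where "w a = pmf (type_marginal \<mu>) a - s * m a" for a
  have "w a = 0" for a
  proof (rule fixed_vector_zero)
    show "0 \<le> w a" for a using s[of a] m_pos[of a] by (simp add: w_def pos_le_divide_eq)
    show "w a0 = 0" using m_pos[of a0] by (simp add: w_def a0)
    show "w a = (\<Sum>b\<in>UNIV. w b * A' a b)" for a
    proof -
      have "w a = (\<Sum>b\<in>UNIV. pmf (type_marginal \<mu>) b * A' a b) - s * (\<Sum>b\<in>UNIV. m b * A' a b)"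
        unfolding w_def fm[of a, symmetric] f\<nu>[of a, symmetric] ..
      also have "\<dots> = (\<Sum>b\<in>UNIV. w b * A' a b)"
        by (simp add: w_def left_diff_distrib sum_subtractf sum_distrib_left mult.assoc)
      finally show ?thesis .
    qed
  qed
  then have eq: "pmf (type_marginal \<mu>) a = s * m a" for a by (simp add: w_def)
  have "(\<Sum>a\<in>UNIV. pmf (type_marginal \<mu>) a) = s * (\<Sum>a\<in>UNIV. m a)"
    unfolding eq by (simp add: sum_distrib_left)
  then have "s = 1" by (simp add: sum_pmf_eq_1)
  then have "type_marginal \<mu> = type_marginal \<nu>" by (intro pmf_eqI) (simp add: eq)
  then show ?thesis using \<mu>q \<nu>_eq by metis
qed

text \<open>Some root type has a generating function that diverges at \<open>exp s\<close>, so its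
  size probabilities are not all exponentially small with rate above \<open>s\<close>. Bounded sums
  would make the increasing masses \<open>X h a\<close> converge to a finite positive solution of
  the fixed point equation, which Jensen's inequality excludes.\<close>

lemma exists_unbounded_growth:
  assumes s: "0 < s"
  shows "\<exists>a. \<forall>B. \<exists>n. B < (\<Sum>k\<le>n. exp (s * real k) * tree_prob Q' k a UNIV)"
proof (rule ccontr)
  assume "\<not> ?thesis"
  then have "\<forall>a. \<exists>B. \<forall>n. (\<Sum>k\<le>n. exp (s * real k) * tree_prob Q' k a UNIV) \<le> B" by (simp add: not_less)
  from choice[OF this] obtain B where B: "\<And>a n. (\<Sum>k\<le>n. exp (s * real k) * tree_prob Q' k a UNIV) \<le> B a" by blast
  define q where "q x = exp s * offspring_prob Q' x" for x
  have q0: "0 \<le> q x" for x unfolding q_def by (intro mult_nonneg_nonneg offspring_prob_nonneg) simp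
  \<comment> \<open>Large enough that cutting the number of children loses no list of positive
    \<open>Q'\<close>-probability and that \<open>\<tau> a\<close> belongs to
    \<open>bounded_trees N N a\<close>.\<close>
  define N where "N = Max ((\<lambda>x. length (snd x)) ` set_pmf \<nu>) + (\<Sum>a\<in>UNIV. size (tree_cnt (\<tau> a)))"
  have N1: "length c \<le> N" if "(a, c) \<in> set_pmf \<nu>" for a c
  proof -
    have "length c \<le> Max ((\<lambda>x. length (snd x)) ` set_pmf \<nu>)" using that fin by (intro Max_ge) force+
    then show ?thesis by (simp add: N_def)
  qed
  have N2: "size (tree_cnt (\<tau> a)) \<le> N" for a
  proof -
    have "size (tree_cnt (\<tau> a)) \<le> (\<Sum>a\<in>UNIV. size (tree_cnt (\<tau> a)))" by (intro member_le_sum) auto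
    then show ?thesis by (simp add: N_def)
  qed
  define X where "X h a = (\<Sum>t\<in>bounded_trees N h a. tree_weight q t)" for h a
  have mono_bt: "bounded_trees N h a \<subseteq> bounded_trees N (Suc h) a" for h and a :: 'a
  proof (induction h arbitrary: a)
    case (Suc h)
    have "listset (map (bounded_trees N h) c) \<subseteq> listset (map (bounded_trees N (Suc h)) c)" for c :: "'a list"
      unfolding subset_iff in_listset list_all2_conv_all_nth
      by (auto simp del: bounded_trees.simps intro!: subsetD[OF Suc])
    then show ?case unfolding bounded_trees.simps(2)[of N "Suc h"] bounded_trees.simps(2)[of N h]
      by (intro UN_mono image_mono subset_refl)
  qed simp
  have inc: "incseq (\<lambda>h. X h a)" for a
    unfolding X_def
    by (intro incseq_SucI sum_mono2 finite_bounded_trees mono_bt tree_weight_nonneg q0)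
  have weight_q: "tree_weight q t = exp (s * real (size (tree_cnt t))) * tree_weight (offspring_prob Q') t" for t
  proof -
    have "(\<Prod>x\<in>#C. q x) = exp (s * real (size C)) * (\<Prod>x\<in>#C. offspring_prob Q' x)" for C
      by (induction C) (simp_all add: q_def exp_add distrib_left mult_ac)
    then show ?thesis by (simp add: tree_weight_def)
  qed
  have XB: "X h a \<le> B a" for h a
  proof -
    have "finite ((\<lambda>t. size (tree_cnt t)) ` bounded_trees N h a)" by (intro finite_imageI finite_bounded_trees)
    then obtain n where n: "\<And>t. t \<in> bounded_trees N h a \<Longrightarrow> size (tree_cnt t) \<le> n"
      unfolding finite_nat_set_iff_bounded_le by blast
    have "bounded_trees N h a \<subseteq> (\<Union>k\<le>n. sized_trees k a)"
    proof
      fix t assume t: "t \<in> bounded_trees N h a"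
      then show "t \<in> (\<Union>k\<le>n. sized_trees k a)"
        using n[OF t] root_type_bounded_trees[OF t]
        by (intro UN_I[of "size (tree_cnt t)"]) (simp_all add: sized_trees_def)
    qed
    then have "X h a \<le> (\<Sum>t\<in>(\<Union>k\<le>n. sized_trees k a). tree_weight q t)"
      unfolding X_def by (intro sum_mono2 tree_weight_nonneg q0) simp_all
    also have "\<dots> = (\<Sum>k\<le>n. \<Sum>t\<in>sized_trees k a. tree_weight q t)"
      by (intro sum.UNION_disjoint) (simp_all, auto simp: sized_trees_def)
    also have "\<dots> = (\<Sum>k\<le>n. exp (s * real k) * tree_prob Q' k a UNIV)"
      unfolding tree_prob_def sum_distrib_left
      by (intro sum.cong refl) (auto simp: weight_q sized_trees_def)
    also have "\<dots> \<le> B a" by (rule B)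
    finally show ?thesis .
  qed
  have "\<forall>a. \<exists>T. (\<lambda>h. X h a) \<longlonglongrightarrow> T \<and> (\<forall>h. X h a \<le> T)"
  proof
    fix a
    obtain T where "(\<lambda>h. X h a) \<longlonglongrightarrow> T" "\<forall>h. X h a \<le> T"
      using incseq_convergent[OF inc[of a], of "B a"] XB by blast
    then show "\<exists>T. (\<lambda>h. X h a) \<longlonglongrightarrow> T \<and> (\<forall>h. X h a \<le> T)" by (intro exI conjI)
  qed
  from choice[OF this] obtain T where T: "\<And>a. (\<lambda>h. X h a) \<longlonglongrightarrow> T a" "\<And>h a. X h a \<le> T a" by blast
  \<comment> \<open>Positivity, which the logarithms below require, comes from
    \<open>\<tau> a\<close>, all of whose vertices are charged.\<close>
  have T_pos: "0 < T a" for a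
  proof -
    have "\<tau> a \<in> bounded_trees N N a" using in_bounded_trees[OF N2 N2, of a] by (simp add: root_\<tau>)
    then have "tree_weight q (\<tau> a) \<le> X N a"
      unfolding X_def by (intro member_le_sum finite_bounded_trees tree_weight_nonneg q0)
    moreover have "0 < tree_weight q (\<tau> a)"
    proof -
      have "0 < (\<Prod>x\<in>#C. q x)" if "set_mset C \<subseteq> set_pmf \<nu>" for C
        using that
      proof (induction C)
        case (add x C)
        obtain b c where "x = (b, c)" by (cases x)
        then have "0 < q x" using add.prems set_pmf_Q'_iff[of c b] by (simp add: q_def pmf_positive)
        then show ?case using add by simp
      qed simp
      then show ?thesis unfolding tree_weight_def using tree_\<tau>_support by blast
    qed
    ultimately show ?thesis using T(2)[where h = N and a = a] by linarith
  qed
  have T_fix: "T a = (\<Sum>c | length c \<le> N. q (a, c) * prod_list (map T c))" for a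
  proof (rule LIMSEQ_unique)
    show "(\<lambda>h. X (Suc h) a) \<longlonglongrightarrow> T a" using T(1) by (rule LIMSEQ_Suc)
    have "(\<lambda>h. prod_list (map (X h) c)) \<longlonglongrightarrow> prod_list (map T c)" for c
      by (induction c) (auto intro!: tendsto_mult T(1))
    then have "(\<lambda>h. \<Sum>c | length c \<le> N. q (a, c) * prod_list (map (X h) c))
        \<longlonglongrightarrow> (\<Sum>c | length c \<le> N. q (a, c) * prod_list (map T c))"
      by (intro tendsto_intros)
    then show "(\<lambda>h. X (Suc h) a) \<longlonglongrightarrow> (\<Sum>c | length c \<le> N. q (a, c) * prod_list (map T c))"
      unfolding X_def sum_bounded_trees_Suc by (simp add: X_def[abs_def])
  qed
  text \<open>Jensen's inequality for the fixed point equation; shift-invariance cancels the terms \<open>ln (T b)\<close>.\<close>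
  define L where "L x = s + sum_list (map (\<lambda>b. ln (T b)) (snd x)) - ln (T (fst x))" for x
  define y where "y x = exp s * prod_list (map T (snd x)) / T (fst x)" for x
  have y_pos: "0 < prod_list (map T c)" for c using T_pos by (induction c) auto
  have ln_y: "ln (y x) = L x" for x
  proof -
    have "ln (prod_list (map T c)) = sum_list (map (\<lambda>b. ln (T b)) c)" for c
    proof (induction c)
      case (Cons a c)
      then show ?case using T_pos[of a] y_pos[of c] by (simp add: ln_mult)
    qed simp
    then show ?thesis using T_pos[of "fst x"] y_pos[of "snd x"] by (simp add: y_def L_def ln_div ln_mult)
  qed
  have sum_list_ln: "sum_list (map (\<lambda>b. ln (T b)) c) = (\<Sum>b\<in>UNIV. ln (T b) * real (count_list c b))" for c
  proof (induction c)
    case (Cons x c)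
    have "(\<Sum>b\<in>UNIV. ln (T b) * real (count_list (x # c) b))
        = (\<Sum>b\<in>UNIV. ln (T b) * real (count_list c b) + (if b = x then ln (T b) else 0))"
      by (intro sum.cong) (auto simp: distrib_left)
    then show ?case using Cons by (simp add: sum.distrib)
  qed simp
  have int: "integrable (measure_pmf \<nu>) f" for f :: "_ \<Rightarrow> real" by (rule integrable_measure_pmf_finite[OF fin])
  have "measure_pmf.expectation \<nu> L = s"
  proof -
    have "(\<lambda>x. L x) = (\<lambda>x. s - (\<Sum>b\<in>UNIV. ln (T b) * excess b x))"
    proof
      fix x :: "'a \<times> 'a list"
      have "(\<Sum>b\<in>UNIV. ln (T b) * indicator {b} (fst x)) = ln (T (fst x))"
        by (simp add: indicator_def if_distrib cong: if_cong)
      then show "L x = s - (\<Sum>b\<in>UNIV. ln (T b) * excess b x)"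
        by (simp add: L_def sum_list_ln excess_def right_diff_distrib sum_subtractf)
    qed
    then have "measure_pmf.expectation \<nu> L = measure_pmf.expectation \<nu> (\<lambda>x. s - (\<Sum>b\<in>UNIV. ln (T b) * excess b x))"
      by simp
    also have "\<dots> = s - (\<Sum>b\<in>UNIV. ln (T b) * measure_pmf.expectation \<nu> (excess b))"
      by (simp add: int)
    finally show ?thesis by (simp add: excess_\<nu>)
  qed
  moreover have "measure_pmf.expectation \<nu> L \<le> measure_pmf.expectation \<nu> (\<lambda>x. y x - 1)"
  proof (intro integral_mono int)
    fix x
    have "0 < y x" using y_pos T_pos by (simp add: y_def)
    then show "L x \<le> y x - 1" using ln_le_minus_one[of "y x"] by (simp add: ln_y)
  qed
  moreover have "measure_pmf.expectation \<nu> (\<lambda>x. y x - 1) = 0"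
  proof -
    have ik: "integrable (measure_pmf (Q' a)) f" for a and f :: "'a list \<Rightarrow> real"
    proof (rule integrable_measure_pmf_finite)
      have "set_pmf (Q' a) \<subseteq> snd ` set_pmf \<nu>" using set_pmf_Q'_iff by force
      then show "finite (set_pmf (Q' a))" using fin finite_subset by blast
    qed
    have "measure_pmf.expectation \<nu> y = measure_pmf.expectation (kernel_product (type_marginal \<nu>) Q') y"
      using \<nu>_eq by simp
    also have "\<dots> = (\<Sum>a\<in>UNIV. m a * measure_pmf.expectation (Q' a) (\<lambda>c. y (a, c)))"
      using y_pos T_pos by (intro expectation_kernel_product(2) ik) (simp add: y_def less_imp_le)
    also have "\<dots> = (\<Sum>a\<in>UNIV. m a)"
    proof (intro sum.cong refl)
      fix a
      have "measure_pmf.expectation (Q' a) (\<lambda>c. y (a, c)) = (\<Sum>c | length c \<le> N. pmf (Q' a) c * y (a, c))"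
        using N1 set_pmf_Q'_iff by (subst integral_measure_pmf[OF finite_words[of N]]) auto
      also have "\<dots> = (\<Sum>c | length c \<le> N. q (a, c) * prod_list (map T c)) / T a"
        by (simp add: sum_divide_distrib y_def q_def mult_ac)
      also have "\<dots> = 1" using T_fix[of a] T_pos[of a] by simp
      finally show "m a * measure_pmf.expectation (Q' a) (\<lambda>c. y (a, c)) = m a" by simp
    qed
    finally show ?thesis by (simp add: int sum_pmf_eq_1)
  qed
  ultimately show False using s by linarith
qed

end

section \<open>The large deviation lower bound\<close>

lemma eventually_exp_le:
  assumes "0 < a" and c: "0 < c"
  shows "\<forall>\<^sub>F n in sequentially. m * exp (- (real n * a)) \<le> (c :: real)"
proof -
  have "(\<lambda>n. exp (- a) ^ n) \<longlonglongrightarrow> 0" using assms by (intro LIMSEQ_realpow_zero) auto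
  then have "(\<lambda>n. m * exp (- a) ^ n) \<longlonglongrightarrow> 0" by (rule tendsto_mult_right_zero)
  then have "\<forall>\<^sub>F n in sequentially. m * exp (- a) ^ n < c" using c by (rule order_tendstoD)
  then show ?thesis by eventually_elim (simp add: exp_of_nat_mult[symmetric])
qed

lemma near_mono: "near \<Phi>' e \<nu> \<mu> \<Longrightarrow> \<Phi> \<subseteq> \<Phi>' \<Longrightarrow> e \<le> e' \<Longrightarrow> near \<Phi> e' \<nu> \<mu>"
  unfolding near_def by (meson less_le_trans subsetD)

lemma near_trans:
  "near \<Phi> e \<nu> \<nu>' \<Longrightarrow> near \<Phi> e' \<nu>' \<mu> \<Longrightarrow> near \<Phi> (e + e') \<nu> \<mu>"
  unfolding near_def
proof
  fix f assume *: "\<forall>f\<in>\<Phi>. \<bar>measure_pmf.expectation \<nu>' f - measure_pmf.expectation \<nu> f\<bar> < e"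
    "\<forall>f\<in>\<Phi>. \<bar>measure_pmf.expectation \<mu> f - measure_pmf.expectation \<nu>' f\<bar> < e'" and f: "f \<in> \<Phi>"
  have "\<bar>measure_pmf.expectation \<nu>' f - measure_pmf.expectation \<nu> f\<bar> < e"
    "\<bar>measure_pmf.expectation \<mu> f - measure_pmf.expectation \<nu>' f\<bar> < e'" using * f by auto
  then show "\<bar>measure_pmf.expectation \<mu> f - measure_pmf.expectation \<nu> f\<bar> < e + e'" by linarith
qed

lemma closedin_not_near:
  assumes "finite \<Phi>" "\<Phi> \<subseteq> offspring_test_functions"
  shows "closedin offspring_topology {\<mu> \<in> offspring_measures. \<not> near \<Phi> e \<nu> \<mu>}"
proof -
  let ?F = "\<lambda>f. {\<mu> \<in> topspace offspring_topology. measure_pmf.expectation \<mu> f \<in> {x. e \<le> \<bar>x - measure_pmf.expectation \<nu> f\<bar>}}"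
  have "closedin offspring_topology (?F f)" if "f \<in> \<Phi>" for f
  proof (intro closedin_continuous_map_preimage[OF continuous_map_test_function])
    show "f \<in> offspring_test_functions" using that assms(2) by (rule subsetD[rotated])
    have "closed {x. e \<le> \<bar>x - measure_pmf.expectation \<nu> f\<bar>}"
      by (intro closed_Collect_le continuous_intros)
    then show "closedin euclideanreal {x. e \<le> \<bar>x - measure_pmf.expectation \<nu> f\<bar>}" by simp
  qed
  then have "closedin offspring_topology (\<Union>f\<in>\<Phi>. ?F f)"
    using assms(1) by (intro closedin_Union) auto
  also have "(\<Union>f\<in>\<Phi>. ?F f) = {\<mu> \<in> offspring_measures. \<not> near \<Phi> e \<nu> \<mu>}"
    by (auto simp: near_def topspace_offspring_topology not_less)
  finally show ?thesis .
qed

text \<open>The allowance \<epsilon> is halved: one half \<open>e\<close> covers the fluctuation of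
  the logarithmic density along the tree, which is why \<open>g\<close> joins the tests, and the
  other covers the subexponential \<open>Q'\<close>-probability of the size.\<close>

lemma (in conditional_kernel) exists_near_growth:
  assumes \<Phi>: "finite \<Phi>" "\<Phi> \<subseteq> offspring_test_functions" and \<epsilon>: "0 < \<epsilon>"
  shows "\<exists>a. \<exists>\<^sub>F n in sequentially. exp (- (real n * (J + \<epsilon>))) \<le> tree_prob Q n a {\<mu>. near \<Phi> \<epsilon> \<nu> \<mu>}"
proof -
  define e where "e = \<epsilon> / 2"
  have e: "0 < e" "e \<le> \<epsilon>" using \<epsilon> by (auto simp: e_def)
  define \<Phi>' where "\<Phi>' = insert g \<Phi>"
  have \<Phi>': "finite \<Phi>'" "\<Phi>' \<subseteq> offspring_test_functions" "\<Phi> \<subseteq> \<Phi>'"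
    using \<Phi> bounded_g by (auto simp: \<Phi>'_def offspring_test_functions_def)
  define F where "F = {\<mu> \<in> offspring_measures. \<not> near \<Phi>' e \<nu> \<mu>}"
  have F: "closedin offspring_topology F" unfolding F_def by (rule closedin_not_near[OF \<Phi>'(1,2)])
  have "near \<Phi>' e \<nu> \<nu>" using e by (simp add: near_def)
  then have "0 < offspring_rate Q' \<mu>" if "\<mu> \<in> F" for \<mu>
    using that rate_zero_unique[of \<mu>] by (auto simp: F_def)
  from offspring_rate_pos_bound[OF finite_exponential_moments_Q' F this]
  obtain \<alpha> where \<alpha>: "0 < \<alpha>" "\<And>\<mu>. \<mu> \<in> F \<Longrightarrow> ereal \<alpha> < offspring_rate Q' \<mu>" by blast
  obtain M where M: "\<forall>\<^sub>F n in sequentially. \<forall>a. tree_prob Q' n a F \<le> M * exp (- (real n * \<alpha>))"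
    using tree_prob_upper_bound[OF finite_exponential_moments_Q' F \<alpha>(2)] by blast
  \<comment> \<open>With \<open>4 * s\<close> below both \<alpha> and \<open>e\<close>, a mass of
    order \<open>exp (- 2 s n)\<close> dominates the mass \<open>exp (- \<alpha> n)\<close> far from
    \<nu>, and half of it still dominates \<open>exp (- e n)\<close>.\<close>
  define s where "s = min \<alpha> e / 4"
  have s: "0 < s" "4 * s \<le> \<alpha>" "4 * s \<le> e" using \<alpha> e by (auto simp: s_def)
  obtain a where a: "\<And>B. \<exists>n. B < (\<Sum>k\<le>n. exp (s * real k) * tree_prob Q' k a UNIV)"
    using exists_unbounded_growth[OF s(1)] by blast
  \<comment> \<open>Otherwise the terms of the divergent series would eventually be at most
    \<open>exp (- s n)\<close>, and the partial sums would be bounded.\<close>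
  have freq: "\<exists>\<^sub>F n in sequentially. exp (- (real n * (2 * s))) < tree_prob Q' n a UNIV"
  proof (rule ccontr)
    assume "\<not> ?thesis"
    then have "\<forall>\<^sub>F n in sequentially. tree_prob Q' n a UNIV \<le> exp (- (real n * (2 * s)))"
      by (simp add: not_frequently not_less)
    then obtain n0 where n0: "\<And>n. n \<ge> n0 \<Longrightarrow> tree_prob Q' n a UNIV \<le> exp (- (real n * (2 * s)))"
      by (auto simp: eventually_sequentially)
    let ?u = "\<lambda>k. exp (s * real k) * tree_prob Q' k a UNIV"
    have "summable ?u"
    proof (rule summable_comparison_test')
      show "summable (\<lambda>n. exp (- s) ^ n)" using s by (intro summable_geometric) simp
      fix n assume "n0 \<le> n"
      then have "?u n \<le> exp (s * real n) * exp (- (real n * (2 * s)))" by (intro mult_left_mono n0) auto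
      also have "\<dots> = exp (- s) ^ n" by (simp add: exp_add[symmetric] exp_of_nat_mult[symmetric] algebra_simps)
      finally show "norm (?u n) \<le> exp (- s) ^ n" by (simp add: tree_prob_nonneg)
    qed
    then have "(\<Sum>k\<le>n. ?u k) \<le> suminf ?u" for n
      by (intro sum_le_suminf) (auto simp: tree_prob_nonneg)
    then show False using a[of "suminf ?u"] by (meson not_less)
  qed
  have ev1: "\<forall>\<^sub>F n in sequentially. M * exp (- (real n * (\<alpha> - 2 * s))) \<le> 1 / 2"
    using s \<alpha> by (intro eventually_exp_le) auto
  have ev2: "\<forall>\<^sub>F n in sequentially. 1 * exp (- (real n * (e - 2 * s))) \<le> 1 / 2"
    using s e by (intro eventually_exp_le) auto
  let ?N = "{\<mu>. near \<Phi>' e \<nu> \<mu>}"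
  have "\<exists>\<^sub>F n in sequentially. exp (- (real n * (J + \<epsilon>))) \<le> tree_prob Q n a {\<mu>. near \<Phi> \<epsilon> \<nu> \<mu>}"
    using frequently_eventually_conj[OF freq eventually_conj[OF M eventually_conj[OF ev1 ev2]]]
  proof (rule frequently_elim1)
    fix n
    assume *: "((\<forall>a. tree_prob Q' n a F \<le> M * exp (- (real n * \<alpha>))) \<and>
        M * exp (- (real n * (\<alpha> - 2 * s))) \<le> 1 / 2 \<and> 1 * exp (- (real n * (e - 2 * s))) \<le> 1 / 2) \<and>
        exp (- (real n * (2 * s))) < tree_prob Q' n a UNIV"
    let ?E = "exp (- (real n * (2 * s)))"
    have "tree_prob Q' n a UNIV \<le> tree_prob Q' n a (?N \<union> F)"
      by (rule tree_prob_mono) (auto simp: F_def emp_offspring_measures)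
    also have "\<dots> \<le> tree_prob Q' n a ?N + tree_prob Q' n a F" by (rule tree_prob_Un)
    finally have 1: "?E \<le> tree_prob Q' n a ?N + tree_prob Q' n a F" using * by linarith
    have "M * exp (- (real n * \<alpha>)) = (M * exp (- (real n * (\<alpha> - 2 * s)))) * ?E"
      by (simp add: exp_add[symmetric] algebra_simps)
    also have "\<dots> \<le> 1 / 2 * ?E" using * by (intro mult_right_mono) auto
    finally have "M * exp (- (real n * \<alpha>)) \<le> 1 / 2 * ?E" .
    moreover have "tree_prob Q' n a F \<le> M * exp (- (real n * \<alpha>))" using * by blast
    ultimately have 2: "tree_prob Q' n a F \<le> ?E / 2" by linarith
    have "exp (- (real n * e)) = exp (- (real n * (e - 2 * s))) * ?E"
      by (simp add: exp_add[symmetric] algebra_simps)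
    also have "\<dots> \<le> 1 / 2 * ?E" using * by (intro mult_right_mono) auto
    finally have 3: "exp (- (real n * e)) \<le> tree_prob Q' n a ?N" using 1 2 by linarith
    have w: "exp (- (real n * (J + e))) * tree_weight (offspring_prob Q') t \<le> tree_weight (offspring_prob Q) t"
      if t: "t \<in> sized_trees n a" "emp t \<in> ?N" for t
    proof (cases "set_mset (tree_cnt t) \<subseteq> set_pmf \<nu>")
      case True
      have sz: "size (tree_cnt t) = n" using t by (simp add: sized_trees_def)
      have n0: "0 < n" using sz tree_cnt_nonempty[of t] by (metis nonempty_has_size)
      have "\<bar>measure_pmf.expectation (emp t) g - measure_pmf.expectation \<nu> g\<bar> < e"
        using t(2) by (auto simp: near_def \<Phi>'_def)
      then have "(\<Sum>x\<in>#tree_cnt t. g x) / real n \<le> J + e"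
        using expectation_g unfolding expectation_emp sz by linarith
      then have "(\<Sum>x\<in>#tree_cnt t. g x) \<le> real n * (J + e)"
        using n0 by (simp add: pos_divide_le_eq mult.commute)
      then have "tree_weight (offspring_prob Q') t * exp (- (real n * (J + e)))
          \<le> tree_weight (offspring_prob Q') t * exp (- (\<Sum>x\<in>#tree_cnt t. g x))"
        by (intro mult_left_mono tree_weight_nonneg offspring_prob_nonneg) simp
      then show ?thesis unfolding tree_weight_Q[OF True] by (simp only: mult.commute)
    next
      case False
      then show ?thesis
        using tree_weight_nonneg[of "offspring_prob Q" t] by (simp add: tree_weight_Q'_zero)
    qed
    have "exp (- (real n * (J + \<epsilon>))) = exp (- (real n * (J + e))) * exp (- (real n * e))"
      by (simp add: exp_add[symmetric] algebra_simps e_def)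
    also have "\<dots> \<le> exp (- (real n * (J + e))) * tree_prob Q' n a ?N"
      using 3 by (intro mult_left_mono) auto
    also have "\<dots> \<le> tree_prob Q n a ?N"
      unfolding tree_prob_def sum_distrib_left using w by (intro sum_mono) auto
    also have "\<dots> \<le> tree_prob Q n a {\<mu>. near \<Phi> \<epsilon> \<nu> \<mu>}"
      using near_mono[OF _ \<Phi>'(3) e(2)] by (intro tree_prob_mono) auto
    finally show "exp (- (real n * (J + \<epsilon>))) \<le> tree_prob Q n a {\<mu>. near \<Phi> \<epsilon> \<nu> \<mu>}" .
  qed
  then show ?thesis by blast
qed

text \<open>Not divided by the size, hence additive under gluing.\<close>

definition deviation :: "('a \<times> 'a list) pmf \<Rightarrow> ('a \<times> 'a list \<Rightarrow> real) \<Rightarrow> ('a \<times> 'a list) multiset \<Rightarrow> real" where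
  "deviation \<nu> f C = (\<Sum>x\<in>#C. f x - measure_pmf.expectation \<nu> f)"

lemma deviation_plus: "deviation \<nu> f (C + D) = deviation \<nu> f C + deviation \<nu> f D"
  by (simp add: deviation_def)

lemma deviation_tree:
  "deviation \<nu> f (tree_cnt t)
    = real (size (tree_cnt t)) * (measure_pmf.expectation (emp t) f - measure_pmf.expectation \<nu> f)"
proof -
  have "0 < real (size (tree_cnt t))" by (simp add: nonempty_has_size[symmetric])
  then show ?thesis by (simp add: deviation_def sum_mset_diff_real expectation_emp right_diff_distrib)
qed

text \<open>A chain: each application of \<open>h\<close> puts a block from \<open>B\<close> into
  one open leaf of the frame and the chain built so far into the other.\<close>

primrec glued_trees :: "('a gtree \<times> 'a gtree \<Rightarrow> 'a gtree) \<Rightarrow> 'a gtree set \<Rightarrow> 'a gtree \<Rightarrow> nat \<Rightarrow> 'a gtree set" where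
  "glued_trees h B t 0 = {t}"
| "glued_trees h B t (Suc n) = h ` (B \<times> glued_trees h B t n)"

text \<open>Because \<open>h\<close> is injective, different choices of blocks give different trees,
  so the weight sum is an exact power and nothing is lost to double counting. Sizes and deviations
  are additive along the chain.\<close>

lemma glued_trees:
  assumes h_all: "\<forall>t u. root_type t = a \<longrightarrow> root_type u = r \<longrightarrow>
      root_type (h (t, u)) = r \<and> tree_cnt (h (t, u)) = tree_cnt t + tree_cnt u + C"
    and inj: "inj_on h ({t. root_type t = a} \<times> {u. root_type u = r})"
    and B: "finite B" "B \<subseteq> sized_trees k a" and t: "root_type t = r"
  shows "finite (glued_trees h B t n)"
    and "u \<in> glued_trees h B t n \<Longrightarrow>
      root_type u = r \<and> size (tree_cnt u) = size (tree_cnt t) + n * (k + size C)"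
    and "(\<And>b. b \<in> B \<Longrightarrow> \<bar>deviation \<nu> f (tree_cnt b + C)\<bar> \<le> D) \<Longrightarrow> u \<in> glued_trees h B t n \<Longrightarrow>
      \<bar>deviation \<nu> f (tree_cnt u)\<bar> \<le> real n * D + \<bar>deviation \<nu> f (tree_cnt t)\<bar>"
    and "(\<Sum>u\<in>glued_trees h B t n. tree_weight q u)
      = ((\<Prod>x\<in>#C. q x) * (\<Sum>b\<in>B. tree_weight q b)) ^ n * tree_weight q t"
proof -
  note h = h_all[rule_format]
  show fin: "finite (glued_trees h B t n)" for n using B by (induction n) auto
  have root: "u \<in> glued_trees h B t n \<Longrightarrow>
      root_type u = r \<and> size (tree_cnt u) = size (tree_cnt t) + n * (k + size C)" for u n
  proof (induction n arbitrary: u)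
    case (Suc n)
    then obtain b v where bv: "b \<in> B" "v \<in> glued_trees h B t n" "u = h (b, v)" by auto
    have "root_type b = a" "size (tree_cnt b) = k" using B(2) bv(1) by (auto simp: sized_trees_def)
    then show ?case using h[of b v] Suc.IH[OF bv(2)] bv(3) by simp
  qed (use t in simp)
  then show "u \<in> glued_trees h B t n \<Longrightarrow>
      root_type u = r \<and> size (tree_cnt u) = size (tree_cnt t) + n * (k + size C)" .
  have rB: "root_type b = a" if "b \<in> B" for b using B(2) that by (auto simp: sized_trees_def)
  show "\<bar>deviation \<nu> f (tree_cnt u)\<bar> \<le> real n * D + \<bar>deviation \<nu> f (tree_cnt t)\<bar>"
    if D: "\<And>b. b \<in> B \<Longrightarrow> \<bar>deviation \<nu> f (tree_cnt b + C)\<bar> \<le> D" and "u \<in> glued_trees h B t n"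
    using that(2)
  proof (induction n arbitrary: u)
    case (Suc n)
    then obtain b v where bv: "b \<in> B" "v \<in> glued_trees h B t n" "u = h (b, v)" by auto
    have "tree_cnt u = (tree_cnt b + C) + tree_cnt v"
      using h[of b v] rB[OF bv(1)] root[OF bv(2)] bv(3) by (simp add: ac_simps)
    then have "deviation \<nu> f (tree_cnt u) = deviation \<nu> f (tree_cnt b + C) + deviation \<nu> f (tree_cnt v)"
      by (simp only: deviation_plus[of _ _ "tree_cnt b + C"])
    then show ?case using D[OF bv(1)] Suc.IH[OF bv(2)] by (simp add: distrib_right)
  qed simp
  show "(\<Sum>u\<in>glued_trees h B t n. tree_weight q u)
      = ((\<Prod>x\<in>#C. q x) * (\<Sum>b\<in>B. tree_weight q b)) ^ n * tree_weight q t"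
  proof (induction n)
    case (Suc n)
    have sub: "B \<times> glued_trees h B t n \<subseteq> {t. root_type t = a} \<times> {u. root_type u = r}"
      using rB root by auto
    have "(\<Sum>u\<in>glued_trees h B t (Suc n). tree_weight q u)
        = (\<Sum>(b, v)\<in>B \<times> glued_trees h B t n. tree_weight q (h (b, v)))"
      by (simp add: sum.reindex[OF inj_on_subset[OF inj sub]] case_prod_unfold)
    also have "\<dots> = (\<Sum>(b, v)\<in>B \<times> glued_trees h B t n. (\<Prod>x\<in>#C. q x) * tree_weight q b * tree_weight q v)"
    proof (intro sum.cong refl, clarify)
      fix b v assume "b \<in> B" "v \<in> glued_trees h B t n"
      then show "tree_weight q (h (b, v)) = (\<Prod>x\<in>#C. q x) * tree_weight q b * tree_weight q v"
        using h[of b v] rB root[of v n] by (simp add: tree_weight_def mult_ac)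
    qed
    also have "\<dots> = (\<Prod>x\<in>#C. q x) * (\<Sum>b\<in>B. tree_weight q b) * (\<Sum>v\<in>glued_trees h B t n. tree_weight q v)"
      by (simp add: sum.cartesian_product[symmetric] sum_distrib_left[symmetric] sum_distrib_right[symmetric])
    finally show ?case using Suc by (simp add: mult_ac)
  qed simp
qed

section \<open>From one block size to all large sizes\<close>

context surviving_types
begin

text \<open>Of the distance \<eta>, a block uses one half, the frame a quarter and the starting tree
  a quarter. Of the rate \<epsilon>, the frames use one half and the starting tree the
  other.\<close>

lemma glued_tree_prob:
  assumes r: "r \<in> Xr" and \<Phi>: "finite \<Phi>" and \<eta>: "0 < \<eta>" and \<epsilon>: "0 < \<epsilon>" and J0: "0 \<le> J"
    and blocks: "\<exists>\<^sub>F n in sequentially. exp (- (real n * J)) \<le> tree_prob Q n a {\<mu>. near \<Phi> (\<eta> / 2) \<nu> \<mu>}"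
  shows "\<forall>\<^sub>F n in sequentially. 0 < tree_prob Q n r UNIV \<longrightarrow>
    exp (- (real n * (J + \<epsilon>))) \<le> tree_prob Q n r {\<mu>. near \<Phi> \<eta> \<nu> \<mu>}"
proof -
  let ?q = "offspring_prob Q"
  obtain C h where C: "pos_mset Q C" and h: "\<forall>t u. root_type t = a \<longrightarrow> root_type u = r \<longrightarrow>
      root_type (h (t, u)) = r \<and> tree_cnt (h (t, u)) = tree_cnt t + tree_cnt u + C"
    and inj: "inj_on h ({t. root_type t = a} \<times> {u. root_type u = r})"
    using hole2_hole[OF r, of a] unfolding hole2_def by blast
  define wC where "wC = (\<Prod>x\<in>#C. ?q x)"
  have wC: "0 < wC"
    using C unfolding wC_def by (induction C) (auto simp: pos_mset_def)
  have ev1: "\<forall>\<^sub>F k in sequentially. - ln wC \<le> real k * (\<epsilon> / 2)"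
  proof -
    have "filterlim (\<lambda>k. real k * (\<epsilon> / 2)) at_top sequentially"
      using \<epsilon> by (intro filterlim_at_top_mult_tendsto_pos[OF tendsto_const _ filterlim_real_sequentially]) simp
    then show ?thesis unfolding filterlim_at_top by (rule spec)
  qed
  have ev2: "\<forall>\<^sub>F k in sequentially. \<forall>f\<in>\<Phi>. \<bar>deviation \<nu> f C\<bar> \<le> real k * (\<eta> / 4)"
  proof (intro eventually_ball_finite ballI \<Phi>)
    fix f
    have "filterlim (\<lambda>k. real k * (\<eta> / 4)) at_top sequentially"
      using \<eta> by (intro filterlim_at_top_mult_tendsto_pos[OF tendsto_const _ filterlim_real_sequentially]) simp
    then show "\<forall>\<^sub>F k in sequentially. \<bar>deviation \<nu> f C\<bar> \<le> real k * (\<eta> / 4)"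
      unfolding filterlim_at_top by (rule spec)
  qed
  \<comment> \<open>One size, fixed from here on, at which blocks are likely enough and which is so
    large that the weight and the deviation of a frame are negligible beside it.\<close>
  obtain k where k: "exp (- (real k * J)) \<le> tree_prob Q k a {\<mu>. near \<Phi> (\<eta> / 2) \<nu> \<mu>}"
    "- ln wC \<le> real k * (\<epsilon> / 2)" "\<And>f. f \<in> \<Phi> \<Longrightarrow> \<bar>deviation \<nu> f C\<bar> \<le> real k * (\<eta> / 4)" "1 \<le> k"
    using frequently_ex[OF frequently_eventually_conj[OF blocks eventually_conj[OF ev1 eventually_conj[OF ev2 eventually_ge_at_top[of 1]]]]]
    by blast
  define d where "d = k + size C"
  have d: "1 \<le> d" using k(4) by (simp add: d_def)
  define B where "B = {t \<in> sized_trees k a. emp t \<in> {\<mu>. near \<Phi> (\<eta> / 2) \<nu> \<mu>}}"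
  have B: "finite B" "B \<subseteq> sized_trees k a" by (auto simp: B_def)
  have block: "exp (- (real d * (J + \<epsilon> / 2))) \<le> wC * (\<Sum>b\<in>B. tree_weight ?q b)"
  proof -
    have "- (real d * (J + \<epsilon> / 2)) \<le> ln wC - real k * J"
    proof -
      have "real k * (J + \<epsilon> / 2) \<le> real d * (J + \<epsilon> / 2)"
        using J0 \<epsilon> by (intro mult_right_mono) (auto simp: d_def)
      then show ?thesis using k(2) by (simp add: distrib_left)
    qed
    then have "exp (- (real d * (J + \<epsilon> / 2))) \<le> exp (ln wC - real k * J)" by simp
    also have "\<dots> = wC * exp (- (real k * J))" using wC by (simp add: exp_diff exp_minus divide_inverse)
    also have "\<dots> \<le> wC * (\<Sum>b\<in>B. tree_weight ?q b)"
      using k(1) wC unfolding tree_prob_def B_def by (intro mult_left_mono) auto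
    finally show ?thesis .
  qed
  have dev: "\<bar>deviation \<nu> f (tree_cnt b + C)\<bar> \<le> real d * (3 / 4 * \<eta>)" if "b \<in> B" "f \<in> \<Phi>" for b f
  proof -
    have "\<bar>measure_pmf.expectation (emp b) f - measure_pmf.expectation \<nu> f\<bar> < \<eta> / 2" "size (tree_cnt b) = k"
      using that by (auto simp: B_def near_def sized_trees_def)
    then have "\<bar>deviation \<nu> f (tree_cnt b)\<bar> \<le> real k * (\<eta> / 2)"
      unfolding deviation_tree abs_mult by (intro mult_mono) auto
    then have "\<bar>deviation \<nu> f (tree_cnt b + C)\<bar> \<le> real k * (\<eta> / 2) + real k * (\<eta> / 4)"
      using k(3)[OF that(2)] unfolding deviation_plus by (intro order_trans[OF abs_triangle_ineq add_mono])
    also have "\<dots> = real k * (3 / 4 * \<eta>)" by (simp add: field_simps)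
    finally have "\<bar>deviation \<nu> f (tree_cnt b + C)\<bar> \<le> real k * (3 / 4 * \<eta>)" .
    also have "\<dots> \<le> real d * (3 / 4 * \<eta>)" using \<eta> by (intro mult_right_mono) (auto simp: d_def)
    finally show ?thesis .
  qed
  \<comment> \<open>One starting tree is fixed for each residue modulo \<open>d\<close>. For a
    residue that no tree attains the choice is arbitrary, so the weight estimate below is guarded by
    \<open>ok i (sel i)\<close>.\<close>
  define ok where "ok i t \<longleftrightarrow> root_type t = r \<and> 0 < tree_weight ?q t \<and> size (tree_cnt t) mod d = i" for i t
  define sel where "sel i = (SOME t. ok i t)" for i
  have sel: "ok i (sel i)" if "ok i t" for i t unfolding sel_def using that by (rule someI)
  have "\<forall>\<^sub>F n in sequentially. \<forall>i\<in>{..<d}. size (tree_cnt (sel i)) \<le> n \<and>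
      (\<forall>f\<in>\<Phi>. \<bar>deviation \<nu> f (tree_cnt (sel i))\<bar> < real n * (\<eta> / 4)) \<and>
      (ok i (sel i) \<longrightarrow> 1 * exp (- (real n * (\<epsilon> / 2))) \<le> tree_weight ?q (sel i))"
  proof (intro eventually_ball_finite ballI eventually_conj \<Phi>)
    fix i f
    show "\<forall>\<^sub>F n in sequentially. size (tree_cnt (sel i)) \<le> n" by (rule eventually_ge_at_top)
    have "filterlim (\<lambda>k. real k * (\<eta> / 4)) at_top sequentially"
      using \<eta> by (intro filterlim_at_top_mult_tendsto_pos[OF tendsto_const _ filterlim_real_sequentially]) simp
    then show "\<forall>\<^sub>F n in sequentially. \<bar>deviation \<nu> f (tree_cnt (sel i))\<bar> < real n * (\<eta> / 4)"
      unfolding filterlim_at_top_dense by (rule spec)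
    show "\<forall>\<^sub>F n in sequentially. ok i (sel i) \<longrightarrow> 1 * exp (- (real n * (\<epsilon> / 2))) \<le> tree_weight ?q (sel i)"
    proof (cases "ok i (sel i)")
      case True
      then show ?thesis using \<epsilon> eventually_exp_le[of "\<epsilon> / 2" "tree_weight ?q (sel i)" 1] by (simp add: ok_def)
    qed simp
  qed simp
  then show ?thesis
  proof eventually_elim
    case (elim n)
    show ?case
    proof
      assume "0 < tree_prob Q n r UNIV"
      then obtain t where t: "t \<in> sized_trees n r" "0 < tree_weight ?q t"
        unfolding tree_prob_def by (metis (no_types, lifting) mem_Collect_eq not_less sum_nonpos)
      define i where "i = n mod d"
      have i: "i < d" using d by (simp add: i_def)
      define u where "u = sel i"
      \<comment> \<open>A tree of size \<open>n\<close> itself shows that its residue is attained.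
        The starting tree then exists and \<open>n\<close> minus its size is a multiple of
        \<open>d\<close>, so the period of the sizes never has to be determined.\<close>
      have "ok i t" using t by (simp add: ok_def i_def sized_trees_def)
      then have u: "ok i u" unfolding u_def by (rule sel)
      have el: "size (tree_cnt u) \<le> n" "\<And>f. f \<in> \<Phi> \<Longrightarrow> \<bar>deviation \<nu> f (tree_cnt u)\<bar> < real n * (\<eta> / 4)"
        "exp (- (real n * (\<epsilon> / 2))) \<le> tree_weight ?q u"
        using elim i u by (auto simp: u_def)
      have "size (tree_cnt u) mod d = n mod d" using u by (simp add: ok_def i_def)
      then have "d dvd n - size (tree_cnt u)" using el(1) by (metis mod_eq_dvd_iff_nat)
      then obtain l where "n - size (tree_cnt u) = d * l" by (rule dvdE)
      then have l: "n = size (tree_cnt u) + l * d" using el(1) by (simp add: mult.commute)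
      have ru: "root_type u = r" using u by (simp add: ok_def)
      note gl = glued_trees[OF h inj B ru, where n = l]
      have n0: "0 < real n" using t(1) tree_cnt_nonempty[of t] by (auto simp: sized_trees_def nonempty_has_size[symmetric])
      have sub: "glued_trees h B u l \<subseteq> {t \<in> sized_trees n r. emp t \<in> {\<mu>. near \<Phi> \<eta> \<nu> \<mu>}}"
      proof
        fix v assume v: "v \<in> glued_trees h B u l"
        have v': "root_type v = r" "size (tree_cnt v) = n" using gl(2)[OF v] l by (auto simp: d_def)
        have "\<bar>measure_pmf.expectation (emp v) f - measure_pmf.expectation \<nu> f\<bar> < \<eta>" if f: "f \<in> \<Phi>" for f
        proof -
          have "\<bar>deviation \<nu> f (tree_cnt v)\<bar> \<le> real l * (real d * (3 / 4 * \<eta>)) + \<bar>deviation \<nu> f (tree_cnt u)\<bar>"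
            by (rule gl(3)[OF _ v]) (rule dev[OF _ f])
          also have "\<dots> < real l * (real d * (3 / 4 * \<eta>)) + real n * (\<eta> / 4)" using el(2)[OF f] by simp
          also have "real l * (real d * (3 / 4 * \<eta>)) \<le> real n * (3 / 4 * \<eta>)"
          proof -
            have "real l * real d \<le> real n" using l by (metis le_add2 of_nat_le_iff of_nat_mult)
            then have "real l * real d * (3 / 4 * \<eta>) \<le> real n * (3 / 4 * \<eta>)" using \<eta> by (intro mult_right_mono) auto
            then show ?thesis by (simp only: mult.assoc)
          qed
          finally have "\<bar>deviation \<nu> f (tree_cnt v)\<bar> < real n * \<eta>" by (simp add: algebra_simps)
          then have "real n * \<bar>measure_pmf.expectation (emp v) f - measure_pmf.expectation \<nu> f\<bar> < real n * \<eta>"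
            unfolding deviation_tree v' abs_mult by simp
          then show ?thesis using n0 by (simp only: mult_less_cancel_left_pos)
        qed
        then show "v \<in> {t \<in> sized_trees n r. emp t \<in> {\<mu>. near \<Phi> \<eta> \<nu> \<mu>}}"
          using v' by (simp add: sized_trees_def near_def)
      qed
      have "exp (- (real n * (J + \<epsilon>))) = exp (- (real n * (J + \<epsilon> / 2))) * exp (- (real n * (\<epsilon> / 2)))"
        by (simp add: exp_add[symmetric] algebra_simps)
      also have "\<dots> \<le> exp (- (real l * (real d * (J + \<epsilon> / 2)))) * tree_weight ?q u"
      proof (intro mult_mono el(3))
        have "real l * real d \<le> real n" using l by (metis le_add2 of_nat_le_iff of_nat_mult)
        then have "real l * real d * (J + \<epsilon> / 2) \<le> real n * (J + \<epsilon> / 2)" using \<epsilon> J0 by (intro mult_right_mono) auto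
        then show "exp (- (real n * (J + \<epsilon> / 2))) \<le> exp (- (real l * (real d * (J + \<epsilon> / 2))))"
          by (simp only: mult.assoc exp_le_cancel_iff neg_le_iff_le)
      qed auto
      also have "\<dots> = exp (- (real d * (J + \<epsilon> / 2))) ^ l * tree_weight ?q u"
        by (simp add: exp_of_nat_mult[symmetric])
      also have "\<dots> \<le> (wC * (\<Sum>b\<in>B. tree_weight ?q b)) ^ l * tree_weight ?q u"
        using block by (intro mult_right_mono power_mono tree_weight_nonneg) auto
      also have "\<dots> = (\<Sum>v\<in>glued_trees h B u l. tree_weight ?q v)"
        unfolding wC_def by (rule gl(4)[symmetric])
      also have "\<dots> \<le> tree_prob Q n r {\<mu>. near \<Phi> \<eta> \<nu> \<mu>}"
        unfolding tree_prob_def by (intro tree_weight_mono_sum sub) auto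
      finally show "exp (- (real n * (J + \<epsilon>))) \<le> tree_prob Q n r {\<mu>. near \<Phi> \<eta> \<nu> \<mu>}" .
    qed
  qed
qed

lemma exists_conditional_kernel:
  assumes "finite (set_pmf \<nu>)" "rich (set_pmf \<nu>)"
  shows "\<exists>Q'. \<forall>a c. pmf (Q' a) c = pmf \<nu> (a, c) / pmf (type_marginal \<nu>) a"
proof -
  have "\<exists>p. \<forall>c. pmf p c = pmf \<nu> (a, c) / pmf (type_marginal \<nu>) a" for a
  proof (rule exists_pmf_finite_support)
    let ?C = "{c. (a, c) \<in> set_pmf \<nu>}"
    obtain ts where "\<tau> a = GNode a ts" using root_\<tau>[of a] by (cases "\<tau> a") auto
    then have "(a, map root_type ts) \<in># tree_cnt (\<tau> a)" by simp
    then have "(a, map root_type ts) \<in> set_pmf \<nu>" using assms(2) unfolding rich_def by blast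
    then have "0 < pmf \<nu> (a, map root_type ts)" by (rule pmf_positive)
    then have pos: "0 < pmf (type_marginal \<nu>) a" using pmf_type_marginal_ge[of \<nu> a "map root_type ts"] by linarith
    have "?C \<subseteq> snd ` set_pmf \<nu>" by force
    then show fin: "finite ?C" using assms(1) finite_subset by blast
    have "(\<Sum>c\<in>?C. pmf \<nu> (a, c)) = (\<Sum>x\<in>Pair a ` ?C. pmf \<nu> x)"
      by (subst sum.reindex) (auto simp: inj_on_def)
    also have "\<dots> = measure \<nu> (Pair a ` ?C)" using fin by (simp add: measure_measure_pmf_finite)
    also have "Pair a ` ?C = fst -` {a} \<inter> set_pmf \<nu>" by auto
    also have "measure \<nu> (fst -` {a} \<inter> set_pmf \<nu>) = measure \<nu> (fst -` {a})" by (rule measure_Int_set_pmf)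
    also have "\<dots> = pmf (type_marginal \<nu>) a" by (simp add: type_marginal_def pmf_map)
    finally show "(\<Sum>c\<in>?C. pmf \<nu> (a, c) / pmf (type_marginal \<nu>) a) = 1"
      using pos by (simp add: sum_divide_distrib[symmetric])
  qed (auto simp: set_pmf_iff)
  then have "\<forall>a. \<exists>p. \<forall>c. pmf p c = pmf \<nu> (a, c) / pmf (type_marginal \<nu>) a" by blast
  from choice[OF this] show ?thesis .
qed

lemma tree_prob_lower_bound:
  assumes r: "r \<in> Xr" and \<nu>: "\<nu> \<in> offspring_measures" "offspring_rate Q \<nu> \<le> ereal J"
    and \<Phi>: "finite \<Phi>" "\<Phi> \<subseteq> offspring_test_functions" and \<eta>: "0 < \<eta>" and \<epsilon>: "0 < \<epsilon>"
  shows "\<forall>\<^sub>F n in sequentially. 0 < tree_prob Q n r UNIV \<longrightarrow>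
    exp (- (real n * (J + \<epsilon>))) \<le> tree_prob Q n r {\<mu>. near \<Phi> \<eta> \<nu> \<mu>}"
proof -
  \<comment> \<open>The approximation and the growth estimate each use \<open>e\<close> twice over:
    \<open>J + e + e\<close> stays below \<open>J + \<epsilon> / 2\<close>, and the two distances
    add up to at most \<open>\<eta> / 2\<close>.\<close>
  define e where "e = min (\<epsilon> / 4) (\<eta> / 4)"
  have e: "0 < e" "e \<le> \<epsilon> / 4" "e \<le> \<eta> / 4" using \<epsilon> \<eta> by (auto simp: e_def)
  have J0: "0 \<le> J" using order_trans[OF offspring_rate_nonneg \<nu>(2)] by simp
  obtain \<nu>' where \<nu>': "finite (set_pmf \<nu>')" "rich (set_pmf \<nu>')" "offspring_rate Q \<nu>' \<le> ereal (J + e)" "near \<Phi> e \<nu> \<nu>'"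
    using exists_rich_approximation[OF \<nu> \<Phi> e(1)] by blast
  obtain Q' where Q': "\<And>a c. pmf (Q' a) c = pmf \<nu>' (a, c) / pmf (type_marginal \<nu>') a"
    using exists_conditional_kernel[OF \<nu>'(1,2)] by blast
  interpret ck: conditional_kernel Q Xr Xt K t0 \<nu>' Q' "J + e"
    by unfold_locales (use \<nu>' Q' in auto)
  obtain a where a: "\<exists>\<^sub>F n in sequentially. exp (- (real n * (J + e + e))) \<le> tree_prob Q n a {\<mu>. near \<Phi> e \<nu>' \<mu>}"
    using ck.exists_near_growth[OF \<Phi> e(1)] by blast
  have "\<exists>\<^sub>F n in sequentially. exp (- (real n * (J + \<epsilon> / 2))) \<le> tree_prob Q n a {\<mu>. near \<Phi> (\<eta> / 2) \<nu> \<mu>}"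
    using a
  proof (rule frequently_elim1)
    fix n assume *: "exp (- (real n * (J + e + e))) \<le> tree_prob Q n a {\<mu>. near \<Phi> e \<nu>' \<mu>}"
    have "real n * (J + e + e) \<le> real n * (J + \<epsilon> / 2)" using e by (intro mult_left_mono) auto
    then have "exp (- (real n * (J + \<epsilon> / 2))) \<le> exp (- (real n * (J + e + e)))" by simp
    also note *
    also have "tree_prob Q n a {\<mu>. near \<Phi> e \<nu>' \<mu>} \<le> tree_prob Q n a {\<mu>. near \<Phi> (\<eta> / 2) \<nu> \<mu>}"
    proof (rule tree_prob_mono)
      fix t assume "emp t \<in> {\<mu>. near \<Phi> e \<nu>' \<mu>}"
      then have "near \<Phi> e \<nu>' (emp t)" by simp
      from near_trans[OF \<nu>'(4) this] have "near \<Phi> (e + e) \<nu> (emp t)" .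
      then show "emp t \<in> {\<mu>. near \<Phi> (\<eta> / 2) \<nu> \<mu>}" using near_mono[OF _ subset_refl, of \<Phi> "e + e" \<nu> "emp t" "\<eta> / 2"] e by simp
    qed
    finally show "exp (- (real n * (J + \<epsilon> / 2))) \<le> tree_prob Q n a {\<mu>. near \<Phi> (\<eta> / 2) \<nu> \<mu>}" .
  qed
  note blocks = this
  have "0 < \<epsilon> / 2" "0 \<le> J + \<epsilon> / 2" using \<epsilon> J0 by auto
  from glued_tree_prob[OF r \<Phi>(1) \<eta> this blocks] show ?thesis
    by (simp only: add.assoc field_sum_of_halves)
qed

end

section \<open>The conditioned tree\<close>

lemma tree_prob_le_1:
  fixes Q :: "'a::finite \<Rightarrow> 'a list pmf"
  shows "tree_prob Q n a B \<le> 1"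
  using tree_prob_chernoff[where f = "\<lambda>_. 0" and Q = Q and n = n and a = a and B = B and \<alpha> = 0] by simp

context
  fixes \<mu> :: "'a::finite pmf" and Q :: "'a \<Rightarrow> 'a list pmf"
begin

definition root_prob :: "nat \<Rightarrow> ('a \<times> 'a list) pmf set \<Rightarrow> real" where
  "root_prob n B = (\<Sum>a\<in>UNIV. pmf \<mu> a * tree_prob Q n a B)"

lemma root_prob_nonneg: "0 \<le> root_prob n B"
  unfolding root_prob_def by (intro sum_nonneg mult_nonneg_nonneg tree_prob_nonneg) simp

lemma root_prob_le:
  assumes "\<And>a. tree_prob Q n a B \<le> M" shows "root_prob n B \<le> M"
proof -
  have "root_prob n B \<le> (\<Sum>a\<in>UNIV. pmf \<mu> a * M)"
    unfolding root_prob_def by (intro sum_mono mult_left_mono assms) simp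
  also have "\<dots> = M" by (simp add: sum_distrib_right[symmetric] sum_pmf_eq_1)
  finally show ?thesis .
qed

lemma root_prob_ge: "pmf \<mu> a * tree_prob Q n a B \<le> root_prob n B"
  unfolding root_prob_def by (intro member_le_sum) (auto intro!: mult_nonneg_nonneg tree_prob_nonneg)

lemma root_prob_0: "root_prob 0 B = 0"
proof -
  have "sized_trees 0 a = {}" for a :: 'a by (simp add: sized_trees_def)
  then show ?thesis by (simp add: root_prob_def tree_prob_def)
qed

lemma prob_tree_size: "\<P>(t in gw_law \<mu> Q. tree_size t = enat n) = root_prob n UNIV"
  using prob_gw_law[of \<mu> Q UNIV n] by (simp add: root_prob_def)

lemma cond_prob_gw_law:
  "\<P>(t in gw_law \<mu> Q. empirical_offspring_measure t \<in> B \<bar> tree_size t = enat n)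
    = root_prob n B / root_prob n UNIV"
  unfolding cond_prob_def prob_tree_size prob_gw_law root_prob_def ..

text \<open>Beyond the size bound for transient roots, a possible size must come from a recurrent
  root. Infinitely many possible sizes provide such a size, and with it the finite tree
  \<open>t0\<close>.\<close>

lemma exists_surviving_types:
  assumes "weakly_irreducible_gw Q" "critical_gw Q" "finite_exponential_moments Q"
    and inf: "infinite {n. 0 < root_prob n UNIV}"
  obtains Xr Xt K t0 where "surviving_types Q Xr Xt K t0"
    and "\<forall>\<^sub>F n in sequentially. 0 < root_prob n UNIV \<longrightarrow> (\<exists>a\<in>Xr. 0 < pmf \<mu> a \<and> 0 < tree_prob Q n a UNIV)"
proof -
  obtain Xr Xt K where X: "weakly_irreducible_wrt (mean_matrix Q) Xr Xt"
    "\<forall>b. \<forall>c\<in>set_pmf (Q b). (\<Sum>a\<in>Xt. count_list c a) \<le> K"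
    using assms(1) unfolding weakly_irreducible_gw_def by (elim exE conjE)
  interpret recurrent_types Q Xr Xt K by unfold_locales (use assms X in auto)
  obtain N where N: "\<And>t. root_type t \<in> Xt \<Longrightarrow> pos_mset Q (tree_cnt t) \<Longrightarrow> size (tree_cnt t) \<le> N"
    using transient_trees_bounded by blast
  have pos_tree: "\<exists>t\<in>sized_trees n a. pos_mset Q (tree_cnt t)" if "0 < tree_prob Q n a UNIV" for n a
  proof -
    have "\<exists>t\<in>sized_trees n a. 0 < tree_weight (offspring_prob Q) t"
      using that unfolding tree_prob_def by (metis (no_types, lifting) mem_Collect_eq not_less sum_nonpos)
    then obtain t where t: "t \<in> sized_trees n a" "0 < tree_weight (offspring_prob Q) t" by blast
    have "0 < offspring_prob Q x" if "x \<in># tree_cnt t" for x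
    proof (rule ccontr)
      assume "\<not> 0 < offspring_prob Q x"
      then have "offspring_prob Q x = 0" using offspring_prob_nonneg[of Q x] by linarith
      then have "0 \<in># image_mset (offspring_prob Q) (tree_cnt t)" using that by (metis image_eqI set_image_mset)
      then have "tree_weight (offspring_prob Q) t = 0" by (simp only: tree_weight_def prod_mset_zero_iff)
      then show False using t by simp
    qed
    then have "pos_mset Q (tree_cnt t)" unfolding pos_mset_def by (rule ballI)
    then show ?thesis using t(1) by (rule bexI)
  qed
  have ev: "\<exists>a\<in>Xr. 0 < pmf \<mu> a \<and> 0 < tree_prob Q n a UNIV" if n: "N < n" "0 < root_prob n UNIV" for n
  proof -
    obtain a where "0 < pmf \<mu> a * tree_prob Q n a UNIV"
      using n(2) unfolding root_prob_def by (metis (no_types, lifting) not_less sum_nonpos)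
    then have a: "0 < pmf \<mu> a" "0 < tree_prob Q n a UNIV"
      using tree_prob_nonneg[of Q n a UNIV] by (auto simp: zero_less_mult_iff)
    obtain t where t: "t \<in> sized_trees n a" "pos_mset Q (tree_cnt t)" using pos_tree[OF a(2)] by blast
    have "a \<in> Xr" using N[of t] t n(1) in_Xt_iff[of a] by (auto simp: sized_trees_def)
    then show ?thesis using a by blast
  qed
  obtain n where n: "N < n" "0 < root_prob n UNIV"
    using inf unfolding infinite_nat_iff_unbounded by blast
  obtain a where a: "a \<in> Xr" "0 < tree_prob Q n a UNIV" using ev[OF n] by blast
  obtain t0 where "t0 \<in> sized_trees n a" "pos_mset Q (tree_cnt t0)" using pos_tree[OF a(2)] by blast
  then have "surviving_types Q Xr Xt K t0"
    using a(1) by unfold_locales (auto simp: sized_trees_def)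
  moreover have "\<forall>\<^sub>F n in sequentially. 0 < root_prob n UNIV \<longrightarrow> (\<exists>a\<in>Xr. 0 < pmf \<mu> a \<and> 0 < tree_prob Q n a UNIV)"
    using eventually_gt_at_top[of N] by eventually_elim (use ev in blast)
  ultimately show ?thesis by (rule that)
qed

text \<open>The recurrent root type that realises \<open>n\<close> may vary with \<open>n\<close>.
  As there are finitely many types, the estimates hold for all of them eventually, and positive root
  probabilities are absorbed by half of \<epsilon>.\<close>

lemma root_prob_lower_bound:
  assumes "weakly_irreducible_gw Q" "critical_gw Q" "finite_exponential_moments Q"
    and inf: "infinite {n. 0 < root_prob n UNIV}"
    and G: "openin offspring_topology G" "\<nu> \<in> G" "offspring_rate Q \<nu> \<le> ereal J" and \<epsilon>: "0 < \<epsilon>"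
  shows "\<forall>\<^sub>F n in sequentially. 0 < root_prob n UNIV \<longrightarrow> exp (- (real n * (J + \<epsilon>))) \<le> root_prob n G"
proof -
  obtain Xr Xt K t0 where st: "surviving_types Q Xr Xt K t0"
    and rec: "\<forall>\<^sub>F n in sequentially. 0 < root_prob n UNIV \<longrightarrow> (\<exists>a\<in>Xr. 0 < pmf \<mu> a \<and> 0 < tree_prob Q n a UNIV)"
    using exists_surviving_types[OF assms(1-4)] by blast
  interpret surviving_types Q Xr Xt K t0 by (rule st)
  have \<nu>M: "\<nu> \<in> offspring_measures" using openin_subset[OF G(1)] G(2) by (auto simp: topspace_offspring_topology)
  obtain \<Phi> \<eta> where \<Phi>: "finite \<Phi>" "\<Phi> \<subseteq> offspring_test_functions" "0 < \<eta>"
    "\<And>\<nu>'. \<nu>' \<in> offspring_measures \<Longrightarrow> near \<Phi> \<eta> \<nu> \<nu>' \<Longrightarrow> \<nu>' \<in> G"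
    using openin_offspring_nbhd[OF G(1,2)] by blast
  have \<epsilon>2: "0 < \<epsilon> / 2" using \<epsilon> by simp
  have lb: "\<forall>\<^sub>F n in sequentially. \<forall>a\<in>Xr. 0 < tree_prob Q n a UNIV \<longrightarrow>
      exp (- (real n * (J + \<epsilon> / 2))) \<le> tree_prob Q n a {\<mu>. near \<Phi> \<eta> \<nu> \<mu>}"
    by (intro eventually_ball_finite ballI tree_prob_lower_bound[OF _ \<nu>M G(3) \<Phi>(1-3) \<epsilon>2]) simp_all
  have mu: "\<forall>\<^sub>F n in sequentially. \<forall>a\<in>UNIV. 0 < pmf \<mu> a \<longrightarrow> 1 * exp (- (real n * (\<epsilon> / 2))) \<le> pmf \<mu> a"
  proof (intro eventually_ball_finite ballI)
    fix a show "\<forall>\<^sub>F n in sequentially. 0 < pmf \<mu> a \<longrightarrow> 1 * exp (- (real n * (\<epsilon> / 2))) \<le> pmf \<mu> a"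
      using eventually_exp_le[OF \<epsilon>2, of "pmf \<mu> a" 1] by (cases "0 < pmf \<mu> a") simp_all
  qed simp
  show ?thesis using rec lb mu
  proof eventually_elim
    case (elim n)
    show ?case
    proof
      assume "0 < root_prob n UNIV"
      then obtain a where a: "a \<in> Xr" "0 < pmf \<mu> a" "0 < tree_prob Q n a UNIV" using elim(1) by blast
      have "exp (- (real n * (J + \<epsilon>))) = exp (- (real n * (\<epsilon> / 2))) * exp (- (real n * (J + \<epsilon> / 2)))"
        by (simp add: exp_add[symmetric] algebra_simps)
      also have "\<dots> \<le> pmf \<mu> a * tree_prob Q n a {\<mu>. near \<Phi> \<eta> \<nu> \<mu>}"
        using elim(2,3) a by (intro mult_mono) auto
      also have "\<dots> \<le> pmf \<mu> a * tree_prob Q n a G"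
        by (intro mult_left_mono tree_prob_mono) (auto intro: \<Phi>(4) emp_offspring_measures)
      also have "\<dots> \<le> root_prob n G" by (rule root_prob_ge)
      finally show "exp (- (real n * (J + \<epsilon>))) \<le> root_prob n G" .
    qed
  qed
qed

end

theorem theorem2p2:
  fixes \<mu> :: "'a::finite pmf"
    and Q :: "'a \<Rightarrow> 'a list pmf"
    and S :: "nat set"
  assumes "weakly_irreducible_gw Q"
    and "critical_gw Q"
    and "finite_exponential_moments Q"
    and "S = {n. \<P>(t in gw_law \<mu> Q. tree_size t = enat n) > 0}"
    and "infinite S"
  shows "large_deviation_principle offspring_topology S
           (\<lambda>n B. \<P>(t in gw_law \<mu> Q. empirical_offspring_measure t \<in> B \<bar> tree_size t = enat n))
           (\<lambda>n. real n)
           (offspring_rate Q)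
       \<and> good_rate_function offspring_topology (offspring_rate Q)
       \<and> convex_on_pmfs offspring_measures (offspring_rate Q)"
proof -
  let ?r = "root_prob \<mu> Q"
  let ?X = "offspring_topology :: ('a \<times> 'a list) pmf topology"
  let ?L = "inf at_top (principal S) :: nat filter"
  let ?P = "\<lambda>n B. \<P>(t in gw_law \<mu> Q. empirical_offspring_measure t \<in> B \<bar> tree_size t = enat n)"
  have P: "?P n B = ?r n B / ?r n UNIV" for n B by (rule cond_prob_gw_law)
  have S: "n \<in> S \<longleftrightarrow> 0 < ?r n UNIV" for n unfolding assms(4) prob_tree_size by (rule mem_Collect_eq)
  have inf: "infinite {n. 0 < ?r n UNIV}" 
  proof -
    have "S = {n. 0 < ?r n UNIV}" unfolding assms(4) prob_tree_size ..
    from assms(5)[unfolded this] show ?thesis .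
  qed
  \<comment> \<open>No tree is empty, so 0 is not in \<open>S\<close> and the speed is positive
    there.\<close>
  have S0: "0 < real n" if "n \<in> S" for n
  proof -
    have "n \<noteq> 0"
    proof
      assume "n = 0"
      then have "0 < ?r 0 UNIV" using that unfolding S by simp
      then show False unfolding root_prob_0 by simp
    qed
    then show ?thesis by simp
  qed
  have one: "?r n UNIV \<le> 1" for n by (intro root_prob_le tree_prob_le_1)
  obtain \<nu>0 where \<nu>0: "\<nu>0 \<in> offspring_measures" "offspring_rate Q \<nu>0 \<le> ereal 0"
  proof -
    obtain Xr Xt K t0 where st: "surviving_types Q Xr Xt K t0"
      by (rule exists_surviving_types[OF assms(1-3) inf])
    show thesis by (rule bexE[OF surviving_types.exists_zero_of_rate[OF st]]) (rule that)
  qed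
  \<comment> \<open>The lower bound for the whole space, at a point of rate zero. It serves the
    upper bound, where the normaliser stands in the denominator.\<close>
  have denom: "\<forall>\<^sub>F n in sequentially. n \<in> S \<longrightarrow> exp (- (real n * \<epsilon>)) \<le> ?r n UNIV" if "0 < \<epsilon>" for \<epsilon>
  proof -
    have "\<nu>0 \<in> topspace ?X" using \<nu>0 by (simp add: topspace_offspring_topology)
    then have "\<forall>\<^sub>F n in sequentially. 0 < ?r n UNIV \<longrightarrow> exp (- (real n * (0 + \<epsilon>))) \<le> ?r n (topspace ?X)"
      by (intro root_prob_lower_bound[OF assms(1-3) inf openin_topspace _ \<nu>0(2) that])
    then show ?thesis
    proof eventually_elim
      case (elim n)
      show ?case
      proof
        assume "n \<in> S"
        then have "exp (- (real n * (0 + \<epsilon>))) \<le> ?r n (topspace ?X)" using elim unfolding S by (rule mp[rotated])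
        also have "?r n (topspace ?X) \<le> ?r n UNIV"
          unfolding root_prob_def by (intro sum_mono mult_left_mono tree_prob_mono UNIV_I pmf_nonneg)
        finally show "exp (- (real n * \<epsilon>)) \<le> ?r n UNIV" by (simp only: add_0)
      qed
    qed
  qed
  have upper: "Limsup ?L (\<lambda>n. ereal (1 / real n) * log_prob (?P n F)) \<le> - (INF x\<in>F. offspring_rate Q x)"
    if F: "closedin ?X F" for F
    unfolding Limsup_le_iff
  proof (intro allI impI)
    fix y assume y: "- (INF x\<in>F. offspring_rate Q x) < y"
    then have "- y < (INF x\<in>F. offspring_rate Q x)" by (simp add: ereal_uminus_less_reorder)
    from ereal_dense2[OF this] obtain \<alpha> where \<alpha>: "- y < ereal \<alpha>" "ereal \<alpha> < (INF x\<in>F. offspring_rate Q x)"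
      by (elim exE conjE)
    from ereal_dense2[OF \<alpha>(1)] obtain \<alpha>' where \<alpha>': "- y < ereal \<alpha>'" "\<alpha>' < \<alpha>"
      by (elim exE conjE) simp
    \<comment> \<open>One \<delta> absorbs the constant \<open>M\<close>, the other the
      normaliser.\<close>
    define \<delta> where "\<delta> = (\<alpha> - \<alpha>') / 2"
    have \<delta>: "0 < \<delta>" "\<alpha> = \<alpha>' + 2 * \<delta>" using \<alpha>'(2) by (simp_all add: \<delta>_def field_simps)
    have "ereal \<alpha> < offspring_rate Q x" if "x \<in> F" for x
      by (rule less_le_trans[OF \<alpha>(2) INF_lower[OF that]])
    from tree_prob_upper_bound[OF assms(3) F this]
    obtain M where M: "\<forall>\<^sub>F n in sequentially. \<forall>a. tree_prob Q n a F \<le> M * exp (- (real n * \<alpha>))" by blast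
    have "\<forall>\<^sub>F n in sequentially. n \<in> S \<longrightarrow> ereal (1 / real n) * log_prob (?P n F) < y"
      using M denom[OF \<delta>(1)] eventually_exp_le[OF \<delta>(1) zero_less_one, of M]
    proof eventually_elim
      case (elim n)
      show ?case
      proof
        assume n: "n \<in> S"
        note n0 = S0[OF n]
        have rU: "0 < ?r n UNIV" using n S by simp
        have "?r n F \<le> M * exp (- (real n * \<alpha>))" using elim(1) by (intro root_prob_le) blast
        also have "\<dots> = (M * exp (- (real n * \<delta>))) * (exp (- (real n * \<delta>)) * exp (- (real n * \<alpha>')))"
          by (simp add: \<delta>(2) exp_add[symmetric] algebra_simps)
        also have "\<dots> \<le> 1 * (exp (- (real n * \<delta>)) * exp (- (real n * \<alpha>')))"
          using elim(3) by (intro mult_right_mono) auto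
        also have "\<dots> \<le> ?r n UNIV * exp (- (real n * \<alpha>'))"
          using elim(2) n by (simp add: mult_right_mono)
        finally have le: "?P n F \<le> exp (- (real n * \<alpha>'))"
          unfolding P using rU by (simp add: pos_divide_le_eq mult.commute)
        show "ereal (1 / real n) * log_prob (?P n F) < y"
        proof (cases "?P n F \<le> 0")
          case True
          have "ereal (1 / real n) * log_prob (?P n F) = - \<infinity>" using True n0 by (simp add: log_prob_def)
          \<comment> \<open>\<open>y\<close> cannot be minus infinity since \<open>- y\<close> lies
            below a real number, so a null probability satisfies the strict inequality.\<close>
          moreover have "- \<infinity> < y" using \<alpha>'(1) by (cases y) auto
          ultimately show ?thesis by (simp only:)
        next
          case False
          then have "ln (?P n F) \<le> ln (exp (- (real n * \<alpha>')))" using le by (intro ln_mono) auto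
          then have "1 / real n * ln (?P n F) \<le> - \<alpha>'" using n0 by (simp add: field_simps)
          then have "ereal (1 / real n) * log_prob (?P n F) \<le> ereal (- \<alpha>')"
            using False by (simp add: log_prob_def)
          also have "\<dots> < y" using \<alpha>'(1) by (cases y) auto
          finally show ?thesis .
        qed
      qed
    qed
    then show "\<forall>\<^sub>F n in ?L. ereal (1 / real n) * log_prob (?P n F) < y"
      by (simp add: eventually_inf_principal)
  qed
  have lower: "- (INF x\<in>G. offspring_rate Q x) \<le> Liminf ?L (\<lambda>n. ereal (1 / real n) * log_prob (?P n G))"
    if G: "openin ?X G" for G
    unfolding le_Liminf_iff
  proof (intro allI impI)
    fix y assume y: "y < - (INF x\<in>G. offspring_rate Q x)"
    then have "(INF x\<in>G. offspring_rate Q x) < - y" by (simp add: ereal_less_uminus_reorder)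
    then obtain \<nu> where \<nu>: "\<nu> \<in> G" "offspring_rate Q \<nu> < - y"
      unfolding INF_less_iff by (elim bexE)
    from ereal_dense2[OF \<nu>(2)] obtain z where z: "offspring_rate Q \<nu> < ereal z" "ereal z < - y"
      by (elim exE conjE)
    from ereal_dense2[OF z(1)] obtain J where J: "offspring_rate Q \<nu> < ereal J" "J < z"
      by (elim exE conjE) simp
    \<comment> \<open>The gap between \<open>J\<close> and \<open>z\<close> serves as the allowance
      of the lower bound. Division by the normaliser, which is at most 1, only enlarges the
      probability afterwards.\<close>
    have "\<forall>\<^sub>F n in sequentially. 0 < ?r n UNIV \<longrightarrow> exp (- (real n * (J + (z - J)))) \<le> ?r n G"
      using J(2) by (intro root_prob_lower_bound[OF assms(1-3) inf G \<nu>(1) less_imp_le[OF J(1)]]) simp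
    then have "\<forall>\<^sub>F n in sequentially. n \<in> S \<longrightarrow> y < ereal (1 / real n) * log_prob (?P n G)"
    proof eventually_elim
      case (elim n)
      show ?case
      proof
        assume n: "n \<in> S"
        note n0 = S0[OF n]
        have rU: "0 < ?r n UNIV" using n S by simp
        have "exp (- (real n * z)) \<le> ?r n G" using elim rU by simp
        also have "\<dots> \<le> ?P n G"
          unfolding P using rU one[of n] root_prob_nonneg[of \<mu> Q n G]
          by (simp add: pos_le_divide_eq mult_left_le)
        finally have le: "exp (- (real n * z)) \<le> ?P n G" .
        then have pos: "0 < ?P n G" by (rule less_le_trans[OF exp_gt_zero])
        have "ln (exp (- (real n * z))) \<le> ln (?P n G)" using le pos by (intro ln_mono) auto
        then have "- z \<le> 1 / real n * ln (?P n G)" using n0 by (simp add: field_simps)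
        then have "ereal (- z) \<le> ereal (1 / real n) * log_prob (?P n G)"
          using pos by (simp add: log_prob_def)
        moreover have "y < ereal (- z)" using z(2) by (cases y) auto
        ultimately show "y < ereal (1 / real n) * log_prob (?P n G)" by (rule less_le_trans[rotated])
      qed
    qed
    then show "\<forall>\<^sub>F n in ?L. y < ereal (1 / real n) * log_prob (?P n G)"
      by (simp add: eventually_inf_principal)
  qed
  have "rate_function ?X (offspring_rate Q)"
    using good_offspring_rate[OF assms(3)] by (simp add: good_rate_function_def)
  then have "large_deviation_principle ?X S ?P (\<lambda>n. real n) (offspring_rate Q)"
    using upper lower by (simp add: large_deviation_principle_def)
  then show ?thesis using good_offspring_rate[OF assms(3)] convex_offspring_rate by blast
qed

end
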